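(* Let $i:Z\hookrightarrow X$ be a closed immersion with open complement $j:U\hookrightarrow X$, and let $Y$ be any space. Write $I:Z\times Y\hookrightarrow X\times Y$ for the product immersion and $J:U\times Y\hookrightarrow X\times Y$ for its open complement (with the recollement axioms holding for $(i,j)$ and $(I,J)$). Let $A\in\mathcal C(X)$, $B\in\mathcal C(Y)$, let $c\in H^d(X;A)$ satisfy $j^*c=0$, and let $\beta\in H^e(Y;B)$. Assume that the external product is compatible with closed pushforward and extraordinary pullback for $I$, in the sense that there are functorial isomorphisms $$(i_*C)\boxtimes B\simeq I_*(C\boxtimes B),\qquad I^!(A\boxtimes B)\simeq i^!A\boxtimes B,$$ compatible with the corresponding counits. Then $J^*(c\boxtimes\beta)=0$, and external product with $\beta$ induces a natural morphism of torsors $$\mathrm{Loc}_Z^{\mathrm{tor}}(c)\longrightarrow\mathrm{Loc}_{Z\times Y}^{\mathrm{tor}}(c\boxtimes\beta),\qquad\lambda\longmapsto\lambda\boxtimes\beta$$ (not asserted to be surjective). In particular, whenever the two torsors are singletons, $\mathrm{Loc}_{Z\times Y}(c\boxtimes\beta)=\mathrm{Loc}_Z(c)\boxtimes\beta$.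
   Context: Setting: to each space $X$ is attached a stable triangulated category $\mathcal C(X)$ with a symmetric monoidal structure $(\otimes,\mathbf 1_X)$. Each morphism $f:X\to Y$ has exact functors $f^*\dashv f_*$, with $f^*$ symmetric monoidal, so $f^*\mathbf 1_Y\simeq\mathbf 1_X$. External product: a bi-exact bifunctor $\boxtimes:\mathcal C(X)\times\mathcal C(Y)\to\mathcal C(X\times Y)$, compatible with pullbacks and pushforwards in the usual six-functor sense, with $\mathbf 1_X\boxtimes\mathbf 1_Y\simeq\mathbf 1_{X\times Y}$. For $\alpha\in H^p(X;A)$, $\beta\in H^q(Y;B)$ the class $\alpha\boxtimes\beta\in H^{p+q}(X\times Y;A\boxtimes B)$ is the composite $\mathbf 1_{X\times Y}\simeq\mathbf 1_X\boxtimes\mathbf 1_Y\xrightarrow{\alpha\boxtimes\beta}A[p]\boxtimes B[q]\simeq(A\boxtimes B)[p+q]$. For $\lambda:\mathbf 1_Z\to i^!A[d]$, $\lambda\boxtimes\beta:\mathbf 1_{Z\times Y}\to(i^!A\boxtimes B)[d+e]\simeq I^!(A\boxtimes B)[d+e]$ is defined in the same way. Recollement axioms for a closed immersion $i:Z\hookrightarrow X$ with open complement $j:U=X\setminus Z\hookrightarrow X$: adjunctions $i^*\dashv i_*\dashv i^!$ and $j_!\dashv j^*\dashv j_*$; $i_*$ and $j_!$ fully faithful; $j^*i_*=0$ and $i^*j_!=0$; functorial distinguished triangles $j_!j^*M\to M\to i_*i^*M\xrightarrow{+1}$ and $i_*i^!M\to M\to j_*j^*M\xrightarrow{+1}$ (maps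 given by adjunction units and counits). Definitions: $H^d(X;A)=\mathrm{Hom}_{\mathcal C(X)}(\mathbf 1_X,A[d])$; $H_Z^d(X;A)=\mathrm{Hom}_{\mathcal C(X)}(\mathbf 1_X,i_*i^!A[d])$; $\mathrm{forg}:H_Z^d(X;A)\to H^d(X;A)$ is induced by the counit $i_*i^!A\to A$. For $c$ with $j^*c=0$, $\mathrm{Lift}_Z^d(c)=\{\widetilde c\in H_Z^d(X;A)\mid\mathrm{forg}(\widetilde c)=c\}$, and $\mathrm{Loc}_Z^{\mathrm{tor}}(c)\subset\mathrm{Hom}_{\mathcal C(Z)}(\mathbf 1_Z,i^!A[d])$ is its image under the adjunction isomorphism $H_Z^d(X;A)\cong\mathrm{Hom}_{\mathcal C(Z)}(\mathbf 1_Z,i^!A[d])$; if it is a singleton its element is $\mathrm{Loc}_Z(c)$. It is a torsor under the (adjoint of the) group $\ker(\mathrm{forg})=\mathrm{im}(\delta:H^{d-1}(U;j^*A)\to H_Z^d(X;A))$. A morphism of torsors is a map equivariant with respect to the induced homomorphism of acting groups. *)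

theory Defs
  imports "HOL-Algebra.Group_Action"
begin

section \<open>Categories, functors and natural transformations\<close>

record ('o, 'm) category =
  Obj :: "'o set"
  Arr :: "'m set"
  Dom :: "'m \<Rightarrow> 'o"
  Cod :: "'m \<Rightarrow> 'o"
  Id :: "'o \<Rightarrow> 'm"
  Comp :: "'m \<Rightarrow> 'm \<Rightarrow> 'm"  (infixr "\<cdot>\<index>" 70)

definition Hom :: "('o, 'm, 'z) category_scheme \<Rightarrow> 'o \<Rightarrow> 'o \<Rightarrow> 'm set" where
  "Hom C A B = {f \<in> Arr C. Dom C f = A \<and> Cod C f = B}"

locale category =
  fixes C :: "('o, 'm, 'z) category_scheme" (structure)
  assumes dom_obj: "f \<in> Arr C \<Longrightarrow> Dom C f \<in> Obj C"
    and cod_obj: "f \<in> Arr C \<Longrightarrow> Cod C f \<in> Obj C"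
    and id_hom: "A \<in> Obj C \<Longrightarrow> Id C A \<in> Hom C A A"
    and comp_hom: "\<lbrakk>g \<in> Hom C B D; f \<in> Hom C A B\<rbrakk> \<Longrightarrow> g \<cdot> f \<in> Hom C A D"
    and comp_id_left: "f \<in> Hom C A B \<Longrightarrow> Id C B \<cdot> f = f"
    and comp_id_right: "f \<in> Hom C A B \<Longrightarrow> f \<cdot> Id C A = f"
    and comp_assoc: "\<lbrakk>h \<in> Hom C D E; g \<in> Hom C B D; f \<in> Hom C A B\<rbrakk>
      \<Longrightarrow> (h \<cdot> g) \<cdot> f = h \<cdot> (g \<cdot> f)"

definition inverse_arrows :: "('o, 'm, 'z) category_scheme \<Rightarrow> 'm \<Rightarrow> 'm \<Rightarrow> bool" where
  "inverse_arrows C f g \<longleftrightarrow>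
     f \<in> Arr C \<and> g \<in> Hom C (Cod C f) (Dom C f) \<and>
     g \<cdot>\<^bsub>C\<^esub> f = Id C (Dom C f) \<and> f \<cdot>\<^bsub>C\<^esub> g = Id C (Cod C f)"

definition is_iso :: "('o, 'm, 'z) category_scheme \<Rightarrow> 'm \<Rightarrow> bool" where
  "is_iso C f \<longleftrightarrow> (\<exists>g. inverse_arrows C f g)"

definition inv_arr :: "('o, 'm, 'z) category_scheme \<Rightarrow> 'm \<Rightarrow> 'm" where
  "inv_arr C f = (THE g. inverse_arrows C f g)"

definition Isos :: "('o, 'm, 'z) category_scheme \<Rightarrow> 'o \<Rightarrow> 'o \<Rightarrow> 'm set" where
  "Isos C A B = {f \<in> Hom C A B. is_iso C f}"

definition zero_object :: "('o, 'm, 'z) category_scheme \<Rightarrow> 'o \<Rightarrow> bool" where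
  "zero_object C O' \<longleftrightarrow>
     O' \<in> Obj C \<and> (\<forall>A\<in>Obj C. (\<exists>!f. f \<in> Hom C O' A) \<and> (\<exists>!f. f \<in> Hom C A O'))"

record ('o, 'm) cfun =
  FO :: "'o \<Rightarrow> 'o"
  FM :: "'m \<Rightarrow> 'm"

definition id_fun :: "('o, 'm) cfun" where
  "id_fun = \<lparr>FO = (\<lambda>A. A), FM = (\<lambda>f. f)\<rparr>"

definition comp_fun ::
  "('o, 'm, 'y) cfun_scheme \<Rightarrow> ('o, 'm, 'z) cfun_scheme \<Rightarrow> ('o, 'm) cfun" where
  "comp_fun G F = \<lparr>FO = (\<lambda>A. FO G (FO F A)), FM = (\<lambda>f. FM G (FM F f))\<rparr>"

locale is_functor =
  fixes C :: "('o, 'm, 'y) category_scheme"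
    and D :: "('o, 'm, 'z) category_scheme"
    and F :: "('o, 'm, 'w) cfun_scheme"
  assumes obj: "A \<in> Obj C \<Longrightarrow> FO F A \<in> Obj D"
    and hom: "f \<in> Hom C A B \<Longrightarrow> FM F f \<in> Hom D (FO F A) (FO F B)"
    and id: "A \<in> Obj C \<Longrightarrow> FM F (Id C A) = Id D (FO F A)"
    and comp: "\<lbrakk>g \<in> Hom C B E; f \<in> Hom C A B\<rbrakk>
      \<Longrightarrow> FM F (g \<cdot>\<^bsub>C\<^esub> f) = FM F g \<cdot>\<^bsub>D\<^esub> FM F f"

definition fully_faithful ::
  "('o, 'm, 'y) category_scheme \<Rightarrow> ('o, 'm, 'z) category_scheme
    \<Rightarrow> ('o, 'm, 'w) cfun_scheme \<Rightarrow> bool" where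
  "fully_faithful C D F \<longleftrightarrow>
     (\<forall>A\<in>Obj C. \<forall>B\<in>Obj C. bij_betw (FM F) (Hom C A B) (Hom D (FO F A) (FO F B)))"

locale natural_trans =
  fixes C :: "('o, 'm, 'y) category_scheme"
    and D :: "('o, 'm, 'z) category_scheme"
    and F :: "('o, 'm, 'v) cfun_scheme"
    and G :: "('o, 'm, 'w) cfun_scheme"
    and t :: "'o \<Rightarrow> 'm"
  assumes hom: "A \<in> Obj C \<Longrightarrow> t A \<in> Hom D (FO F A) (FO G A)"
    and natural: "f \<in> Hom C A B \<Longrightarrow> t B \<cdot>\<^bsub>D\<^esub> FM F f = FM G f \<cdot>\<^bsub>D\<^esub> t A"

locale natural_iso = natural_trans +
  assumes iso: "A \<in> Obj C \<Longrightarrow> is_iso D (t A)"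

locale adjunction =
  fixes C :: "('o, 'm, 'y) category_scheme"
    and D :: "('o, 'm, 'z) category_scheme"
    and L :: "('o, 'm, 'v) cfun_scheme"
    and R :: "('o, 'm, 'w) cfun_scheme"
    and unit :: "'o \<Rightarrow> 'm"
    and counit :: "'o \<Rightarrow> 'm"
  assumes left_functor: "is_functor C D L"
    and right_functor: "is_functor D C R"
    and unit_natural: "natural_trans C C id_fun (comp_fun R L) unit"
    and counit_natural: "natural_trans D D (comp_fun L R) id_fun counit"
    and triangle_left: "A \<in> Obj C \<Longrightarrow> counit (FO L A) \<cdot>\<^bsub>D\<^esub> FM L (unit A) = Id D (FO L A)"
    and triangle_right: "B \<in> Obj D \<Longrightarrow> FM R (counit B) \<cdot>\<^bsub>C\<^esub> unit (FO R B) = Id C (FO R B)"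

record ('o, 'm) bifun =
  BO :: "'o \<Rightarrow> 'o \<Rightarrow> 'o"
  BM :: "'m \<Rightarrow> 'm \<Rightarrow> 'm"

locale bifunctor =
  fixes C1 :: "('o, 'm, 'x) category_scheme"
    and C2 :: "('o, 'm, 'y) category_scheme"
    and D :: "('o, 'm, 'z) category_scheme"
    and T :: "('o, 'm, 'w) bifun_scheme"
  assumes obj: "\<lbrakk>A \<in> Obj C1; B \<in> Obj C2\<rbrakk> \<Longrightarrow> BO T A B \<in> Obj D"
    and hom: "\<lbrakk>f \<in> Hom C1 A A'; g \<in> Hom C2 B B'\<rbrakk> \<Longrightarrow> BM T f g \<in> Hom D (BO T A B) (BO T A' B')"
    and id: "\<lbrakk>A \<in> Obj C1; B \<in> Obj C2\<rbrakk> \<Longrightarrow> BM T (Id C1 A) (Id C2 B) = Id D (BO T A B)"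
    and comp: "\<lbrakk>f \<in> Hom C1 A A'; f' \<in> Hom C1 A' A''; g \<in> Hom C2 B B'; g' \<in> Hom C2 B' B''\<rbrakk>
      \<Longrightarrow> BM T (f' \<cdot>\<^bsub>C1\<^esub> f) (g' \<cdot>\<^bsub>C2\<^esub> g) = BM T f' g' \<cdot>\<^bsub>D\<^esub> BM T f g"

text \<open>Isomorphisms of bifunctors; \<open>P\<close> and \<open>Q\<close> need not be bifunctors given as such, only
  parallel assignments on objects and on arrows.\<close>

locale bi_natural_iso =
  fixes C1 :: "('o, 'm, 'x) category_scheme"
    and C2 :: "('o, 'm, 'y) category_scheme"
    and D :: "('o, 'm, 'z) category_scheme"
    and P :: "('o, 'm, 'v) bifun_scheme"
    and Q :: "('o, 'm, 'w) bifun_scheme"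
    and t :: "'o \<Rightarrow> 'o \<Rightarrow> 'm"
  assumes iso: "\<lbrakk>A \<in> Obj C1; B \<in> Obj C2\<rbrakk> \<Longrightarrow> t A B \<in> Isos D (BO P A B) (BO Q A B)"
    and natural: "\<lbrakk>f \<in> Hom C1 A A'; g \<in> Hom C2 B B'\<rbrakk>
      \<Longrightarrow> t A' B' \<cdot>\<^bsub>D\<^esub> BM P f g = BM Q f g \<cdot>\<^bsub>D\<^esub> t A B"

definition precomp2 ::
  "('o, 'm, 'x) bifun_scheme \<Rightarrow> ('o, 'm, 'y) cfun_scheme \<Rightarrow> ('o, 'm, 'z) cfun_scheme
    \<Rightarrow> ('o, 'm) bifun" where
  "precomp2 T F G =
     \<lparr>BO = (\<lambda>A B. BO T (FO F A) (FO G B)), BM = (\<lambda>f g. BM T (FM F f) (FM G g))\<rparr>"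

definition postcomp2 ::
  "('o, 'm, 'x) cfun_scheme \<Rightarrow> ('o, 'm, 'y) bifun_scheme \<Rightarrow> ('o, 'm) bifun" where
  "postcomp2 F T = \<lparr>BO = (\<lambda>A B. FO F (BO T A B)), BM = (\<lambda>f g. FM F (BM T f g))\<rparr>"


section \<open>Triangulated categories and exact functors\<close>

text \<open>As usual, the translation functor is taken to be an automorphism of the category, so that
  its powers \<open>A \<mapsto> A[n]\<close> form a strict action of the integers; \<open>ShO\<close> and \<open>ShM\<close> are the powers on
  objects and arrows. An element \<open>(u, v, w)\<close> of \<open>Tri\<close> is a triangle \<open>A \<rightarrow> B \<rightarrow> D \<rightarrow> A[1]\<close>.\<close>

record ('o, 'm) tri_category = "('o, 'm) category" +
  Add :: "'m \<Rightarrow> 'm \<Rightarrow> 'm"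
  Zero :: "'o \<Rightarrow> 'o \<Rightarrow> 'm"
  ShO :: "int \<Rightarrow> 'o \<Rightarrow> 'o"
  ShM :: "int \<Rightarrow> 'm \<Rightarrow> 'm"
  Tri :: "('m \<times> 'm \<times> 'm) set"

definition hom_group :: "('o, 'm, 'z) tri_category_scheme \<Rightarrow> 'o \<Rightarrow> 'o \<Rightarrow> 'm monoid" where
  "hom_group C A B = \<lparr>carrier = Hom C A B, mult = Add C, one = Zero C A B\<rparr>"

definition neg :: "('o, 'm, 'z) tri_category_scheme \<Rightarrow> 'm \<Rightarrow> 'm" where
  "neg C f = inv\<^bsub>hom_group C (Dom C f) (Cod C f)\<^esub> f"

definition shift :: "('o, 'm, 'z) tri_category_scheme \<Rightarrow> int \<Rightarrow> ('o, 'm) cfun" where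
  "shift C n = \<lparr>FO = ShO C n, FM = ShM C n\<rparr>"

definition additive_functor ::
  "('o, 'm, 'y) tri_category_scheme \<Rightarrow> ('o, 'm, 'z) tri_category_scheme
    \<Rightarrow> ('o, 'm, 'w) cfun_scheme \<Rightarrow> bool" where
  "additive_functor C D F \<longleftrightarrow>
     is_functor C D F \<and>
     (\<forall>A B f g. f \<in> Hom C A B \<longrightarrow> g \<in> Hom C A B \<longrightarrow> FM F (Add C f g) = Add D (FM F f) (FM F g))"

locale additive_category = category C
  for C :: "('o, 'm, 'z) tri_category_scheme" (structure) +
  assumes hom_comm_group: "\<lbrakk>A \<in> Obj C; B \<in> Obj C\<rbrakk> \<Longrightarrow> comm_group (hom_group C A B)"
    and comp_add_left: "\<lbrakk>g \<in> Hom C B D; g' \<in> Hom C B D; f \<in> Hom C A B\<rbrakk>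
      \<Longrightarrow> Add C g g' \<cdot> f = Add C (g \<cdot> f) (g' \<cdot> f)"
    and comp_add_right: "\<lbrakk>g \<in> Hom C B D; f \<in> Hom C A B; f' \<in> Hom C A B\<rbrakk>
      \<Longrightarrow> g \<cdot> Add C f f' = Add C (g \<cdot> f) (g \<cdot> f')"
    and ex_zero_object: "\<exists>O'. zero_object C O'"
    and ex_biproduct: "\<lbrakk>A \<in> Obj C; B \<in> Obj C\<rbrakk> \<Longrightarrow>
      \<exists>P\<in>Obj C. \<exists>i1\<in>Hom C A P. \<exists>i2\<in>Hom C B P. \<exists>p1\<in>Hom C P A. \<exists>p2\<in>Hom C P B.
        p1 \<cdot> i1 = Id C A \<and> p2 \<cdot> i2 = Id C B \<and> p1 \<cdot> i2 = Zero C B A \<and> p2 \<cdot> i1 = Zero C A B \<and>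
        Add C (i1 \<cdot> p1) (i2 \<cdot> p2) = Id C P"

locale triangulated_category = additive_category C
  for C :: "('o, 'm, 'z) tri_category_scheme" (structure) +
  assumes shift_additive: "additive_functor C C (shift C n)"
    and shift_obj_0: "A \<in> Obj C \<Longrightarrow> ShO C 0 A = A"
    and shift_arr_0: "f \<in> Arr C \<Longrightarrow> ShM C 0 f = f"
    and shift_obj_add: "A \<in> Obj C \<Longrightarrow> ShO C (m + n) A = ShO C m (ShO C n A)"
    and shift_arr_add: "f \<in> Arr C \<Longrightarrow> ShM C (m + n) f = ShM C m (ShM C n f)"
    and tri_hom: "(u, v, w) \<in> Tri C \<Longrightarrow>
      \<exists>A B D. u \<in> Hom C A B \<and> v \<in> Hom C B D \<and> w \<in> Hom C D (ShO C 1 A)"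
    and tri_iso_closed: "\<lbrakk>(u, v, w) \<in> Tri C;
        u \<in> Hom C A B; v \<in> Hom C B D; w \<in> Hom C D (ShO C 1 A);
        u' \<in> Hom C A' B'; v' \<in> Hom C B' D'; w' \<in> Hom C D' (ShO C 1 A');
        a \<in> Isos C A A'; b \<in> Isos C B B'; d \<in> Isos C D D';
        b \<cdot> u = u' \<cdot> a; d \<cdot> v = v' \<cdot> b; ShM C 1 a \<cdot> w = w' \<cdot> d\<rbrakk>
      \<Longrightarrow> (u', v', w') \<in> Tri C"
    and tri_identity: "\<lbrakk>A \<in> Obj C; zero_object C O'\<rbrakk>
      \<Longrightarrow> (Id C A, Zero C A O', Zero C O' (ShO C 1 A)) \<in> Tri C"
    and tri_cone: "u \<in> Arr C \<Longrightarrow> \<exists>v w. (u, v, w) \<in> Tri C"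
    and tri_rotate: "u \<in> Arr C \<Longrightarrow> v \<in> Arr C \<Longrightarrow> w \<in> Hom C (Cod C v) (ShO C 1 (Dom C u)) \<Longrightarrow>
      (u, v, w) \<in> Tri C \<longleftrightarrow> (v, w, neg C (ShM C 1 u)) \<in> Tri C"
    and tri_morphism: "\<lbrakk>(u, v, w) \<in> Tri C; (u', v', w') \<in> Tri C;
        a \<in> Hom C (Dom C u) (Dom C u'); b \<in> Hom C (Cod C u) (Cod C u'); b \<cdot> u = u' \<cdot> a\<rbrakk>
      \<Longrightarrow> \<exists>d \<in> Hom C (Cod C v) (Cod C v'). d \<cdot> v = v' \<cdot> b \<and> ShM C 1 a \<cdot> w = w' \<cdot> d"
    and octahedral: "\<lbrakk>f \<in> Hom C A B; g \<in> Hom C B D;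
        (f, f', f'') \<in> Tri C; (g, g', g'') \<in> Tri C; (g \<cdot> f, h', h'') \<in> Tri C\<rbrakk>
      \<Longrightarrow> \<exists>u \<in> Hom C (Cod C f') (Cod C h'). \<exists>v \<in> Hom C (Cod C h') (Cod C g').
        (u, v, ShM C 1 f' \<cdot> g'') \<in> Tri C \<and>
        u \<cdot> f' = h' \<cdot> g \<and> h'' \<cdot> u = f'' \<and> v \<cdot> h' = g' \<and> g'' \<cdot> v = ShM C 1 f \<cdot> h''"

text \<open>An exact functor carries its comparison isomorphism \<open>FSh F A : F(A[1]) \<rightarrow> (F A)[1]\<close>.\<close>

record ('o, 'm) exfun = "('o, 'm) cfun" +
  FSh :: "'o \<Rightarrow> 'm"

locale exact_functor =
  fixes C :: "('o, 'm, 'y) tri_category_scheme"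
    and D :: "('o, 'm, 'z) tri_category_scheme"
    and F :: "('o, 'm, 'w) exfun_scheme"
  assumes additive: "additive_functor C D F"
    and shift_iso: "natural_iso C D (comp_fun F (shift C 1)) (comp_fun (shift D 1) F) (FSh F)"
    and triangles: "(u, v, w) \<in> Tri C
      \<Longrightarrow> (FM F u, FM F v, FSh F (Dom C u) \<cdot>\<^bsub>D\<^esub> FM F w) \<in> Tri D"

text \<open>The induced comparison \<open>F(A[n]) \<rightarrow> (F A)[n]\<close>: the \<open>n\<close>-fold iterate of \<open>FSh\<close> for \<open>n \<ge> 0\<close>,
  and for \<open>n = - k < 0\<close> the \<open>n\<close>-th shift of the inverse of
  \<open>F A = F(A[n][k]) \<rightarrow> (F(A[n]))[k]\<close>.\<close>

primrec shift_cmp_nat ::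
  "('o, 'm, 'y) tri_category_scheme \<Rightarrow> ('o, 'm, 'z) tri_category_scheme
    \<Rightarrow> ('o, 'm, 'w) exfun_scheme \<Rightarrow> nat \<Rightarrow> 'o \<Rightarrow> 'm" where
  "shift_cmp_nat C D F 0 A = Id D (FO F A)"
| "shift_cmp_nat C D F (Suc n) A =
     ShM D 1 (shift_cmp_nat C D F n A) \<cdot>\<^bsub>D\<^esub> FSh F (ShO C (int n) A)"

definition shift_cmp ::
  "('o, 'm, 'y) tri_category_scheme \<Rightarrow> ('o, 'm, 'z) tri_category_scheme
    \<Rightarrow> ('o, 'm, 'w) exfun_scheme \<Rightarrow> int \<Rightarrow> 'o \<Rightarrow> 'm" where
  "shift_cmp C D F n A =
     (if 0 \<le> n then shift_cmp_nat C D F (nat n) A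
      else ShM D n (inv_arr D (shift_cmp_nat C D F (nat (- n)) (ShO C n A))))"

text \<open>An adjunction between exact functors, whose unit and counit commute with the shifts.\<close>

locale exact_adjunction = adjunction C D L R unit counit
  for C :: "('o, 'm, 'y) tri_category_scheme"
    and D :: "('o, 'm, 'z) tri_category_scheme"
    and L :: "('o, 'm, 'v) exfun_scheme"
    and R :: "('o, 'm, 'w) exfun_scheme"
    and unit :: "'o \<Rightarrow> 'm"
    and counit :: "'o \<Rightarrow> 'm" +
  assumes left_exact_functor: "exact_functor C D L"
    and right_exact_functor: "exact_functor D C R"
    and unit_shift: "A \<in> Obj C \<Longrightarrow>
      FSh R (FO L A) \<cdot>\<^bsub>C\<^esub> FM R (FSh L A) \<cdot>\<^bsub>C\<^esub> unit (ShO C 1 A) = ShM C 1 (unit A)"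
    and counit_shift: "B \<in> Obj D \<Longrightarrow>
      ShM D 1 (counit B) \<cdot>\<^bsub>D\<^esub> FSh L (FO R B) \<cdot>\<^bsub>D\<^esub> FM L (FSh R B) = counit (ShO D 1 B)"

text \<open>A bi-exact bifunctor carries \<open>BL T A B : T(A[1], B) \<rightarrow> T(A, B)[1]\<close> and
  \<open>BR T A B : T(A, B[1]) \<rightarrow> T(A, B)[1]\<close>; the two resulting isomorphisms
  \<open>T(A[1], B[1]) \<rightarrow> T(A, B)[2]\<close> differ by the usual sign.\<close>

record ('o, 'm) biexfun = "('o, 'm) bifun" +
  BL :: "'o \<Rightarrow> 'o \<Rightarrow> 'm"
  BR :: "'o \<Rightarrow> 'o \<Rightarrow> 'm"

definition fix_right ::
  "('o, 'm, 'y) category_scheme \<Rightarrow> ('o, 'm, 'w) biexfun_scheme \<Rightarrow> 'o \<Rightarrow> ('o, 'm) exfun" where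
  "fix_right C2 T B = \<lparr>FO = (\<lambda>A. BO T A B), FM = (\<lambda>f. BM T f (Id C2 B)), FSh = (\<lambda>A. BL T A B)\<rparr>"

definition fix_left ::
  "('o, 'm, 'x) category_scheme \<Rightarrow> ('o, 'm, 'w) biexfun_scheme \<Rightarrow> 'o \<Rightarrow> ('o, 'm) exfun" where
  "fix_left C1 T A = \<lparr>FO = (\<lambda>B. BO T A B), FM = (\<lambda>g. BM T (Id C1 A) g), FSh = (\<lambda>B. BR T A B)\<rparr>"

locale biexact_bifunctor = bifunctor C1 C2 D T
  for C1 :: "('o, 'm, 'x) tri_category_scheme"
    and C2 :: "('o, 'm, 'y) tri_category_scheme"
    and D :: "('o, 'm, 'z) tri_category_scheme"
    and T :: "('o, 'm, 'w) biexfun_scheme" +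
  assumes exact_left: "B \<in> Obj C2 \<Longrightarrow> exact_functor C1 D (fix_right C2 T B)"
    and exact_right: "A \<in> Obj C1 \<Longrightarrow> exact_functor C2 D (fix_left C1 T A)"
    and left_natural: "bi_natural_iso C1 C2 D
      (precomp2 T (shift C1 1) id_fun) (postcomp2 (shift D 1) T) (BL T)"
    and right_natural: "bi_natural_iso C1 C2 D
      (precomp2 T id_fun (shift C2 1)) (postcomp2 (shift D 1) T) (BR T)"
    and anticommute: "\<lbrakk>A \<in> Obj C1; B \<in> Obj C2\<rbrakk> \<Longrightarrow>
      ShM D 1 (BR T A B) \<cdot>\<^bsub>D\<^esub> BL T A (ShO C2 1 B) =
      neg D (ShM D 1 (BL T A B) \<cdot>\<^bsub>D\<^esub> BR T (ShO C1 1 A) B)"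

text \<open>The isomorphism \<open>T(A[p], B[q]) \<rightarrow> T(A, B)[p + q]\<close>. By the sign above it depends on the order
  in which the shifts are moved out; the convention is that the left one goes first.\<close>

definition bishift_cmp ::
  "('o, 'm, 'x) tri_category_scheme \<Rightarrow> ('o, 'm, 'y) tri_category_scheme
    \<Rightarrow> ('o, 'm, 'z) tri_category_scheme \<Rightarrow> ('o, 'm, 'w) biexfun_scheme
    \<Rightarrow> int \<Rightarrow> int \<Rightarrow> 'o \<Rightarrow> 'o \<Rightarrow> 'm" where
  "bishift_cmp C1 C2 D T p q A B =
     ShM D p (shift_cmp C2 D (fix_left C1 T A) q B) \<cdot>\<^bsub>D\<^esub>
     shift_cmp C1 D (fix_right C2 T (ShO C2 q B)) p A"


section \<open>Symmetric monoidal structures\<close>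

record ('o, 'm) tt_category = "('o, 'm) tri_category" +
  Ten :: "('o, 'm) bifun"
  One :: "'o"
  Assoc :: "'o \<Rightarrow> 'o \<Rightarrow> 'o \<Rightarrow> 'm"
  LUnit :: "'o \<Rightarrow> 'm"
  RUnit :: "'o \<Rightarrow> 'm"
  Sym :: "'o \<Rightarrow> 'o \<Rightarrow> 'm"

abbreviation TenO :: "('o, 'm, 'z) tt_category_scheme \<Rightarrow> 'o \<Rightarrow> 'o \<Rightarrow> 'o" where
  "TenO C \<equiv> BO (Ten C)"

abbreviation TenM :: "('o, 'm, 'z) tt_category_scheme \<Rightarrow> 'm \<Rightarrow> 'm \<Rightarrow> 'm" where
  "TenM C \<equiv> BM (Ten C)"

locale symmetric_monoidal =
  fixes C :: "('o, 'm, 'z) tt_category_scheme" (structure)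
  assumes tensor: "bifunctor C C C (Ten C)"
    and one_obj: "One C \<in> Obj C"
    and assoc_iso: "\<lbrakk>X \<in> Obj C; Y \<in> Obj C; Z \<in> Obj C\<rbrakk>
      \<Longrightarrow> Assoc C X Y Z \<in> Isos C (TenO C (TenO C X Y) Z) (TenO C X (TenO C Y Z))"
    and assoc_natural: "\<lbrakk>f \<in> Hom C X X'; g \<in> Hom C Y Y'; h \<in> Hom C Z Z'\<rbrakk>
      \<Longrightarrow> Assoc C X' Y' Z' \<cdot> TenM C (TenM C f g) h = TenM C f (TenM C g h) \<cdot> Assoc C X Y Z"
    and lunit: "natural_iso C C
      \<lparr>FO = (\<lambda>X. TenO C (One C) X), FM = (\<lambda>f. TenM C (Id C (One C)) f)\<rparr> id_fun (LUnit C)"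
    and runit: "natural_iso C C
      \<lparr>FO = (\<lambda>X. TenO C X (One C)), FM = (\<lambda>f. TenM C f (Id C (One C)))\<rparr> id_fun (RUnit C)"
    and sym_iso: "bi_natural_iso C C C
      (Ten C) \<lparr>BO = (\<lambda>X Y. TenO C Y X), BM = (\<lambda>f g. TenM C g f)\<rparr> (Sym C)"
    and pentagon: "\<lbrakk>W \<in> Obj C; X \<in> Obj C; Y \<in> Obj C; Z \<in> Obj C\<rbrakk> \<Longrightarrow>
      Assoc C W X (TenO C Y Z) \<cdot> Assoc C (TenO C W X) Y Z =
      TenM C (Id C W) (Assoc C X Y Z) \<cdot> Assoc C W (TenO C X Y) Z \<cdot> TenM C (Assoc C W X Y) (Id C Z)"
    and triangle: "\<lbrakk>X \<in> Obj C; Y \<in> Obj C\<rbrakk> \<Longrightarrow>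
      TenM C (Id C X) (LUnit C Y) \<cdot> Assoc C X (One C) Y = TenM C (RUnit C X) (Id C Y)"
    and hexagon: "\<lbrakk>X \<in> Obj C; Y \<in> Obj C; Z \<in> Obj C\<rbrakk> \<Longrightarrow>
      Assoc C Y Z X \<cdot> Sym C X (TenO C Y Z) \<cdot> Assoc C X Y Z =
      TenM C (Id C Y) (Sym C X Z) \<cdot> Assoc C Y X Z \<cdot> TenM C (Sym C X Y) (Id C Z)"
    and sym_involutive: "\<lbrakk>X \<in> Obj C; Y \<in> Obj C\<rbrakk> \<Longrightarrow> Sym C Y X \<cdot> Sym C X Y = Id C (TenO C X Y)"

text \<open>A (strong) symmetric monoidal functor carries \<open>FMul F A B : F A \<otimes> F B \<rightarrow> F(A \<otimes> B)\<close> and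
  \<open>FOne F : 1 \<rightarrow> F 1\<close>.\<close>

record ('o, 'm) smexfun = "('o, 'm) exfun" +
  FMul :: "'o \<Rightarrow> 'o \<Rightarrow> 'm"
  FOne :: "'m"

locale symmetric_monoidal_functor =
  fixes C :: "('o, 'm, 'y) tt_category_scheme"
    and D :: "('o, 'm, 'z) tt_category_scheme"
    and F :: "('o, 'm, 'w) smexfun_scheme"
  assumes mul_iso: "bi_natural_iso C C D (precomp2 (Ten D) F F) (postcomp2 F (Ten C)) (FMul F)"
    and one_iso: "FOne F \<in> Isos D (One D) (FO F (One C))"
    and mul_assoc: "\<lbrakk>X \<in> Obj C; Y \<in> Obj C; Z \<in> Obj C\<rbrakk> \<Longrightarrow>
      FM F (Assoc C X Y Z) \<cdot>\<^bsub>D\<^esub> FMul F (TenO C X Y) Z \<cdot>\<^bsub>D\<^esub> TenM D (FMul F X Y) (Id D (FO F Z)) =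
      FMul F X (TenO C Y Z) \<cdot>\<^bsub>D\<^esub> TenM D (Id D (FO F X)) (FMul F Y Z) \<cdot>\<^bsub>D\<^esub>
        Assoc D (FO F X) (FO F Y) (FO F Z)"
    and mul_lunit: "X \<in> Obj C \<Longrightarrow>
      FM F (LUnit C X) \<cdot>\<^bsub>D\<^esub> FMul F (One C) X \<cdot>\<^bsub>D\<^esub> TenM D (FOne F) (Id D (FO F X)) =
      LUnit D (FO F X)"
    and mul_runit: "X \<in> Obj C \<Longrightarrow>
      FM F (RUnit C X) \<cdot>\<^bsub>D\<^esub> FMul F X (One C) \<cdot>\<^bsub>D\<^esub> TenM D (Id D (FO F X)) (FOne F) =
      RUnit D (FO F X)"
    and mul_sym: "\<lbrakk>X \<in> Obj C; Y \<in> Obj C\<rbrakk> \<Longrightarrow>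
      FM F (Sym C X Y) \<cdot>\<^bsub>D\<^esub> FMul F X Y = FMul F Y X \<cdot>\<^bsub>D\<^esub> Sym D (FO F X) (FO F Y)"


section \<open>Coefficient systems with pullback, pushforward and external product\<close>

record ('s, 'f) spaces = "('s, 'f) category" +
  Prod :: "'s \<Rightarrow> 's \<Rightarrow> 's"
  Pr1 :: "'s \<Rightarrow> 's \<Rightarrow> 'f"
  Pr2 :: "'s \<Rightarrow> 's \<Rightarrow> 'f"

locale category_with_products = category P
  for P :: "('s, 'f, 'z) spaces_scheme" (structure) +
  assumes prod_obj: "\<lbrakk>X \<in> Obj P; Y \<in> Obj P\<rbrakk> \<Longrightarrow> Prod P X Y \<in> Obj P"
    and pr1_hom: "\<lbrakk>X \<in> Obj P; Y \<in> Obj P\<rbrakk> \<Longrightarrow> Pr1 P X Y \<in> Hom P (Prod P X Y) X"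
    and pr2_hom: "\<lbrakk>X \<in> Obj P; Y \<in> Obj P\<rbrakk> \<Longrightarrow> Pr2 P X Y \<in> Hom P (Prod P X Y) Y"
    and prod_universal: "\<lbrakk>f \<in> Hom P W X; g \<in> Hom P W Y\<rbrakk> \<Longrightarrow>
      \<exists>!h. h \<in> Hom P W (Prod P X Y) \<and> Pr1 P X Y \<cdot> h = f \<and> Pr2 P X Y \<cdot> h = g"

definition prod_map :: "('s, 'f, 'z) spaces_scheme \<Rightarrow> 'f \<Rightarrow> 'f \<Rightarrow> 'f" where
  "prod_map P f g =
     (THE h. h \<in> Hom P (Prod P (Dom P f) (Dom P g)) (Prod P (Cod P f) (Cod P g)) \<and>
        Pr1 P (Cod P f) (Cod P g) \<cdot>\<^bsub>P\<^esub> h = f \<cdot>\<^bsub>P\<^esub> Pr1 P (Dom P f) (Dom P g) \<and>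
        Pr2 P (Cod P f) (Cod P g) \<cdot>\<^bsub>P\<^esub> h = g \<cdot>\<^bsub>P\<^esub> Pr2 P (Dom P f) (Dom P g))"

text \<open>For \<open>f : X \<rightarrow> X'\<close> and \<open>g : Y \<rightarrow> Y'\<close>:
  \<open>PPUnit f\<close> and \<open>PPCounit f\<close> belong to the adjunction of \<open>f\<^sup>*\<close> and \<open>f\<^sub>*\<close>;
  \<open>PullId X A : id\<^sup>* A \<rightarrow> A\<close>;
  \<open>ExtOne X Y : 1 \<rightarrow> 1 \<boxtimes> 1\<close>;
  \<open>ExtPull f g M N : (f \<times> g)\<^sup>*(M \<boxtimes> N) \<rightarrow> f\<^sup>* M \<boxtimes> g\<^sup>* N\<close>.\<close>

record ('s, 'f, 'o, 'm) coeff_system =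
  Sp :: "('s, 'f) spaces"
  Coef :: "'s \<Rightarrow> ('o, 'm) tt_category"
  Pull :: "'f \<Rightarrow> ('o, 'm) smexfun"
  Push :: "'f \<Rightarrow> ('o, 'm) exfun"
  PPUnit :: "'f \<Rightarrow> 'o \<Rightarrow> 'm"
  PPCounit :: "'f \<Rightarrow> 'o \<Rightarrow> 'm"
  PullId :: "'s \<Rightarrow> 'o \<Rightarrow> 'm"
  Ext :: "'s \<Rightarrow> 's \<Rightarrow> ('o, 'm) biexfun"
  ExtOne :: "'s \<Rightarrow> 's \<Rightarrow> 'm"
  ExtPull :: "'f \<Rightarrow> 'f \<Rightarrow> 'o \<Rightarrow> 'o \<Rightarrow> 'm"

text \<open>The exchange map \<open>f\<^sub>* M \<boxtimes> g\<^sub>* N \<rightarrow> (f \<times> g)\<^sub>*(M \<boxtimes> N)\<close> for pushforwards is the adjoint mate of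
  \<open>ExtPull\<close>, hence no further datum; it is not assumed to be invertible.\<close>

locale coefficient_system =
  fixes S :: "('s, 'f, 'o, 'm) coeff_system"
  assumes spaces: "category_with_products (Sp S)"
    and coef_triangulated: "X \<in> Obj (Sp S) \<Longrightarrow> triangulated_category (Coef S X)"
    and coef_monoidal: "X \<in> Obj (Sp S) \<Longrightarrow> symmetric_monoidal (Coef S X)"
    and pull_push: "f \<in> Hom (Sp S) X Y \<Longrightarrow>
      exact_adjunction (Coef S Y) (Coef S X) (Pull S f) (Push S f) (PPUnit S f) (PPCounit S f)"
    and pull_monoidal: "f \<in> Hom (Sp S) X Y \<Longrightarrow>
      symmetric_monoidal_functor (Coef S Y) (Coef S X) (Pull S f)"
    and pull_id: "X \<in> Obj (Sp S) \<Longrightarrow>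
      natural_iso (Coef S X) (Coef S X) (Pull S (Id (Sp S) X)) id_fun (PullId S X)"
    and pull_id_shift: "\<lbrakk>X \<in> Obj (Sp S); A \<in> Obj (Coef S X)\<rbrakk> \<Longrightarrow>
      ShM (Coef S X) 1 (PullId S X A) \<cdot>\<^bsub>Coef S X\<^esub> FSh (Pull S (Id (Sp S) X)) A =
      PullId S X (ShO (Coef S X) 1 A)"
    and pull_id_one: "X \<in> Obj (Sp S) \<Longrightarrow>
      PullId S X (One (Coef S X)) \<cdot>\<^bsub>Coef S X\<^esub> FOne (Pull S (Id (Sp S) X)) =
      Id (Coef S X) (One (Coef S X))"
    and pull_id_mul: "\<lbrakk>X \<in> Obj (Sp S); A \<in> Obj (Coef S X); B \<in> Obj (Coef S X)\<rbrakk> \<Longrightarrow>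
      PullId S X (TenO (Coef S X) A B) \<cdot>\<^bsub>Coef S X\<^esub> FMul (Pull S (Id (Sp S) X)) A B =
      TenM (Coef S X) (PullId S X A) (PullId S X B)"
    and ext_biexact: "\<lbrakk>X \<in> Obj (Sp S); Y \<in> Obj (Sp S)\<rbrakk> \<Longrightarrow>
      biexact_bifunctor (Coef S X) (Coef S Y) (Coef S (Prod (Sp S) X Y)) (Ext S X Y)"
    and ext_one: "\<lbrakk>X \<in> Obj (Sp S); Y \<in> Obj (Sp S)\<rbrakk> \<Longrightarrow>
      ExtOne S X Y \<in> Isos (Coef S (Prod (Sp S) X Y)) (One (Coef S (Prod (Sp S) X Y)))
        (BO (Ext S X Y) (One (Coef S X)) (One (Coef S Y)))"
    and ext_pull: "\<lbrakk>f \<in> Hom (Sp S) X X'; g \<in> Hom (Sp S) Y Y'\<rbrakk> \<Longrightarrow>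
      bi_natural_iso (Coef S X') (Coef S Y') (Coef S (Prod (Sp S) X Y))
        (postcomp2 (Pull S (prod_map (Sp S) f g)) (Ext S X' Y'))
        (precomp2 (Ext S X Y) (Pull S f) (Pull S g)) (ExtPull S f g)"
    and ext_pull_shift_left: "\<lbrakk>f \<in> Hom (Sp S) X X'; g \<in> Hom (Sp S) Y Y';
        M \<in> Obj (Coef S X'); N \<in> Obj (Coef S Y')\<rbrakk> \<Longrightarrow>
      let D = Coef S (Prod (Sp S) X Y); F = Pull S (prod_map (Sp S) f g) in
        ShM D 1 (ExtPull S f g M N) \<cdot>\<^bsub>D\<^esub> FSh F (BO (Ext S X' Y') M N) \<cdot>\<^bsub>D\<^esub>
          FM F (BL (Ext S X' Y') M N) =
        BL (Ext S X Y) (FO (Pull S f) M) (FO (Pull S g) N) \<cdot>\<^bsub>D\<^esub>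
          BM (Ext S X Y) (FSh (Pull S f) M) (Id (Coef S Y) (FO (Pull S g) N)) \<cdot>\<^bsub>D\<^esub>
          ExtPull S f g (ShO (Coef S X') 1 M) N"
    and ext_pull_shift_right: "\<lbrakk>f \<in> Hom (Sp S) X X'; g \<in> Hom (Sp S) Y Y';
        M \<in> Obj (Coef S X'); N \<in> Obj (Coef S Y')\<rbrakk> \<Longrightarrow>
      let D = Coef S (Prod (Sp S) X Y); F = Pull S (prod_map (Sp S) f g) in
        ShM D 1 (ExtPull S f g M N) \<cdot>\<^bsub>D\<^esub> FSh F (BO (Ext S X' Y') M N) \<cdot>\<^bsub>D\<^esub>
          FM F (BR (Ext S X' Y') M N) =
        BR (Ext S X Y) (FO (Pull S f) M) (FO (Pull S g) N) \<cdot>\<^bsub>D\<^esub>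
          BM (Ext S X Y) (Id (Coef S X) (FO (Pull S f) M)) (FSh (Pull S g) N) \<cdot>\<^bsub>D\<^esub>
          ExtPull S f g M (ShO (Coef S Y') 1 N)"
    and ext_pull_one: "\<lbrakk>f \<in> Hom (Sp S) X X'; g \<in> Hom (Sp S) Y Y'\<rbrakk> \<Longrightarrow>
      let D = Coef S (Prod (Sp S) X Y); F = Pull S (prod_map (Sp S) f g) in
        ExtPull S f g (One (Coef S X')) (One (Coef S Y')) \<cdot>\<^bsub>D\<^esub> FM F (ExtOne S X' Y') \<cdot>\<^bsub>D\<^esub> FOne F =
        BM (Ext S X Y) (FOne (Pull S f)) (FOne (Pull S g)) \<cdot>\<^bsub>D\<^esub> ExtOne S X Y"


section \<open>Recollements\<close>

text \<open>The functors \<open>i\<^sup>!\<close> and \<open>j\<^sub>!\<close> with the units and counits of their adjunctions.\<close>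

record ('o, 'm) recol =
  UpSh :: "('o, 'm) cfun"
  UpUnit :: "'o \<Rightarrow> 'm"
  UpCounit :: "'o \<Rightarrow> 'm"
  LowSh :: "('o, 'm) cfun"
  LowUnit :: "'o \<Rightarrow> 'm"
  LowCounit :: "'o \<Rightarrow> 'm"

locale recollement =
  fixes S :: "('s, 'f, 'o, 'm) coeff_system"
    and Z U X :: "'s"
    and i j :: "'f"
    and R :: "('o, 'm) recol"
  assumes i_hom: "i \<in> Hom (Sp S) Z X"
    and j_hom: "j \<in> Hom (Sp S) U X"
    and upper_shriek: "adjunction (Coef S Z) (Coef S X) (Push S i) (UpSh R) (UpUnit R) (UpCounit R)"
    and lower_shriek: "adjunction (Coef S U) (Coef S X) (LowSh R) (Pull S j) (LowUnit R) (LowCounit R)"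
    and push_ff: "fully_faithful (Coef S Z) (Coef S X) (Push S i)"
    and lower_ff: "fully_faithful (Coef S U) (Coef S X) (LowSh R)"
    and pull_push_zero: "M \<in> Obj (Coef S Z) \<Longrightarrow>
      zero_object (Coef S U) (FO (Pull S j) (FO (Push S i) M))"
    and pull_lower_zero: "M \<in> Obj (Coef S U) \<Longrightarrow>
      zero_object (Coef S Z) (FO (Pull S i) (FO (LowSh R) M))"
    and triangle_open_closed: "\<exists>w.
      natural_trans (Coef S X) (Coef S X) (comp_fun (Push S i) (Pull S i))
        (comp_fun (shift (Coef S X) 1) (comp_fun (LowSh R) (Pull S j))) w \<and>
      (\<forall>M\<in>Obj (Coef S X). (LowCounit R M, PPUnit S i M, w M) \<in> Tri (Coef S X))"
    and triangle_closed_open: "\<exists>w.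
      natural_trans (Coef S X) (Coef S X) (comp_fun (Push S j) (Pull S j))
        (comp_fun (shift (Coef S X) 1) (comp_fun (Push S i) (UpSh R))) w \<and>
      (\<forall>M\<in>Obj (Coef S X). (UpCounit R M, PPUnit S j M, w M) \<in> Tri (Coef S X))"


section \<open>Cohomology classes and their localizations\<close>

definition Coh :: "('s, 'f, 'o, 'm) coeff_system \<Rightarrow> 's \<Rightarrow> int \<Rightarrow> 'o \<Rightarrow> 'm set" where
  "Coh S X d A = Hom (Coef S X) (One (Coef S X)) (ShO (Coef S X) d A)"

text \<open>\<open>f\<^sup>* c\<close> for \<open>c \<in> H\<^sup>d(X; A)\<close>, as a class in \<open>H\<^sup>d(U; f\<^sup>* A)\<close>, where \<open>f : U \<rightarrow> X\<close>.\<close>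

definition pull_class ::
  "('s, 'f, 'o, 'm) coeff_system \<Rightarrow> 'f \<Rightarrow> int \<Rightarrow> 'o \<Rightarrow> 'm \<Rightarrow> 'm" where
  "pull_class S f d A c =
     (let CU = Coef S (Dom (Sp S) f); CX = Coef S (Cod (Sp S) f) in
      shift_cmp CX CU (Pull S f) d A \<cdot>\<^bsub>CU\<^esub> FM (Pull S f) c \<cdot>\<^bsub>CU\<^esub> FOne (Pull S f))"

definition ext_class ::
  "('s, 'f, 'o, 'm) coeff_system \<Rightarrow> 's \<Rightarrow> 's \<Rightarrow> int \<Rightarrow> int \<Rightarrow> 'o \<Rightarrow> 'o \<Rightarrow> 'm \<Rightarrow> 'm \<Rightarrow> 'm" where
  "ext_class S X Y p q A B \<alpha> \<beta> =
     (let D = Coef S (Prod (Sp S) X Y) in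
      bishift_cmp (Coef S X) (Coef S Y) D (Ext S X Y) p q A B \<cdot>\<^bsub>D\<^esub>
        BM (Ext S X Y) \<alpha> \<beta> \<cdot>\<^bsub>D\<^esub> ExtOne S X Y)"

text \<open>\<open>i\<^sub>*i\<^sup>!A[d]\<close> is read as \<open>(i\<^sub>*i\<^sup>!A)[d]\<close>; passing to the adjoint uses the comparison
  \<open>i\<^sub>*(i\<^sup>!A[d]) \<rightarrow> (i\<^sub>*i\<^sup>!A)[d]\<close>.\<close>

definition supp_group ::
  "('s, 'f, 'o, 'm) coeff_system \<Rightarrow> 'f \<Rightarrow> ('o, 'm) recol \<Rightarrow> int \<Rightarrow> 'o \<Rightarrow> 'm monoid" where
  "supp_group S i R d A =
     (let CX = Coef S (Cod (Sp S) i) in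
      hom_group CX (One CX) (ShO CX d (FO (Push S i) (FO (UpSh R) A))))"

definition coh_group :: "('s, 'f, 'o, 'm) coeff_system \<Rightarrow> 's \<Rightarrow> int \<Rightarrow> 'o \<Rightarrow> 'm monoid" where
  "coh_group S X d A = hom_group (Coef S X) (One (Coef S X)) (ShO (Coef S X) d A)"

definition forg ::
  "('s, 'f, 'o, 'm) coeff_system \<Rightarrow> 'f \<Rightarrow> ('o, 'm) recol \<Rightarrow> int \<Rightarrow> 'o \<Rightarrow> 'm \<Rightarrow> 'm" where
  "forg S i R d A c =
     (let CX = Coef S (Cod (Sp S) i) in ShM CX d (UpCounit R A) \<cdot>\<^bsub>CX\<^esub> c)"

definition Lift ::
  "('s, 'f, 'o, 'm) coeff_system \<Rightarrow> 'f \<Rightarrow> ('o, 'm) recol \<Rightarrow> int \<Rightarrow> 'o \<Rightarrow> 'm \<Rightarrow> 'm set" where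
  "Lift S i R d A c = {c' \<in> carrier (supp_group S i R d A). forg S i R d A c' = c}"

definition supp_adj ::
  "('s, 'f, 'o, 'm) coeff_system \<Rightarrow> 'f \<Rightarrow> ('o, 'm) recol \<Rightarrow> int \<Rightarrow> 'o \<Rightarrow> 'm \<Rightarrow> 'm" where
  "supp_adj S i R d A c =
     (let CZ = Coef S (Dom (Sp S) i); CX = Coef S (Cod (Sp S) i); E = FO (UpSh R) A in
      PPCounit S i (ShO CZ d E) \<cdot>\<^bsub>CZ\<^esub>
        FM (Pull S i) (inv_arr CX (shift_cmp CZ CX (Push S i) d E) \<cdot>\<^bsub>CX\<^esub> c) \<cdot>\<^bsub>CZ\<^esub>
        FOne (Pull S i))"

definition LocTor ::
  "('s, 'f, 'o, 'm) coeff_system \<Rightarrow> 'f \<Rightarrow> ('o, 'm) recol \<Rightarrow> int \<Rightarrow> 'o \<Rightarrow> 'm \<Rightarrow> 'm set" where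
  "LocTor S i R d A c = supp_adj S i R d A ` Lift S i R d A c"

definition Loc ::
  "('s, 'f, 'o, 'm) coeff_system \<Rightarrow> 'f \<Rightarrow> ('o, 'm) recol \<Rightarrow> int \<Rightarrow> 'o \<Rightarrow> 'm \<Rightarrow> 'm" where
  "Loc S i R d A c = the_elem (LocTor S i R d A c)"

definition LocGroup ::
  "('s, 'f, 'o, 'm) coeff_system \<Rightarrow> 'f \<Rightarrow> ('o, 'm) recol \<Rightarrow> int \<Rightarrow> 'o \<Rightarrow> 'm monoid" where
  "LocGroup S i R d A =
     (coh_group S (Dom (Sp S) i) d (FO (UpSh R) A))
       \<lparr>carrier := supp_adj S i R d A `
          kernel (supp_group S i R d A) (coh_group S (Cod (Sp S) i) d A) (forg S i R d A)\<rparr>"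

definition LocAct ::
  "('s, 'f, 'o, 'm) coeff_system \<Rightarrow> 'f \<Rightarrow> ('o, 'm) recol \<Rightarrow> int \<Rightarrow> 'o \<Rightarrow> 'm \<Rightarrow> 'm \<Rightarrow> 'm \<Rightarrow> 'm" where
  "LocAct S i R d A c = (\<lambda>g. \<lambda>l\<in>LocTor S i R d A c. g \<otimes>\<^bsub>LocGroup S i R d A\<^esub> l)"

definition torsor :: "('g, 'z) monoid_scheme \<Rightarrow> 't set \<Rightarrow> ('g \<Rightarrow> 't \<Rightarrow> 't) \<Rightarrow> bool" where
  "torsor G T \<phi> \<longleftrightarrow>
     transitive_action G T \<phi> \<and> T \<noteq> {} \<and> (\<forall>x\<in>T. stabilizer G \<phi> x = {\<one>\<^bsub>G\<^esub>})"

definition torsor_morphism ::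
  "('g, 'y) monoid_scheme \<Rightarrow> 't set \<Rightarrow> ('g \<Rightarrow> 't \<Rightarrow> 't)
    \<Rightarrow> ('h, 'z) monoid_scheme \<Rightarrow> 'u set \<Rightarrow> ('h \<Rightarrow> 'u \<Rightarrow> 'u)
    \<Rightarrow> ('g \<Rightarrow> 'h) \<Rightarrow> ('t \<Rightarrow> 'u) \<Rightarrow> bool" where
  "torsor_morphism G T \<phi> G' T' \<phi>' h f \<longleftrightarrow>
     torsor G T \<phi> \<and> torsor G' T' \<phi>' \<and> h \<in> hom G G' \<and> f \<in> T \<rightarrow> T' \<and>
     (\<forall>g\<in>carrier G. \<forall>x\<in>T. f (\<phi> g x) = \<phi>' (h g) (f x))"


section \<open>Compatibility of the external product with a closed immersion\<close>

abbreviation times_id :: "('s, 'f, 'o, 'm) coeff_system \<Rightarrow> 'f \<Rightarrow> 's \<Rightarrow> 'f" where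
  "times_id S f Y \<equiv> prod_map (Sp S) f (Id (Sp S) Y)"

text \<open>\<open>(f \<times> id)\<^sup>*(M \<boxtimes> N) \<rightarrow> f\<^sup>* M \<boxtimes> N\<close> for \<open>f : Z \<rightarrow> X\<close>.\<close>

definition ext_pull_id ::
  "('s, 'f, 'o, 'm) coeff_system \<Rightarrow> 'f \<Rightarrow> 's \<Rightarrow> 'o \<Rightarrow> 'o \<Rightarrow> 'm" where
  "ext_pull_id S f Y M N =
     (let Z = Dom (Sp S) f in
      BM (Ext S Z Y) (Id (Coef S Z) (FO (Pull S f) M)) (PullId S Y N)
        \<cdot>\<^bsub>Coef S (Prod (Sp S) Z Y)\<^esub> ExtPull S f (Id (Sp S) Y) M N)"

text \<open>\<open>\<phi> C N : i\<^sub>* C \<boxtimes> N \<rightarrow> I\<^sub>*(C \<boxtimes> N)\<close> and \<open>\<psi> A N : i\<^sup>! A \<boxtimes> N \<rightarrow> I\<^sup>!(A \<boxtimes> N)\<close> with \<open>I = i \<times> id\<^sub>Y\<close>.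
  The counits concerned are those of both adjunctions in which \<open>i\<^sub>*\<close> and \<open>I\<^sub>*\<close> take part:
  \<open>i\<^sup>*i\<^sub>* \<rightarrow> id\<close> (this makes \<open>\<phi>\<close> the exchange map mate to the pullback compatibility)
  and \<open>i\<^sub>*i\<^sup>! \<rightarrow> id\<close>.\<close>

locale closed_ext_compatible =
  fixes S :: "('s, 'f, 'o, 'm) coeff_system"
    and i :: "'f" and Y :: "'s"
    and R R' :: "('o, 'm) recol"
    and \<phi> \<psi> :: "'o \<Rightarrow> 'o \<Rightarrow> 'm"
  assumes push_iso: "bi_natural_iso (Coef S (Dom (Sp S) i)) (Coef S Y)
      (Coef S (Prod (Sp S) (Cod (Sp S) i) Y))
      (precomp2 (Ext S (Cod (Sp S) i) Y) (Push S i) id_fun)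
      (postcomp2 (Push S (times_id S i Y)) (Ext S (Dom (Sp S) i) Y)) \<phi>"
    and shriek_iso: "bi_natural_iso (Coef S (Cod (Sp S) i)) (Coef S Y)
      (Coef S (Prod (Sp S) (Dom (Sp S) i) Y))
      (precomp2 (Ext S (Dom (Sp S) i) Y) (UpSh R) id_fun)
      (postcomp2 (UpSh R') (Ext S (Cod (Sp S) i) Y)) \<psi>"
    and pull_counit: "\<lbrakk>M \<in> Obj (Coef S (Dom (Sp S) i)); N \<in> Obj (Coef S Y)\<rbrakk> \<Longrightarrow>
      PPCounit S (times_id S i Y) (BO (Ext S (Dom (Sp S) i) Y) M N)
        \<cdot>\<^bsub>Coef S (Prod (Sp S) (Dom (Sp S) i) Y)\<^esub> FM (Pull S (times_id S i Y)) (\<phi> M N) =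
      BM (Ext S (Dom (Sp S) i) Y) (PPCounit S i M) (Id (Coef S Y) N)
        \<cdot>\<^bsub>Coef S (Prod (Sp S) (Dom (Sp S) i) Y)\<^esub> ext_pull_id S i Y (FO (Push S i) M) N"
    and shriek_counit: "\<lbrakk>M \<in> Obj (Coef S (Cod (Sp S) i)); N \<in> Obj (Coef S Y)\<rbrakk> \<Longrightarrow>
      UpCounit R' (BO (Ext S (Cod (Sp S) i) Y) M N)
        \<cdot>\<^bsub>Coef S (Prod (Sp S) (Cod (Sp S) i) Y)\<^esub> FM (Push S (times_id S i Y)) (\<psi> M N)
        \<cdot>\<^bsub>Coef S (Prod (Sp S) (Cod (Sp S) i) Y)\<^esub> \<phi> (FO (UpSh R) M) N =
      BM (Ext S (Cod (Sp S) i) Y) (UpCounit R M) (Id (Coef S Y) N)"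

text \<open>\<open>\<lambda> \<boxtimes> \<beta> : 1 \<rightarrow> (i\<^sup>! A \<boxtimes> B)[d + e] \<rightarrow> I\<^sup>!(A \<boxtimes> B)[d + e]\<close> for \<open>\<lambda> : 1 \<rightarrow> i\<^sup>! A[d]\<close>, \<open>\<beta> : 1 \<rightarrow> B[e]\<close>.\<close>

definition ext_loc ::
  "('s, 'f, 'o, 'm) coeff_system \<Rightarrow> 'f \<Rightarrow> 's \<Rightarrow> ('o, 'm) recol \<Rightarrow> ('o \<Rightarrow> 'o \<Rightarrow> 'm)
    \<Rightarrow> int \<Rightarrow> int \<Rightarrow> 'o \<Rightarrow> 'o \<Rightarrow> 'm \<Rightarrow> 'm \<Rightarrow> 'm" where
  "ext_loc S i Y R \<psi> d e A B l \<beta> =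
     (let D = Coef S (Prod (Sp S) (Dom (Sp S) i) Y) in
      ShM D (d + e) (\<psi> A B) \<cdot>\<^bsub>D\<^esub> ext_class S (Dom (Sp S) i) Y d e (FO (UpSh R) A) B l \<beta>)"

end

theory Submission
  imports Defs
begin

text \<open>
  Two facts reduce everything to formal manipulations. First, since the counit of \<open>i\<^sup>* \<stileturn> i\<^sub>*\<close> commutes
  with shifts, the adjoint of \<open>c' \<in> H\<^sup>d(X; i\<^sub>*i\<^sup>!A)\<close> is the pullback class \<open>i\<^sup>*c'\<close> followed by
  \<open>\<epsilon>[d]\<close>, where \<open>\<epsilon> : i\<^sup>*i\<^sub>*i\<^sup>!A \<rightarrow> i\<^sup>!A\<close>. Second, pullback of classes commutes with external products,
  which gives \<open>J\<^sup>*(c \<boxtimes> \<beta>) = 0\<close> at once. For a lift \<open>c'\<close> of \<open>c\<close>, the image of \<open>c' \<boxtimes> \<beta>\<close> under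
  \<open>i\<^sub>*i\<^sup>!A \<boxtimes> B \<rightarrow> I\<^sub>*(i\<^sup>!A \<boxtimes> B) \<rightarrow> I\<^sub>*I\<^sup>!(A \<boxtimes> B)\<close> is then a lift of \<open>c \<boxtimes> \<beta>\<close> by compatibility
  with the counit of \<open>i\<^sub>* \<stileturn> i\<^sup>!\<close>, and its adjoint is \<open>\<lambda> \<boxtimes> \<beta>\<close> by compatibility with the counit
  of \<open>i\<^sup>* \<stileturn> i\<^sub>*\<close>, where \<open>\<lambda>\<close> is the adjoint of \<open>c'\<close>. All identities between the
  comparisons \<open>F(A[n]) \<rightarrow> (F A)[n]\<close> follow from their recursion in \<open>n\<close>, which
  holds for all integers and determines them.
\<close>

section \<open>Categories and functors\<close>

text \<open>The obstacle is bookkeeping. Every class carries a shift, and \<open>shift_cmp\<close>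
  is defined directly for \<open>n \<ge> 0\<close> but through an inverse for \<open>n < 0\<close>.
  The recursion valid for all integers writes each side of an identity at \<open>n + 1\<close> as
  the translate of that side at \<open>n\<close>, followed by the same isomorphism
  \<open>FSh\<close>. As translation is injective, the identities at \<open>n\<close> and
  \<open>n + 1\<close> are equivalent, and one induction serves both directions. External products
  move the left shift out first on both sides of each identity, so no sign arises.

  The torsor part is additivity: two lifts of \<open>c\<close> differ by an element of the kernel of
  \<open>forg\<close>, and the acting group, the image of that kernel under the additive passage to
  the adjoint, is the localization set of the class 0. Since 0 times \<open>\<beta>\<close> is 0,
  one map serves both as the homomorphism of groups and as the map of torsors. Lifts exist because
  maps out of the unit object turn the triangle \<open>i_* i^! A -> A -> j_* j^* A\<close> into an
  exact sequence in which \<open>j^* c = 0\<close> forces \<open>c\<close> to die at the last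
  term.\<close>

context category
begin

lemma homD:
  assumes "f \<in> Hom C A B"
  shows "f \<in> Arr C" "Dom C f = A" "Cod C f = B" "A \<in> Obj C" "B \<in> Obj C"
  using assms dom_obj cod_obj by (auto simp: Hom_def)

text \<open>Side conditions go through \<open>Dom\<close> and \<open>Cod\<close> instead of
  \<open>Hom\<close>: rules stated with \<open>Hom\<close> leave the middle object as a free
  variable that rewriting cannot instantiate. Later computations rely on the resulting normal form,
  with composites associated to the right.\<close>

lemma comp_arr [simp]:
  assumes "g \<in> Arr C" "f \<in> Arr C" "Dom C g = Cod C f"
  shows "g \<cdot> f \<in> Arr C" "Dom C (g \<cdot> f) = Dom C f" "Cod C (g \<cdot> f) = Cod C g"
  using comp_hom[of g "Cod C f" "Cod C g" f "Dom C f"] assms by (auto simp: Hom_def)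

lemma id_arr [simp]:
  assumes "A \<in> Obj C"
  shows "Id C A \<in> Arr C" "Dom C (Id C A) = A" "Cod C (Id C A) = A"
  using id_hom[OF assms] by (auto simp: Hom_def)

lemma comp_id_left_arr [simp]: "\<lbrakk>f \<in> Arr C; Cod C f = A\<rbrakk> \<Longrightarrow> Id C A \<cdot> f = f"
  by (rule comp_id_left[of f "Dom C f"]) (auto simp: Hom_def)

lemma comp_id_right_arr [simp]: "\<lbrakk>f \<in> Arr C; Dom C f = A\<rbrakk> \<Longrightarrow> f \<cdot> Id C A = f"
  by (rule comp_id_right[of f _ "Cod C f"]) (auto simp: Hom_def)

lemma comp_assoc_arr [simp]:
  "\<lbrakk>h \<in> Arr C; g \<in> Arr C; f \<in> Arr C; Dom C h = Cod C g; Dom C g = Cod C f\<rbrakk>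
    \<Longrightarrow> (h \<cdot> g) \<cdot> f = h \<cdot> (g \<cdot> f)"
  by (rule comp_assoc[of h "Cod C g" "Cod C h" g "Cod C f" f "Dom C f"]) (auto simp: Hom_def)

declare dom_obj [simp] cod_obj [simp]

text \<open>In right-associated normal form the two arrows of a commuting square no longer form a
  subterm once another arrow precedes them. This form applies the square in front of such a tail
  \<open>x\<close>.\<close>

lemma comp_eq_reassoc:
  assumes "a \<cdot> b = c \<cdot> d"
    and "a \<in> Arr C" "b \<in> Arr C" "Dom C a = Cod C b"
    and "c \<in> Arr C" "d \<in> Arr C" "Dom C c = Cod C d"
    and "x \<in> Arr C" "Cod C x = Dom C b"
  shows "a \<cdot> (b \<cdot> x) = c \<cdot> (d \<cdot> x)"
proof -
  have "Dom C d = Dom C b"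
    using arg_cong[OF assms(1), of "Dom C"] assms(2-) by simp
  then have "(a \<cdot> b) \<cdot> x = c \<cdot> (d \<cdot> x)"
    unfolding assms(1) using assms(2-) by simp
  then show ?thesis
    using assms(2-) by simp
qed

lemma inverse_arrows_unique:
  assumes "inverse_arrows C f g" "inverse_arrows C f h"
  shows "g = h"
proof -
  have "g = g \<cdot> (f \<cdot> h)"
    using assms by (auto simp: inverse_arrows_def Hom_def)
  also have "\<dots> = (g \<cdot> f) \<cdot> h"
    using assms by (subst comp_assoc_arr) (auto simp: inverse_arrows_def Hom_def)
  also have "\<dots> = h"
    using assms by (auto simp: inverse_arrows_def Hom_def)
  finally show ?thesis .
qed

lemma inv_arr_eq: "inverse_arrows C f g \<Longrightarrow> inv_arr C f = g"
  unfolding inv_arr_def using inverse_arrows_unique by (intro the_equality) auto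

lemma iso_inv:
  assumes "f \<in> Isos C A B"
  shows "inv_arr C f \<in> Isos C B A" "inv_arr C f \<cdot> f = Id C A" "f \<cdot> inv_arr C f = Id C B"
proof -
  obtain g where g: "inverse_arrows C f g"
    using assms by (auto simp: Isos_def is_iso_def)
  have "inverse_arrows C g f"
    using g by (auto simp: inverse_arrows_def Hom_def)
  then have "is_iso C g"
    by (auto simp: is_iso_def)
  then show "inv_arr C f \<in> Isos C B A" "inv_arr C f \<cdot> f = Id C A" "f \<cdot> inv_arr C f = Id C B"
    using g assms by (auto simp: inv_arr_eq[OF g] Isos_def inverse_arrows_def Hom_def)
qed

lemma isoI:
  assumes "f \<in> Hom C A B" "g \<in> Hom C B A" "g \<cdot> f = Id C A" "f \<cdot> g = Id C B"
  shows "f \<in> Isos C A B" "inv_arr C f = g"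
proof -
  have "inverse_arrows C f g"
    using assms by (auto simp: inverse_arrows_def Hom_def)
  then show "f \<in> Isos C A B" "inv_arr C f = g"
    using assms(1) inv_arr_eq by (auto simp: Isos_def is_iso_def)
qed

lemma iso_id: "A \<in> Obj C \<Longrightarrow> Id C A \<in> Isos C A A"
  by (rule isoI[of _ _ _ "Id C A"]) (auto simp: Hom_def)

lemma iso_comp:
  assumes "g \<in> Isos C B D" "f \<in> Isos C A B"
  shows "g \<cdot> f \<in> Isos C A D" "inv_arr C (g \<cdot> f) = inv_arr C f \<cdot> inv_arr C g"
proof -
  let ?f = "inv_arr C f" and ?g = "inv_arr C g"
  have *: "f \<in> Hom C A B" "g \<in> Hom C B D" "?f \<in> Hom C B A" "?g \<in> Hom C D B"
    using assms iso_inv by (auto simp: Isos_def)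
  have "?g \<cdot> (g \<cdot> f) = f" "f \<cdot> (?f \<cdot> ?g) = ?g"
    using * iso_inv(2)[OF assms(1)] iso_inv(3)[OF assms(2)]
      comp_assoc[of ?g D B g B f A] comp_assoc[of f A B ?f B ?g D] comp_id_left by auto
  then have "(?f \<cdot> ?g) \<cdot> (g \<cdot> f) = Id C A" "(g \<cdot> f) \<cdot> (?f \<cdot> ?g) = Id C D"
    using * iso_inv[OF assms(1)] iso_inv[OF assms(2)] by (simp_all add: Hom_def)
  then show "g \<cdot> f \<in> Isos C A D" "inv_arr C (g \<cdot> f) = ?f \<cdot> ?g"
    using isoI[of "g \<cdot> f" A D "?f \<cdot> ?g"] * comp_hom by auto
qed

lemma iso_cancel_right:
  assumes f: "f \<in> Isos C A B" and x: "x \<in> Hom C B D" and y: "y \<in> Hom C B D"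
    and eq: "x \<cdot> f = y \<cdot> f"
  shows "x = y"
proof -
  have h: "f \<in> Hom C A B" "inv_arr C f \<in> Hom C B A"
    using f iso_inv(1)[OF f] by (auto simp: Isos_def)
  have "x = x \<cdot> (f \<cdot> inv_arr C f)"
    using x iso_inv(3)[OF f] by (simp add: Hom_def)
  also have "\<dots> = y \<cdot> (f \<cdot> inv_arr C f)"
    using comp_assoc[OF x h] comp_assoc[OF y h] eq by simp
  also have "\<dots> = y"
    using y iso_inv(3)[OF f] by (simp add: Hom_def)
  finally show ?thesis .
qed

lemma iso_cancel_left:
  assumes f: "f \<in> Isos C A B" and x: "x \<in> Hom C D A" and y: "y \<in> Hom C D A"
    and eq: "f \<cdot> x = f \<cdot> y"
  shows "x = y"
proof -
  have h: "f \<in> Hom C A B" "inv_arr C f \<in> Hom C B A"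
    using f iso_inv(1)[OF f] by (auto simp: Isos_def)
  have "x = (inv_arr C f \<cdot> f) \<cdot> x"
    using x iso_inv(2)[OF f] by (simp add: Hom_def)
  also have "\<dots> = (inv_arr C f \<cdot> f) \<cdot> y"
    using comp_assoc[OF h(2,1) x] comp_assoc[OF h(2,1) y] eq by simp
  also have "\<dots> = y"
    using y iso_inv(2)[OF f] by (simp add: Hom_def)
  finally show ?thesis .
qed

end

lemma Isos_Hom: "f \<in> Isos C A B \<Longrightarrow> f \<in> Hom C A B"
  by (simp add: Isos_def)

context is_functor
begin

lemma arr [simp]:
  assumes "f \<in> Arr C"
  shows "FM F f \<in> Arr D" "Dom D (FM F f) = FO F (Dom C f)" "Cod D (FM F f) = FO F (Cod C f)"
  using hom[of f "Dom C f" "Cod C f"] assms by (auto simp: Hom_def)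

declare obj [simp] id [simp]

lemma comp_arr [simp]:
  "\<lbrakk>g \<in> Arr C; f \<in> Arr C; Dom C g = Cod C f\<rbrakk> \<Longrightarrow> FM F (g \<cdot>\<^bsub>C\<^esub> f) = FM F g \<cdot>\<^bsub>D\<^esub> FM F f"
  by (rule comp[of g "Cod C f" "Cod C g" f "Dom C f"]) (auto simp: Hom_def)

lemma iso:
  assumes "category C" "category D" "f \<in> Isos C A B"
  shows "FM F f \<in> Isos D (FO F A) (FO F B)" "inv_arr D (FM F f) = FM F (inv_arr C f)"
proof -
  interpret C: category C by fact
  interpret D: category D by fact
  let ?g = "inv_arr C f"
  have h: "f \<in> Hom C A B" "?g \<in> Hom C B A"
    using assms(3) C.iso_inv(1)[OF assms(3)] by (auto simp: Isos_def)
  have "FM F ?g \<cdot>\<^bsub>D\<^esub> FM F f = Id D (FO F A)" "FM F f \<cdot>\<^bsub>D\<^esub> FM F ?g = Id D (FO F B)"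
    using comp[OF h(2,1)] comp[OF h] C.iso_inv(2,3)[OF assms(3)] C.homD(4,5)[OF h(1)] by auto
  with D.isoI[OF hom[OF h(1)] hom[OF h(2)]]
  show "FM F f \<in> Isos D (FO F A) (FO F B)" "inv_arr D (FM F f) = FM F ?g"
    by auto
qed

end

section \<open>Shifts\<close>

context triangulated_category
begin

lemma shift_functor: "is_functor C C (shift C n)"
  using shift_additive by (simp add: additive_functor_def)

lemma shift_obj [simp]: "A \<in> Obj C \<Longrightarrow> ShO C n A \<in> Obj C"
  using is_functor.obj[OF shift_functor, of A n] by (simp add: shift_def)

lemma shift_arr [simp]:
  assumes "f \<in> Arr C"
  shows "ShM C n f \<in> Arr C" "Dom C (ShM C n f) = ShO C n (Dom C f)"
    "Cod C (ShM C n f) = ShO C n (Cod C f)"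
  using is_functor.arr[OF shift_functor assms, of n] by (simp_all add: shift_def)

lemma shift_id [simp]: "A \<in> Obj C \<Longrightarrow> ShM C n (Id C A) = Id C (ShO C n A)"
  using is_functor.id[OF shift_functor, of A n] by (simp add: shift_def)

lemma shift_comp [simp]:
  "\<lbrakk>g \<in> Arr C; f \<in> Arr C; Dom C g = Cod C f\<rbrakk> \<Longrightarrow> ShM C n (g \<cdot> f) = ShM C n g \<cdot> ShM C n f"
  using is_functor.comp_arr[OF shift_functor, of g f n] by (simp add: shift_def)

lemma shift_hom: "f \<in> Hom C A B \<Longrightarrow> ShM C n f \<in> Hom C (ShO C n A) (ShO C n B)"
  by (auto simp: Hom_def)

lemma shift_iso:
  assumes "f \<in> Isos C A B"
  shows "ShM C n f \<in> Isos C (ShO C n A) (ShO C n B)" "inv_arr C (ShM C n f) = ShM C n (inv_arr C f)"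
  using is_functor.iso[OF shift_functor category_axioms category_axioms assms, of n]
  by (simp_all add: shift_def)

lemma shift_shift_obj: "A \<in> Obj C \<Longrightarrow> ShO C m (ShO C n A) = ShO C (m + n) A"
  by (simp add: shift_obj_add)

lemma shift_shift_arr: "f \<in> Arr C \<Longrightarrow> ShM C m (ShM C n f) = ShM C (m + n) f"
  by (simp add: shift_arr_add)

declare shift_obj_0 [simp] shift_arr_0 [simp]

lemma shift_cancel [simp]:
  "A \<in> Obj C \<Longrightarrow> ShO C (- n) (ShO C n A) = A" "A \<in> Obj C \<Longrightarrow> ShO C n (ShO C (- n) A) = A"
  "f \<in> Arr C \<Longrightarrow> ShM C (- n) (ShM C n f) = f" "f \<in> Arr C \<Longrightarrow> ShM C n (ShM C (- n) f) = f"
  by (simp_all add: shift_shift_obj shift_shift_arr)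

lemma shift_inject:
  assumes "f \<in> Arr C" "g \<in> Arr C" "ShM C n f = ShM C n g"
  shows "f = g"
  by (metis assms shift_cancel(3))

end

text \<open>The step is an equivalence, so it carries the claim both upwards and downwards from 0,
  and no case split on the sign of \<open>n\<close> remains.\<close>

lemma int_shift_induct [case_names zero step]:
  fixes P :: "int \<Rightarrow> bool"
  assumes zero: "P 0" and step: "\<And>n. P (n + 1) \<longleftrightarrow> P n"
  shows "P n"
proof (induction n rule: int_induct[where k = 0])
  case (step2 i)
  then show ?case
    using step[of "i - 1"] by simp
qed (use zero step in auto)

text \<open>Keeps of an exact functor only what concerns translation. Identities and composites then
  become instances without any check of additivity or of triangles.\<close>

locale shift_functor = C: triangulated_category C + D: triangulated_category D + is_functor C D F
  for C :: "('o, 'm, 'y) tri_category_scheme"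
    and D :: "('o, 'm, 'z) tri_category_scheme"
    and F :: "('o, 'm, 'w) exfun_scheme" +
  assumes FSh_iso: "A \<in> Obj C \<Longrightarrow> FSh F A \<in> Isos D (FO F (ShO C 1 A)) (ShO D 1 (FO F A))"
    and FSh_natural: "f \<in> Arr C \<Longrightarrow>
      FSh F (Cod C f) \<cdot>\<^bsub>D\<^esub> FM F (ShM C 1 f) = ShM D 1 (FM F f) \<cdot>\<^bsub>D\<^esub> FSh F (Dom C f)"
begin

lemma FSh_arr [simp]:
  assumes "A \<in> Obj C"
  shows "FSh F A \<in> Arr D" "Dom D (FSh F A) = FO F (ShO C 1 A)" "Cod D (FSh F A) = ShO D 1 (FO F A)"
  using FSh_iso[OF assms] by (auto simp: Isos_def Hom_def)

section \<open>Comparison isomorphisms for all integer shifts\<close>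

abbreviation "scn \<equiv> shift_cmp_nat C D F"
abbreviation "sc \<equiv> shift_cmp C D F"

lemma shift_cmp_nat_iso:
  "A \<in> Obj C \<Longrightarrow> scn n A \<in> Isos D (FO F (ShO C (int n) A)) (ShO D (int n) (FO F A))"
proof (induction n)
  case 0
  then show ?case
    by (simp add: D.iso_id)
next
  case (Suc n)
  have "FSh F (ShO C (int n) A)
      \<in> Isos D (FO F (ShO C (int (Suc n)) A)) (ShO D 1 (FO F (ShO C (int n) A)))"
    using FSh_iso[of "ShO C (int n) A"] Suc.prems by (simp add: C.shift_shift_obj)
  then show ?case
    using D.iso_comp(1) D.shift_iso(1)[OF Suc.IH, of 1] Suc.prems by (simp add: D.shift_shift_obj)
qed

lemma shift_cmp_nat_arr [simp]:
  assumes "A \<in> Obj C"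
  shows "scn n A \<in> Arr D" "Dom D (scn n A) = FO F (ShO C (int n) A)"
    "Cod D (scn n A) = ShO D (int n) (FO F A)"
  using shift_cmp_nat_iso[OF assms, of n] by (auto simp: Isos_def Hom_def)

text \<open>The definition peels off the outermost translation; here the innermost one, next to
  \<open>A\<close>, is peeled off. This is the useful form for negative shifts, where the base
  object \<open>A[n]\<close> of the inverted comparison moves with \<open>n\<close>.\<close>

lemma shift_cmp_nat_Suc_right:
  "A \<in> Obj C \<Longrightarrow> scn (Suc n) A = ShM D (int n) (FSh F A) \<cdot>\<^bsub>D\<^esub> scn n (ShO C 1 A)"
proof (induction n)
  case 0
  then show ?case by simp
next
  case (Suc n)
  let ?B = "ShO C 1 A"
  have "scn (Suc (Suc n)) A = ShM D 1 (scn (Suc n) A) \<cdot>\<^bsub>D\<^esub> FSh F (ShO C (int (Suc n)) A)"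
    by (rule shift_cmp_nat.simps)
  also have "\<dots> = ShM D 1 (ShM D (int n) (FSh F A) \<cdot>\<^bsub>D\<^esub> scn n ?B) \<cdot>\<^bsub>D\<^esub> FSh F (ShO C (int n) ?B)"
    unfolding Suc.IH[OF Suc.prems] using Suc.prems by (simp add: C.shift_shift_obj add.commute)
  also have "\<dots> = ShM D (int (Suc n)) (FSh F A) \<cdot>\<^bsub>D\<^esub> (ShM D 1 (scn n ?B) \<cdot>\<^bsub>D\<^esub> FSh F (ShO C (int n) ?B))"
    using Suc.prems by (simp add: C.shift_shift_obj D.shift_shift_obj D.shift_shift_arr add.commute)
  finally show ?case by simp
qed

lemma shift_cmp_iso:
  assumes "A \<in> Obj C"
  shows "sc n A \<in> Isos D (FO F (ShO C n A)) (ShO D n (FO F A))"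
proof (cases "0 \<le> n")
  case True
  then show ?thesis
    using shift_cmp_nat_iso[OF assms, of "nat n"] by (simp add: shift_cmp_def)
next
  case False
  then have "scn (nat (- n)) (ShO C n A) \<in> Isos D (FO F A) (ShO D (- n) (FO F (ShO C n A)))"
    using shift_cmp_nat_iso[of "ShO C n A" "nat (- n)"] assms by simp
  from D.shift_iso(1)[OF D.iso_inv(1)[OF this], of n] show ?thesis
    using False assms by (simp add: shift_cmp_def)
qed

lemma shift_cmp_arr [simp]:
  assumes "A \<in> Obj C"
  shows "sc n A \<in> Arr D" "Dom D (sc n A) = FO F (ShO C n A)" "Cod D (sc n A) = ShO D n (FO F A)"
  using shift_cmp_iso[OF assms, of n] by (auto simp: Isos_def Hom_def)

lemma shift_cmp_0 [simp]: "sc 0 A = Id D (FO F A)"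
  by (simp add: shift_cmp_def)

lemma shift_cmp_Suc:
  assumes A: "A \<in> Obj C"
  shows "sc (n + 1) A = ShM D 1 (sc n A) \<cdot>\<^bsub>D\<^esub> FSh F (ShO C n A)"
proof (cases "0 \<le> n")
  case True
  then have "nat (n + 1) = Suc (nat n)" by simp
  then show ?thesis
    using True by (simp add: shift_cmp_def)
next
  case False
  \<comment> \<open>With \<open>n = - (k + 1)\<close>, both \<open>sc n A\<close> and
    \<open>sc (n + 1) A\<close> become shifted inverses: of \<open>scn (k + 1)\<close> at
    \<open>A[n]\<close> and of \<open>scn k\<close> at \<open>A[n + 1]\<close>. The right-hand
    recursion relates these two.\<close>
  define k where "k = nat (- n - 1)"
  have n: "n = - int (Suc k)"
    using False by (simp add: k_def)
  let ?B = "ShO C n A"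
  have B: "?B \<in> Obj C" "ShO C 1 ?B = ShO C (n + 1) A" "ShO C (1 + int k) ?B = A"
    using A n by (simp_all add: C.shift_shift_obj add.commute)
  \<comment> \<open>For \<open>k = 0\<close> the index \<open>n + 1 = 0\<close> already falls under
    the nonnegative branch of the definition; the formula persists because the inverse of an
    identity is that identity.\<close>
  have sc': "sc (n + 1) A = ShM D (n + 1) (inv_arr D (scn k (ShO C (n + 1) A)))"
  proof (cases k)
    case 0
    then show ?thesis
      using n A D.isoI(2)[of "Id D (FO F A)" "FO F A" "FO F A" "Id D (FO F A)"] by (simp add: Hom_def)
  next
    case (Suc m)
    then have "\<not> 0 \<le> n + 1" "nat (- (n + 1)) = k"
      using n by auto
    then show ?thesis
      by (simp add: shift_cmp_def del: minus_add_distrib)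
  qed
  have kA: "scn k (ShO C (n + 1) A) \<in> Isos D (FO F A) (ShO D (int k) (FO F (ShO C (n + 1) A)))"
    using shift_cmp_nat_iso[of "ShO C (n + 1) A" k] A n by (simp add: C.shift_shift_obj)
  have F: "ShM D (int k) (FSh F ?B) \<in> Isos D (ShO D (int k) (FO F (ShO C (n + 1) A)))
      (ShO D (int k) (ShO D 1 (FO F ?B)))"
    using D.shift_iso(1)[OF FSh_iso[OF B(1)], of "int k"] B by simp
  have "sc n A = ShM D n (inv_arr D (scn (Suc k) ?B))"
    using False by (simp add: shift_cmp_def k_def Suc_nat_eq_nat_zadd1)
  also have "inv_arr D (scn (Suc k) ?B)
      = inv_arr D (scn k (ShO C (n + 1) A)) \<cdot>\<^bsub>D\<^esub> ShM D (int k) (inv_arr D (FSh F ?B))"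
    using D.iso_comp(2)[OF F kA] D.shift_iso(2)[OF FSh_iso[OF B(1)], of "int k"] B
    by (simp add: shift_cmp_nat_Suc_right del: shift_cmp_nat.simps)
  finally have "ShM D 1 (sc n A) = ShM D (n + 1) (inv_arr D (scn k (ShO C (n + 1) A)))
      \<cdot>\<^bsub>D\<^esub> inv_arr D (FSh F ?B)"
    using D.iso_inv(1)[OF kA] D.iso_inv(1)[OF FSh_iso[OF B(1)]] B(1,2) A n
    by (simp add: Isos_def Hom_def D.shift_shift_arr D.shift_shift_obj add.commute)
  then show ?thesis
    using sc' D.iso_inv[OF FSh_iso[OF B(1)]] D.iso_inv(1)[OF kA] B(1,2) A n
    by (simp add: Isos_def Hom_def D.shift_shift_obj)
qed

lemma shift_cmp_1_add:
  "A \<in> Obj C \<Longrightarrow> sc (1 + n) A = ShM D 1 (sc n A) \<cdot>\<^bsub>D\<^esub> FSh F (ShO C n A)"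
  using shift_cmp_Suc[of A n] by (simp add: add.commute)

text \<open>The step of the inductions on the shift: \<open>FSh\<close> is invertible and
  translation is injective on arrows, so the last layer of the recursion can be added or
  stripped.\<close>

lemma shift_FSh_cancel:
  assumes "B \<in> Obj C" "x \<in> Hom D (FO F B) W" "y \<in> Hom D (FO F B) W"
  shows "ShM D 1 x \<cdot>\<^bsub>D\<^esub> FSh F B = ShM D 1 y \<cdot>\<^bsub>D\<^esub> FSh F B \<longleftrightarrow> x = y"
  using D.iso_cancel_right[OF FSh_iso D.shift_hom D.shift_hom, OF assms]
    D.shift_inject[of x y 1] assms(2,3) by (auto simp: Hom_def)

lemma shift_cmp_unique:
  assumes A: "A \<in> Obj C"
    and hom: "\<And>n. r n \<in> Hom D (FO F (ShO C n A)) (ShO D n (FO F A))"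
    and zero: "r 0 = Id D (FO F A)"
    and Suc: "\<And>n. r (n + 1) = ShM D 1 (r n) \<cdot>\<^bsub>D\<^esub> FSh F (ShO C n A)"
  shows "r n = sc n A"
proof (induction n rule: int_shift_induct)
  case zero
  show ?case by (simp add: assms(3))
next
  case (step n)
  show ?case
    unfolding Suc shift_cmp_Suc[OF A]
    by (rule shift_FSh_cancel[OF _ hom]) (auto simp: Hom_def A)
qed

lemma shift_cmp_natural:
  assumes f: "f \<in> Arr C"
  shows "sc n (Cod C f) \<cdot>\<^bsub>D\<^esub> FM F (ShM C n f) = ShM D n (FM F f) \<cdot>\<^bsub>D\<^esub> sc n (Dom C f)"
proof (induction n rule: int_shift_induct)
  case zero
  show ?case using f by simp
next
  case (step n)
  let ?A = "Dom C f" and ?B = "Cod C f"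
  have "FSh F (ShO C n ?B) \<cdot>\<^bsub>D\<^esub> FM F (ShM C (n + 1) f)
      = ShM D 1 (FM F (ShM C n f)) \<cdot>\<^bsub>D\<^esub> FSh F (ShO C n ?A)"
    using FSh_natural[of "ShM C n f"] f by (simp add: C.shift_shift_arr add.commute)
  then have 1: "sc (n + 1) ?B \<cdot>\<^bsub>D\<^esub> FM F (ShM C (n + 1) f)
      = ShM D 1 (sc n ?B \<cdot>\<^bsub>D\<^esub> FM F (ShM C n f)) \<cdot>\<^bsub>D\<^esub> FSh F (ShO C n ?A)"
    using f by (simp add: shift_cmp_1_add C.shift_shift_obj add.commute)
  have 2: "ShM D (n + 1) (FM F f) \<cdot>\<^bsub>D\<^esub> sc (n + 1) ?A
      = ShM D 1 (ShM D n (FM F f) \<cdot>\<^bsub>D\<^esub> sc n ?A) \<cdot>\<^bsub>D\<^esub> FSh F (ShO C n ?A)"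
    using f by (simp add: shift_cmp_1_add D.shift_shift_arr D.shift_shift_obj add.commute)
  show ?case
    unfolding 1 2 by (rule shift_FSh_cancel) (auto simp: Hom_def f)
qed

lemma shift_cmp_add:
  assumes A: "A \<in> Obj C"
  shows "sc (p + q) A = ShM D p (sc q A) \<cdot>\<^bsub>D\<^esub> sc p (ShO C q A)"
proof (induction p rule: int_shift_induct)
  case zero
  show ?case using A by simp
next
  case (step p)
  have 1: "sc (p + 1 + q) A = ShM D 1 (sc (p + q) A) \<cdot>\<^bsub>D\<^esub> FSh F (ShO C (p + q) A)"
    using shift_cmp_Suc[OF A, of "p + q"] by (simp add: ac_simps)
  have 2: "ShM D (p + 1) (sc q A) \<cdot>\<^bsub>D\<^esub> sc (p + 1) (ShO C q A)
      = ShM D 1 (ShM D p (sc q A) \<cdot>\<^bsub>D\<^esub> sc p (ShO C q A)) \<cdot>\<^bsub>D\<^esub> FSh F (ShO C (p + q) A)"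
    using A by (simp add: shift_cmp_1_add C.shift_shift_obj D.shift_shift_arr D.shift_shift_obj ac_simps)
  show ?case
    unfolding 1 2
    by (rule shift_FSh_cancel) (auto simp: Hom_def A C.shift_shift_obj D.shift_shift_obj)
qed

end

text \<open>Reduces compatibility with all shifts to compatibility with a single translation. It is
  applied to units, counits, \<open>PullId\<close> and, with one variable frozen, to maps between
  bifunctors.\<close>

lemma shift_cmp_natural_trans:
  assumes F: "shift_functor C D F" and G: "shift_functor C D G"
    and hom: "\<And>A. A \<in> Obj C \<Longrightarrow> t A \<in> Hom D (FO F A) (FO G A)"
    and shift: "\<And>A. A \<in> Obj C \<Longrightarrow>
      ShM D 1 (t A) \<cdot>\<^bsub>D\<^esub> FSh F A = FSh G A \<cdot>\<^bsub>D\<^esub> t (ShO C 1 A)"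
    and A: "A \<in> Obj C"
  shows "ShM D n (t A) \<cdot>\<^bsub>D\<^esub> shift_cmp C D F n A = shift_cmp C D G n A \<cdot>\<^bsub>D\<^esub> t (ShO C n A)"
proof -
  interpret F: shift_functor C D F by fact
  interpret G: shift_functor C D G by fact
  have t [simp]: "t B \<in> Arr D" "Dom D (t B) = FO F B" "Cod D (t B) = FO G B" if "B \<in> Obj C" for B
    using hom[OF that] by (auto simp: Hom_def)
  show ?thesis
  proof (induction n rule: int_shift_induct)
    case zero
    show ?case using A by simp
  next
    case (step n)
    let ?B = "ShO C n A"
    have "FSh G ?B \<cdot>\<^bsub>D\<^esub> t (ShO C (n + 1) A) = ShM D 1 (t ?B) \<cdot>\<^bsub>D\<^esub> FSh F ?B"
      using shift[of ?B] A by (simp add: F.C.shift_shift_obj add.commute)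
    then have 1: "G.sc (n + 1) A \<cdot>\<^bsub>D\<^esub> t (ShO C (n + 1) A)
        = ShM D 1 (G.sc n A \<cdot>\<^bsub>D\<^esub> t ?B) \<cdot>\<^bsub>D\<^esub> FSh F ?B"
      using A by (simp add: G.shift_cmp_1_add F.C.shift_shift_obj add.commute)
    have 2: "ShM D (n + 1) (t A) \<cdot>\<^bsub>D\<^esub> F.sc (n + 1) A
        = ShM D 1 (ShM D n (t A) \<cdot>\<^bsub>D\<^esub> F.sc n A) \<cdot>\<^bsub>D\<^esub> FSh F ?B"
      using A by (simp add: F.shift_cmp_1_add F.D.shift_shift_arr F.D.shift_shift_obj add.commute)
    show ?case
      unfolding 1 2 by (rule F.shift_FSh_cancel) (auto simp: Hom_def A)
  qed
qed

text \<open>Units and counits have composites as source or target. Recording the translation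
  comparison of a composite makes them families between functors of the same kind, to which
  \<open>shift_cmp_natural_trans\<close> applies.\<close>

definition comp_exfun ::
  "('o, 'm, 'z) tri_category_scheme \<Rightarrow> ('o, 'm, 'v) exfun_scheme \<Rightarrow> ('o, 'm, 'w) exfun_scheme
    \<Rightarrow> ('o, 'm) exfun" where
  "comp_exfun E G F = \<lparr>FO = (\<lambda>A. FO G (FO F A)), FM = (\<lambda>f. FM G (FM F f)),
     FSh = (\<lambda>A. FSh G (FO F A) \<cdot>\<^bsub>E\<^esub> FM G (FSh F A))\<rparr>"

definition id_exfun :: "('o, 'm, 'z) tri_category_scheme \<Rightarrow> ('o, 'm) exfun" where
  "id_exfun C = \<lparr>FO = (\<lambda>A. A), FM = (\<lambda>f. f), FSh = (\<lambda>A. Id C (ShO C 1 A))\<rparr>"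

lemma comp_exfun_sel [simp]:
  "FO (comp_exfun E G F) A = FO G (FO F A)"
  "FM (comp_exfun E G F) f = FM G (FM F f)"
  "FSh (comp_exfun E G F) A = FSh G (FO F A) \<cdot>\<^bsub>E\<^esub> FM G (FSh F A)"
  by (simp_all add: comp_exfun_def)

lemma id_exfun_sel [simp]:
  "FO (id_exfun C) A = A" "FM (id_exfun C) f = f" "FSh (id_exfun C) A = Id C (ShO C 1 A)"
  by (simp_all add: id_exfun_def)

lemma shift_functor_id:
  assumes "triangulated_category C"
  shows "shift_functor C C (id_exfun C)" "A \<in> Obj C \<Longrightarrow> shift_cmp C C (id_exfun C) n A = Id C (ShO C n A)"
proof -
  interpret C: triangulated_category C by fact
  show *: "shift_functor C C (id_exfun C)"
    by unfold_locales (auto simp: Hom_def C.iso_id)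
  show "A \<in> Obj C \<Longrightarrow> shift_cmp C C (id_exfun C) n A = Id C (ShO C n A)"
    by (rule shift_functor.shift_cmp_unique[OF *, symmetric, of A "\<lambda>n. Id C (ShO C n A)"])
      (auto simp: Hom_def C.shift_shift_obj add.commute)
qed

lemma shift_functor_comp:
  assumes F: "shift_functor C D F" and G: "shift_functor D E G"
  shows "shift_functor C E (comp_exfun E G F)"
    "A \<in> Obj C \<Longrightarrow> shift_cmp C E (comp_exfun E G F) n A
      = shift_cmp D E G n (FO F A) \<cdot>\<^bsub>E\<^esub> FM G (shift_cmp C D F n A)"
proof -
  interpret F: shift_functor C D F by fact
  interpret G: shift_functor D E G by fact
  show *: "shift_functor C E (comp_exfun E G F)"
  proof unfold_locales
    fix A assume "A \<in> Obj C"
    then show "FSh (comp_exfun E G F) A \<in> Isos E (FO (comp_exfun E G F) (ShO C 1 A))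
        (ShO E 1 (FO (comp_exfun E G F) A))"
      using G.D.iso_comp(1)[OF G.FSh_iso G.iso(1)[OF _ _ F.FSh_iso]]
        G.D.category_axioms F.D.category_axioms by simp
  next
    fix f assume f: "f \<in> Arr C"
    show "FSh (comp_exfun E G F) (Cod C f) \<cdot>\<^bsub>E\<^esub> FM (comp_exfun E G F) (ShM C 1 f)
        = ShM E 1 (FM (comp_exfun E G F) f) \<cdot>\<^bsub>E\<^esub> FSh (comp_exfun E G F) (Dom C f)"
      using f arg_cong[OF F.FSh_natural[OF f], of "FM G"]
        G.D.comp_eq_reassoc[OF G.FSh_natural[of "FM F f"], of "FM G (FSh F (Dom C f))"] by simp
  qed (auto simp: Hom_def F.comp_arr)
  show "shift_cmp C E (comp_exfun E G F) n A
      = shift_cmp D E G n (FO F A) \<cdot>\<^bsub>E\<^esub> FM G (shift_cmp C D F n A)" if A: "A \<in> Obj C"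
  proof (rule shift_functor.shift_cmp_unique[OF * A, symmetric])
    fix n
    let ?B = "ShO C n A"
    have "FSh G (ShO D n (FO F A)) \<cdot>\<^bsub>E\<^esub> (FM G (ShM D 1 (F.sc n A)) \<cdot>\<^bsub>E\<^esub> FM G (FSh F ?B))
        = ShM E 1 (FM G (F.sc n A)) \<cdot>\<^bsub>E\<^esub> (FSh G (FO F ?B) \<cdot>\<^bsub>E\<^esub> FM G (FSh F ?B))"
      using G.D.comp_eq_reassoc[OF G.FSh_natural[of "F.sc n A"], of "FM G (FSh F ?B)"] A by simp
    then show "G.sc (n + 1) (FO F A) \<cdot>\<^bsub>E\<^esub> FM G (F.sc (n + 1) A)
      = ShM E 1 (G.sc n (FO F A) \<cdot>\<^bsub>E\<^esub> FM G (F.sc n A)) \<cdot>\<^bsub>E\<^esub> FSh (comp_exfun E G F) (ShO C n A)"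
      using A by (simp add: G.shift_cmp_Suc F.shift_cmp_Suc)
  qed (use A in \<open>auto simp: Hom_def\<close>)
qed

lemma exact_functor_shift_functor:
  assumes "triangulated_category C" "triangulated_category D" "exact_functor C D F"
  shows "shift_functor C D F"
proof -
  interpret C: triangulated_category C by fact
  interpret D: triangulated_category D by fact
  interpret F: exact_functor C D F by fact
  interpret is_functor C D F
    using F.additive by (simp add: additive_functor_def)
  interpret s: natural_iso C D "comp_fun F (shift C 1)" "comp_fun (shift D 1) F" "FSh F"
    by (rule F.shift_iso)
  show ?thesis
  proof unfold_locales
    fix A assume "A \<in> Obj C"
    then show "FSh F A \<in> Isos D (FO F (ShO C 1 A)) (ShO D 1 (FO F A))"
      using s.hom[of A] s.iso[of A] by (simp add: Isos_def comp_fun_def shift_def)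
  next
    fix f assume "f \<in> Arr C"
    then show "FSh F (Cod C f) \<cdot>\<^bsub>D\<^esub> FM F (ShM C 1 f) = ShM D 1 (FM F f) \<cdot>\<^bsub>D\<^esub> FSh F (Dom C f)"
      using s.natural[of f "Dom C f" "Cod C f"] by (simp add: comp_fun_def shift_def Hom_def)
  qed
qed

section \<open>Shifts and bi-exact bifunctors\<close>

lemma bifun_sel [simp]:
  "BO (precomp2 T F G) A B = BO T (FO F A) (FO G B)"
  "BM (precomp2 T F G) f g = BM T (FM F f) (FM G g)"
  "BO (postcomp2 F T) A B = FO F (BO T A B)"
  "BM (postcomp2 F T) f g = FM F (BM T f g)"
  "FO id_fun A = A" "FM id_fun f = f"
  "FO (shift C n) A = ShO C n A" "FM (shift C n) f = ShM C n f"
  "FO (fix_right C2 T B) A = BO T A B" "FM (fix_right C2 T B) f = BM T f (Id C2 B)"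
  "FO (fix_left C1 T A) B = BO T A B" "FM (fix_left C1 T A) g = BM T (Id C1 A) g"
  for T :: "('o, 'm, 'w) biexfun_scheme"
  by (simp_all add: precomp2_def postcomp2_def id_fun_def shift_def fix_right_def fix_left_def)

lemma fix_FSh [simp]:
  "FSh (fix_right C2 T B) A = BL T A B" "FSh (fix_left C1 T A) B = BR T A B"
  by (simp_all add: fix_right_def fix_left_def)

lemma (in bi_natural_iso) natural_arr:
  "\<lbrakk>f \<in> Arr C1; g \<in> Arr C2\<rbrakk> \<Longrightarrow> t (Cod C1 f) (Cod C2 g) \<cdot>\<^bsub>D\<^esub> BM P f g
    = BM Q f g \<cdot>\<^bsub>D\<^esub> t (Dom C1 f) (Dom C2 g)"
  by (rule natural) (auto simp: Hom_def)

lemma (in bi_natural_iso) component_arr: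
  assumes "A \<in> Obj C1" "B \<in> Obj C2"
  shows "t A B \<in> Arr D" "Dom D (t A B) = BO P A B" "Cod D (t A B) = BO Q A B"
  using iso[OF assms] by (auto simp: Isos_def Hom_def)

locale triangulated_bifunctor =
  C1: triangulated_category C1 + C2: triangulated_category C2 + D: triangulated_category D +
  biexact_bifunctor C1 C2 D T
  for C1 :: "('o, 'm, 'x) tri_category_scheme"
    and C2 :: "('o, 'm, 'y) tri_category_scheme"
    and D :: "('o, 'm, 'z) tri_category_scheme"
    and T :: "('o, 'm, 'w) biexfun_scheme"
begin

declare obj [simp] id [simp]

lemma BM_arr [simp]:
  assumes "f \<in> Arr C1" "g \<in> Arr C2"
  shows "BM T f g \<in> Arr D" "Dom D (BM T f g) = BO T (Dom C1 f) (Dom C2 g)"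
    "Cod D (BM T f g) = BO T (Cod C1 f) (Cod C2 g)"
  using hom[of f "Dom C1 f" "Cod C1 f" g "Dom C2 g" "Cod C2 g"] assms by (auto simp: Hom_def)

text \<open>Oriented towards merging, whereas the rules for functors and shifts distribute over
  composites. The second part is the same merge in front of a tail. Where a shift has to be split
  over two factors, the rule must be switched off.\<close>

lemma BM_comp [simp]:
  assumes "f' \<in> Arr C1" "f \<in> Arr C1" "Dom C1 f' = Cod C1 f"
    and "g' \<in> Arr C2" "g \<in> Arr C2" "Dom C2 g' = Cod C2 g"
  shows "BM T f' g' \<cdot>\<^bsub>D\<^esub> BM T f g = BM T (f' \<cdot>\<^bsub>C1\<^esub> f) (g' \<cdot>\<^bsub>C2\<^esub> g)"
    and "\<lbrakk>x \<in> Arr D; Cod D x = BO T (Dom C1 f) (Dom C2 g)\<rbrakk>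
      \<Longrightarrow> BM T f' g' \<cdot>\<^bsub>D\<^esub> (BM T f g \<cdot>\<^bsub>D\<^esub> x) = BM T (f' \<cdot>\<^bsub>C1\<^esub> f) (g' \<cdot>\<^bsub>C2\<^esub> g) \<cdot>\<^bsub>D\<^esub> x"
proof -
  show *: "BM T f' g' \<cdot>\<^bsub>D\<^esub> BM T f g = BM T (f' \<cdot>\<^bsub>C1\<^esub> f) (g' \<cdot>\<^bsub>C2\<^esub> g)"
    using comp[of f "Dom C1 f" "Cod C1 f" f' "Cod C1 f'" g "Dom C2 g" "Cod C2 g" g' "Cod C2 g'"] assms
    by (auto simp: Hom_def)
  show "BM T f' g' \<cdot>\<^bsub>D\<^esub> (BM T f g \<cdot>\<^bsub>D\<^esub> x) = BM T (f' \<cdot>\<^bsub>C1\<^esub> f) (g' \<cdot>\<^bsub>C2\<^esub> g) \<cdot>\<^bsub>D\<^esub> x"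
    if "x \<in> Arr D" "Cod D x = BO T (Dom C1 f) (Dom C2 g)"
    using D.comp_assoc_arr[of "BM T f' g'" "BM T f g" x] assms that by (simp add: *)
qed

lemma shift_functor_right: "B \<in> Obj C2 \<Longrightarrow> shift_functor C1 D (fix_right C2 T B)"
  by (rule exact_functor_shift_functor[OF C1.triangulated_category_axioms D.triangulated_category_axioms
        exact_left])

lemma shift_functor_left: "A \<in> Obj C1 \<Longrightarrow> shift_functor C2 D (fix_left C1 T A)"
  by (rule exact_functor_shift_functor[OF C2.triangulated_category_axioms D.triangulated_category_axioms
        exact_right])

abbreviation "scR p A B \<equiv> shift_cmp C1 D (fix_right C2 T B) p A"
abbreviation "scL q A B \<equiv> shift_cmp C2 D (fix_left C1 T A) q B"
abbreviation "bsc p q A B \<equiv> bishift_cmp C1 C2 D T p q A B"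

lemma scR_arr [simp]:
  assumes "A \<in> Obj C1" "B \<in> Obj C2"
  shows "scR p A B \<in> Arr D" "Dom D (scR p A B) = BO T (ShO C1 p A) B"
    "Cod D (scR p A B) = ShO D p (BO T A B)"
  using shift_functor.shift_cmp_arr[OF shift_functor_right, OF assms(2,1)] by simp_all

lemma scL_arr [simp]:
  assumes "A \<in> Obj C1" "B \<in> Obj C2"
  shows "scL p A B \<in> Arr D" "Dom D (scL p A B) = BO T A (ShO C2 p B)"
    "Cod D (scL p A B) = ShO D p (BO T A B)"
  using shift_functor.shift_cmp_arr[OF shift_functor_left, OF assms] by simp_all

lemma bsc_arr [simp]:
  assumes "A \<in> Obj C1" "B \<in> Obj C2"
  shows "bsc p q A B \<in> Arr D" "Dom D (bsc p q A B) = BO T (ShO C1 p A) (ShO C2 q B)"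
    "Cod D (bsc p q A B) = ShO D (p + q) (BO T A B)"
  using assms by (simp_all add: bishift_cmp_def D.shift_shift_obj)

lemma BL_arr [simp]:
  assumes "A \<in> Obj C1" "B \<in> Obj C2"
  shows "BL T A B \<in> Arr D" "Dom D (BL T A B) = BO T (ShO C1 1 A) B" "Cod D (BL T A B) = ShO D 1 (BO T A B)"
  using bi_natural_iso.component_arr[OF left_natural assms] by simp_all

lemma BR_arr [simp]:
  assumes "A \<in> Obj C1" "B \<in> Obj C2"
  shows "BR T A B \<in> Arr D" "Dom D (BR T A B) = BO T A (ShO C2 1 B)" "Cod D (BR T A B) = ShO D 1 (BO T A B)"
  using bi_natural_iso.component_arr[OF right_natural assms] by simp_all

text \<open>Split \<open>(u, v)\<close> as \<open>(u, 1)\<close> after \<open>(1, v)\<close>. The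
  first factor is naturality of the comparison of one functor; the second is a family between two
  functors \<open>T(-, B)\<close>, compatible with translation because \<open>BL\<close> is natural
  in its second argument.\<close>

lemma scR_natural:
  assumes u: "u \<in> Arr C1" and v: "v \<in> Arr C2"
  shows "scR p (Cod C1 u) (Cod C2 v) \<cdot>\<^bsub>D\<^esub> BM T (ShM C1 p u) v
    = ShM D p (BM T u v) \<cdot>\<^bsub>D\<^esub> scR p (Dom C1 u) (Dom C2 v)"
proof -
  let ?A = "Dom C1 u" and ?A' = "Cod C1 u" and ?B = "Dom C2 v" and ?B' = "Cod C2 v"
  have *: "ShM D p (BM T (Id C1 A) v) \<cdot>\<^bsub>D\<^esub> scR p A ?B = scR p A ?B' \<cdot>\<^bsub>D\<^esub> BM T (Id C1 (ShO C1 p A)) v"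
    if A: "A \<in> Obj C1" for A
  proof (rule shift_cmp_natural_trans[OF shift_functor_right shift_functor_right _ _ A])
    fix A assume A: "A \<in> Obj C1"
    show "ShM D 1 (BM T (Id C1 A) v) \<cdot>\<^bsub>D\<^esub> FSh (fix_right C2 T ?B) A
        = FSh (fix_right C2 T ?B') A \<cdot>\<^bsub>D\<^esub> BM T (Id C1 (ShO C1 1 A)) v"
      using bi_natural_iso.natural_arr[OF left_natural C1.id_arr(1)[OF A] v] A v by simp
  qed (use v in \<open>auto simp: Hom_def\<close>)
  have 2: "scR p ?A' B \<cdot>\<^bsub>D\<^esub> BM T (ShM C1 p u) (Id C2 B) = ShM D p (BM T u (Id C2 B)) \<cdot>\<^bsub>D\<^esub> scR p ?A B"
    if "B \<in> Obj C2" for B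
    using shift_functor.shift_cmp_natural[OF shift_functor_right[OF that] u] by simp
  have "scR p ?A' ?B' \<cdot>\<^bsub>D\<^esub> BM T (ShM C1 p u) v
      = scR p ?A' ?B' \<cdot>\<^bsub>D\<^esub> (BM T (ShM C1 p u) (Id C2 ?B') \<cdot>\<^bsub>D\<^esub> BM T (Id C1 (ShO C1 p ?A)) v)"
    using u v by simp
  also have "\<dots> = ShM D p (BM T u (Id C2 ?B')) \<cdot>\<^bsub>D\<^esub> (scR p ?A ?B' \<cdot>\<^bsub>D\<^esub> BM T (Id C1 (ShO C1 p ?A)) v)"
    by (rule D.comp_eq_reassoc[OF 2]) (use u v in auto)
  also have "\<dots> = ShM D p (BM T u (Id C2 ?B')) \<cdot>\<^bsub>D\<^esub> (ShM D p (BM T (Id C1 ?A) v) \<cdot>\<^bsub>D\<^esub> scR p ?A ?B)"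
    using * u by simp
  also have "\<dots> = ShM D p (BM T u (Id C2 ?B') \<cdot>\<^bsub>D\<^esub> BM T (Id C1 ?A) v) \<cdot>\<^bsub>D\<^esub> scR p ?A ?B"
    using u v by (simp del: BM_comp)
  also have "\<dots> = ShM D p (BM T u v) \<cdot>\<^bsub>D\<^esub> scR p ?A ?B"
    using u v by simp
  finally show ?thesis .
qed

lemma scL_natural:
  assumes u: "u \<in> Arr C1" and v: "v \<in> Arr C2"
  shows "scL q (Cod C1 u) (Cod C2 v) \<cdot>\<^bsub>D\<^esub> BM T u (ShM C2 q v)
    = ShM D q (BM T u v) \<cdot>\<^bsub>D\<^esub> scL q (Dom C1 u) (Dom C2 v)"
proof -
  let ?A = "Dom C1 u" and ?A' = "Cod C1 u" and ?B = "Dom C2 v" and ?B' = "Cod C2 v"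
  have *: "ShM D q (BM T u (Id C2 B)) \<cdot>\<^bsub>D\<^esub> scL q ?A B = scL q ?A' B \<cdot>\<^bsub>D\<^esub> BM T u (Id C2 (ShO C2 q B))"
    if B: "B \<in> Obj C2" for B
  proof (rule shift_cmp_natural_trans[OF shift_functor_left shift_functor_left _ _ B])
    fix B assume B: "B \<in> Obj C2"
    show "ShM D 1 (BM T u (Id C2 B)) \<cdot>\<^bsub>D\<^esub> FSh (fix_left C1 T ?A) B
        = FSh (fix_left C1 T ?A') B \<cdot>\<^bsub>D\<^esub> BM T u (Id C2 (ShO C2 1 B))"
      using bi_natural_iso.natural_arr[OF right_natural u C2.id_arr(1)[OF B]] B u by simp
  qed (use u in \<open>auto simp: Hom_def\<close>)
  have 2: "scL q A ?B' \<cdot>\<^bsub>D\<^esub> BM T (Id C1 A) (ShM C2 q v) = ShM D q (BM T (Id C1 A) v) \<cdot>\<^bsub>D\<^esub> scL q A ?B"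
    if "A \<in> Obj C1" for A
    using shift_functor.shift_cmp_natural[OF shift_functor_left[OF that] v] by simp
  have "scL q ?A' ?B' \<cdot>\<^bsub>D\<^esub> BM T u (ShM C2 q v)
      = scL q ?A' ?B' \<cdot>\<^bsub>D\<^esub> (BM T (Id C1 ?A') (ShM C2 q v) \<cdot>\<^bsub>D\<^esub> BM T u (Id C2 (ShO C2 q ?B)))"
    using u v by simp
  also have "\<dots> = ShM D q (BM T (Id C1 ?A') v) \<cdot>\<^bsub>D\<^esub> (scL q ?A' ?B \<cdot>\<^bsub>D\<^esub> BM T u (Id C2 (ShO C2 q ?B)))"
    by (rule D.comp_eq_reassoc[OF 2]) (use u v in auto)
  also have "\<dots> = ShM D q (BM T (Id C1 ?A') v) \<cdot>\<^bsub>D\<^esub> (ShM D q (BM T u (Id C2 ?B)) \<cdot>\<^bsub>D\<^esub> scL q ?A ?B)"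
    using * v by simp
  also have "\<dots> = ShM D q (BM T (Id C1 ?A') v \<cdot>\<^bsub>D\<^esub> BM T u (Id C2 ?B)) \<cdot>\<^bsub>D\<^esub> scL q ?A ?B"
    using u v by (simp del: BM_comp)
  also have "\<dots> = ShM D q (BM T u v) \<cdot>\<^bsub>D\<^esub> scL q ?A ?B"
    using u v by simp
  finally show ?thesis .
qed

lemma bishift_cmp_natural:
  assumes u: "u \<in> Arr C1" and v: "v \<in> Arr C2"
  shows "bsc p q (Cod C1 u) (Cod C2 v) \<cdot>\<^bsub>D\<^esub> BM T (ShM C1 p u) (ShM C2 q v)
    = ShM D (p + q) (BM T u v) \<cdot>\<^bsub>D\<^esub> bsc p q (Dom C1 u) (Dom C2 v)"
proof -
  let ?A = "Dom C1 u" and ?A' = "Cod C1 u" and ?B = "Dom C2 v" and ?B' = "Cod C2 v"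
  have "bsc p q ?A' ?B' \<cdot>\<^bsub>D\<^esub> BM T (ShM C1 p u) (ShM C2 q v)
      = ShM D p (scL q ?A' ?B') \<cdot>\<^bsub>D\<^esub> (scR p ?A' (ShO C2 q ?B') \<cdot>\<^bsub>D\<^esub> BM T (ShM C1 p u) (ShM C2 q v))"
    using u v by (simp add: bishift_cmp_def)
  also have "\<dots> = ShM D p (scL q ?A' ?B') \<cdot>\<^bsub>D\<^esub>
      (ShM D p (BM T u (ShM C2 q v)) \<cdot>\<^bsub>D\<^esub> scR p ?A (ShO C2 q ?B))"
    using scR_natural[of u "ShM C2 q v"] u v by simp
  also have "\<dots> = ShM D p (scL q ?A' ?B' \<cdot>\<^bsub>D\<^esub> BM T u (ShM C2 q v)) \<cdot>\<^bsub>D\<^esub> scR p ?A (ShO C2 q ?B)"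
    using u v by simp
  also have "\<dots> = ShM D p (ShM D q (BM T u v) \<cdot>\<^bsub>D\<^esub> scL q ?A ?B) \<cdot>\<^bsub>D\<^esub> scR p ?A (ShO C2 q ?B)"
    using scL_natural[OF u v] by simp
  also have "\<dots> = ShM D (p + q) (BM T u v) \<cdot>\<^bsub>D\<^esub> bsc p q ?A ?B"
    using u v by (simp add: bishift_cmp_def D.shift_shift_arr D.shift_shift_obj)
  finally show ?thesis .
qed

text \<open>Exactness in the first variable gives additivity only when the second arrow is an
  identity. Hence \<open>b\<close> is split off on the left, and composition with it is
  additive.\<close>

lemma BM_Add_left:
  assumes "a \<in> Hom C1 A A'" "a' \<in> Hom C1 A A'" "b \<in> Hom C2 B B'"
  shows "BM T (Add C1 a a') b = Add D (BM T a b) (BM T a' b)"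
proof -
  interpret exact_functor C1 D "fix_right C2 T B"
    using assms C2.homD exact_left by blast
  have "Add C1 a a' \<in> Hom C1 A A'"
    using C1.hom_comm_group[of A A'] C1.homD[OF assms(1)] assms(1,2)
    by (metis comm_group.axioms(2) group.is_monoid hom_group_def monoid.m_closed monoid.simps(1) partial_object.select_convs(1))
  then have "BM T (Add C1 a a') b = BM T (Id C1 A') b \<cdot>\<^bsub>D\<^esub> BM T (Add C1 a a') (Id C2 B)"
    using assms C2.homD[OF assms(3)] C1.homD[OF assms(1)] by (simp add: Hom_def)
  also have "BM T (Add C1 a a') (Id C2 B) = Add D (BM T a (Id C2 B)) (BM T a' (Id C2 B))"
    using additive assms by (simp add: additive_functor_def)
  also have "BM T (Id C1 A') b \<cdot>\<^bsub>D\<^esub> \<dots> = Add D (BM T (Id C1 A') b \<cdot>\<^bsub>D\<^esub> BM T a (Id C2 B))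
      (BM T (Id C1 A') b \<cdot>\<^bsub>D\<^esub> BM T a' (Id C2 B))"
    by (rule D.comp_add_right[of _ "BO T A' B" "BO T A' B'" _ "BO T A B"])
      (use assms C2.homD[OF assms(3)] C1.homD[OF assms(1)] in \<open>auto simp: Hom_def\<close>)
  also have "\<dots> = Add D (BM T a b) (BM T a' b)"
    using assms C2.homD[OF assms(3)] C1.homD[OF assms(1)] by (simp add: Hom_def)
  finally show ?thesis .
qed

end

text \<open>Each variable is handled alone with the other one frozen, and the two results are pasted
  in the order fixed by \<open>bishift_cmp\<close>. That order is the same for \<open>T\<close> and
  \<open>T'\<close>, so the shifts are never interchanged.\<close>

lemma bishift_cmp_exchange:
  assumes T: "triangulated_bifunctor C1 C2 D T" and T': "triangulated_bifunctor C1' C2' D' T'"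
    and F: "shift_functor D D' F" and G1: "shift_functor C1 C1' G1" and G2: "shift_functor C2 C2' G2"
    and t: "bi_natural_iso C1 C2 D' (postcomp2 F T) (precomp2 T' G1 G2) t"
    and left: "\<And>M N. \<lbrakk>M \<in> Obj C1; N \<in> Obj C2\<rbrakk> \<Longrightarrow>
      ShM D' 1 (t M N) \<cdot>\<^bsub>D'\<^esub> FSh F (BO T M N) \<cdot>\<^bsub>D'\<^esub> FM F (BL T M N)
      = BL T' (FO G1 M) (FO G2 N) \<cdot>\<^bsub>D'\<^esub> BM T' (FSh G1 M) (Id C2' (FO G2 N)) \<cdot>\<^bsub>D'\<^esub> t (ShO C1 1 M) N"
    and right: "\<And>M N. \<lbrakk>M \<in> Obj C1; N \<in> Obj C2\<rbrakk> \<Longrightarrow>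
      ShM D' 1 (t M N) \<cdot>\<^bsub>D'\<^esub> FSh F (BO T M N) \<cdot>\<^bsub>D'\<^esub> FM F (BR T M N)
      = BR T' (FO G1 M) (FO G2 N) \<cdot>\<^bsub>D'\<^esub> BM T' (Id C1' (FO G1 M)) (FSh G2 N) \<cdot>\<^bsub>D'\<^esub> t M (ShO C2 1 N)"
    and M: "M \<in> Obj C1" and N: "N \<in> Obj C2"
  shows "ShM D' (p + q) (t M N) \<cdot>\<^bsub>D'\<^esub> shift_cmp D D' F (p + q) (BO T M N)
      \<cdot>\<^bsub>D'\<^esub> FM F (bishift_cmp C1 C2 D T p q M N)
    = bishift_cmp C1' C2' D' T' p q (FO G1 M) (FO G2 N)
      \<cdot>\<^bsub>D'\<^esub> BM T' (shift_cmp C1 C1' G1 p M) (shift_cmp C2 C2' G2 q N)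
      \<cdot>\<^bsub>D'\<^esub> t (ShO C1 p M) (ShO C2 q N)"
proof -
  interpret T: triangulated_bifunctor C1 C2 D T by fact
  interpret T': triangulated_bifunctor C1' C2' D' T' by fact
  interpret F: shift_functor D D' F by fact
  interpret G1: shift_functor C1 C1' G1 by fact
  interpret G2: shift_functor C2 C2' G2 by fact
  interpret t: bi_natural_iso C1 C2 D' "postcomp2 F T" "precomp2 T' G1 G2" t by fact
  have t_arr [simp]: "t A B \<in> Arr D'" "Dom D' (t A B) = FO F (BO T A B)"
    "Cod D' (t A B) = BO T' (FO G1 A) (FO G2 B)" if "A \<in> Obj C1" "B \<in> Obj C2" for A B
    using t.component_arr[OF that] by simp_all
  \<comment> \<open>With \<open>B\<close> frozen, \<open>t\<close> is a family from
    \<open>F T(-, B)\<close> to \<open>T'(G1 -, G2 B)\<close>, and the assumption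
    \<open>left\<close> is its compatibility with one translation. \<open>R\<close> arises in the
    same way in the other variable.\<close>
  have L: "ShM D' p (t M B) \<cdot>\<^bsub>D'\<^esub> (F.sc p (BO T M B) \<cdot>\<^bsub>D'\<^esub> FM F (T.scR p M B))
      = (T'.scR p (FO G1 M) (FO G2 B) \<cdot>\<^bsub>D'\<^esub> BM T' (G1.sc p M) (Id C2' (FO G2 B)))
        \<cdot>\<^bsub>D'\<^esub> t (ShO C1 p M) B" if B: "B \<in> Obj C2" for B
    using shift_cmp_natural_trans[OF shift_functor_comp(1)[OF T.shift_functor_right[OF B] F]
        shift_functor_comp(1)[OF G1 T'.shift_functor_right[OF G2.obj[OF B]]], of "\<lambda>M. t M B" M p]
      shift_functor_comp(2)[OF T.shift_functor_right[OF B] F]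
      shift_functor_comp(2)[OF G1 T'.shift_functor_right[OF G2.obj[OF B]]] left[OF _ B] B M
    by (simp add: Hom_def)
  have R: "ShM D' q (t A N) \<cdot>\<^bsub>D'\<^esub> (F.sc q (BO T A N) \<cdot>\<^bsub>D'\<^esub> FM F (T.scL q A N))
      = (T'.scL q (FO G1 A) (FO G2 N) \<cdot>\<^bsub>D'\<^esub> BM T' (Id C1' (FO G1 A)) (G2.sc q N))
        \<cdot>\<^bsub>D'\<^esub> t A (ShO C2 q N)" if A: "A \<in> Obj C1" for A
    using shift_cmp_natural_trans[OF shift_functor_comp(1)[OF T.shift_functor_left[OF A] F]
        shift_functor_comp(1)[OF G2 T'.shift_functor_left[OF G1.obj[OF A]]], of "\<lambda>N. t A N" N q]
      shift_functor_comp(2)[OF T.shift_functor_left[OF A] F]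
      shift_functor_comp(2)[OF G2 T'.shift_functor_left[OF G1.obj[OF A]]] right[OF A] A N
    by (simp add: Hom_def)
  let ?W = "BO T M N" and ?Nq = "ShO C2 q N" and ?l = "T.scL q M N" and ?r = "T.scR p M (ShO C2 q N)"
  note s = T.D.shift_shift_obj T'.D.shift_shift_obj T'.D.shift_shift_arr
  have "ShM D' (p + q) (t M N) \<cdot>\<^bsub>D'\<^esub> F.sc (p + q) ?W \<cdot>\<^bsub>D'\<^esub> FM F (T.bsc p q M N)
      = ShM D' (p + q) (t M N) \<cdot>\<^bsub>D'\<^esub> ShM D' p (F.sc q ?W) \<cdot>\<^bsub>D'\<^esub>
        (F.sc p (ShO D q ?W) \<cdot>\<^bsub>D'\<^esub> (FM F (ShM D p ?l) \<cdot>\<^bsub>D'\<^esub> FM F ?r))"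
    using M N by (simp add: F.shift_cmp_add bishift_cmp_def s)
  \<comment> \<open>Naturality of \<open>F.sc p\<close> at \<open>?l\<close> collects everything
    that concerns \<open>q\<close> under a single shift by \<open>p\<close>, the form to which
    \<open>R\<close> applies.\<close>
  also have "F.sc p (ShO D q ?W) \<cdot>\<^bsub>D'\<^esub> (FM F (ShM D p ?l) \<cdot>\<^bsub>D'\<^esub> FM F ?r)
      = ShM D' p (FM F ?l) \<cdot>\<^bsub>D'\<^esub> (F.sc p (BO T M ?Nq) \<cdot>\<^bsub>D'\<^esub> FM F ?r)"
    by (rule T'.D.comp_eq_reassoc) (use F.shift_cmp_natural[of ?l p] M N in \<open>simp_all add: s\<close>)
  also have "ShM D' (p + q) (t M N) \<cdot>\<^bsub>D'\<^esub> ShM D' p (F.sc q ?W) \<cdot>\<^bsub>D'\<^esub> \<dots>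
      = ShM D' p (ShM D' q (t M N) \<cdot>\<^bsub>D'\<^esub> (F.sc q ?W \<cdot>\<^bsub>D'\<^esub> FM F ?l)) \<cdot>\<^bsub>D'\<^esub>
        (F.sc p (BO T M ?Nq) \<cdot>\<^bsub>D'\<^esub> FM F ?r)"
    using M N by (simp add: s)
  also have "\<dots> = ShM D' p (T'.scL q (FO G1 M) (FO G2 N) \<cdot>\<^bsub>D'\<^esub> BM T' (Id C1' (FO G1 M)) (G2.sc q N))
      \<cdot>\<^bsub>D'\<^esub> (ShM D' p (t M ?Nq) \<cdot>\<^bsub>D'\<^esub> (F.sc p (BO T M ?Nq) \<cdot>\<^bsub>D'\<^esub> FM F ?r))"
    unfolding R[OF M] using M N by (simp add: s)
  also have "\<dots> = ShM D' p (T'.scL q (FO G1 M) (FO G2 N)) \<cdot>\<^bsub>D'\<^esub>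
      (ShM D' p (BM T' (Id C1' (FO G1 M)) (G2.sc q N)) \<cdot>\<^bsub>D'\<^esub>
      (T'.scR p (FO G1 M) (FO G2 ?Nq) \<cdot>\<^bsub>D'\<^esub> (BM T' (G1.sc p M) (Id C2' (FO G2 ?Nq))
      \<cdot>\<^bsub>D'\<^esub> t (ShO C1 p M) ?Nq)))"
    unfolding L[OF T.C2.shift_obj[OF N]] using M N by (simp add: s)
  \<comment> \<open>The comparison of \<open>G2\<close> still sits under a shift by
    \<open>p\<close>. Naturality of \<open>scR\<close> in the second variable takes it past the left
    comparison, where it can merge with that of \<open>G1\<close>.\<close>
  also have "ShM D' p (BM T' (Id C1' (FO G1 M)) (G2.sc q N)) \<cdot>\<^bsub>D'\<^esub>
      (T'.scR p (FO G1 M) (FO G2 ?Nq) \<cdot>\<^bsub>D'\<^esub> (BM T' (G1.sc p M) (Id C2' (FO G2 ?Nq))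
      \<cdot>\<^bsub>D'\<^esub> t (ShO C1 p M) ?Nq))
    = T'.scR p (FO G1 M) (ShO C2' q (FO G2 N)) \<cdot>\<^bsub>D'\<^esub>
      (BM T' (Id C1' (ShO C1' p (FO G1 M))) (G2.sc q N) \<cdot>\<^bsub>D'\<^esub> (BM T' (G1.sc p M) (Id C2' (FO G2 ?Nq))
      \<cdot>\<^bsub>D'\<^esub> t (ShO C1 p M) ?Nq))"
    by (rule T'.D.comp_eq_reassoc)
      (use T'.scR_natural[of "Id C1' (FO G1 M)" "G2.sc q N" p] M N in simp_all)
  also have "ShM D' p (T'.scL q (FO G1 M) (FO G2 N)) \<cdot>\<^bsub>D'\<^esub> \<dots>
    = T'.bsc p q (FO G1 M) (FO G2 N) \<cdot>\<^bsub>D'\<^esub> BM T' (G1.sc p M) (G2.sc q N) \<cdot>\<^bsub>D'\<^esub> t (ShO C1 p M) ?Nq"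
    using M N by (simp add: bishift_cmp_def)
  finally show ?thesis .
qed

section \<open>Additivity and exactness of the Hom functors\<close>

context additive_category
begin

lemma hom_group_sel [simp]:
  "carrier (hom_group C A B) = Hom C A B" "mult (hom_group C A B) = Add C"
  "one (hom_group C A B) = Zero C A B"
  by (simp_all add: hom_group_def)

lemma hom_group: "\<lbrakk>A \<in> Obj C; B \<in> Obj C\<rbrakk> \<Longrightarrow> group (hom_group C A B)"
  by (rule comm_group.axioms(2)[OF hom_comm_group])

lemma Zero_hom: "\<lbrakk>A \<in> Obj C; B \<in> Obj C\<rbrakk> \<Longrightarrow> Zero C A B \<in> Hom C A B"
  using monoid.one_closed[OF group.is_monoid[OF hom_group[of A B]]] by simp

lemma Zero_arr [simp]:
  assumes "A \<in> Obj C" "B \<in> Obj C"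
  shows "Zero C A B \<in> Arr C" "Dom C (Zero C A B) = A" "Cod C (Zero C A B) = B"
  using Zero_hom[OF assms] by (auto simp: Hom_def)

lemma Add_hom:
  assumes "f \<in> Hom C A B" "g \<in> Hom C A B"
  shows "Add C f g \<in> Hom C A B"
  using monoid.m_closed[OF group.is_monoid[OF hom_group[OF homD(4,5)[OF assms(1)]]]] assms by simp

text \<open>The only idempotent of a group is its unit; this is how additivity is turned into
  preservation of zero arrows.\<close>

lemma Add_idem_zero:
  assumes f: "f \<in> Hom C A B" and eq: "Add C f f = f"
  shows "f = Zero C A B"
  using group.l_cancel_one[OF hom_group[OF homD(4,5)[OF f]], of f f] assms by simp

lemma Add_Zero:
  assumes "f \<in> Hom C A B"
  shows "Add C (Zero C A B) f = f" "Add C f (Zero C A B) = f"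
proof -
  interpret G: group "hom_group C A B"
    by (rule hom_group[OF homD(4,5)[OF assms]])
  show "Add C (Zero C A B) f = f" "Add C f (Zero C A B) = f"
    using G.l_one[of f] G.r_one[of f] assms by simp_all
qed

lemma comp_Zero_left:
  assumes "f \<in> Hom C A B" "D \<in> Obj C"
  shows "Zero C B D \<cdot> f = Zero C A D"
proof (rule Add_idem_zero)
  have z: "Zero C B D \<in> Hom C B D"
    by (rule Zero_hom[OF homD(5)[OF assms(1)] assms(2)])
  then show "Zero C B D \<cdot> f \<in> Hom C A D"
    using assms(1) by (rule comp_hom)
  show "Add C (Zero C B D \<cdot> f) (Zero C B D \<cdot> f) = Zero C B D \<cdot> f"
    using comp_add_left[OF z z assms(1)] Add_Zero[OF z] by simp
qed

lemma comp_Zero_right: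
  assumes "f \<in> Hom C B D" "A \<in> Obj C"
  shows "f \<cdot> Zero C A B = Zero C A D"
proof (rule Add_idem_zero)
  have z: "Zero C A B \<in> Hom C A B"
    by (rule Zero_hom[OF assms(2) homD(4)[OF assms(1)]])
  with assms(1) show "f \<cdot> Zero C A B \<in> Hom C A D"
    by (rule comp_hom)
  show "Add C (f \<cdot> Zero C A B) (f \<cdot> Zero C A B) = f \<cdot> Zero C A B"
    using comp_add_right[OF assms(1) z z] Add_Zero[OF z] by simp
qed

lemma neg_hom:
  assumes "f \<in> Hom C A B"
  shows "neg C f \<in> Hom C A B" "Add C f (neg C f) = Zero C A B" "neg C (neg C f) = f"
proof -
  interpret G: group "hom_group C A B"
    by (rule hom_group[OF homD(4,5)[OF assms]])
  have "neg C f = inv\<^bsub>hom_group C A B\<^esub> f" if "f \<in> Hom C A B" for f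
    using that by (simp add: neg_def Hom_def)
  then show "neg C f \<in> Hom C A B" "Add C f (neg C f) = Zero C A B" "neg C (neg C f) = f"
    using assms G.r_inv[of f] G.inv_closed[of f] by simp_all
qed

lemma neg_unique:
  assumes "f \<in> Hom C A B" "g \<in> Hom C A B" "Add C f g = Zero C A B"
  shows "g = neg C f"
proof -
  interpret G: group "hom_group C A B"
    by (rule hom_group[OF homD(4,5)[OF assms(1)]])
  show ?thesis
    using G.Units_l_cancel[of f g "neg C f"] assms neg_hom[OF assms(1)] by simp
qed

lemma comp_neg_left:
  assumes "g \<in> Hom C B D" "f \<in> Hom C A B"
  shows "neg C g \<cdot> f = neg C (g \<cdot> f)"
  using neg_unique[OF comp_hom[OF assms] comp_hom[OF neg_hom(1)[OF assms(1)] assms(2)]]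
    comp_add_left[OF assms(1) neg_hom(1)[OF assms(1)] assms(2)] neg_hom(2)[OF assms(1)]
    comp_Zero_left[OF assms(2) homD(5)[OF assms(1)]] by simp

lemma comp_neg_right:
  assumes "g \<in> Hom C B D" "f \<in> Hom C A B"
  shows "g \<cdot> neg C f = neg C (g \<cdot> f)"
  using neg_unique[OF comp_hom[OF assms] comp_hom[OF assms(1) neg_hom(1)[OF assms(2)]]]
    comp_add_right[OF assms(1,2) neg_hom(1)[OF assms(2)]] neg_hom(2)[OF assms(2)]
    comp_Zero_right[OF assms(1) homD(4)[OF assms(2)]] by simp

end

lemma additive_functor_Zero:
  assumes "additive_category C" "additive_category D" "additive_functor C D F" "A \<in> Obj C" "B \<in> Obj C"
  shows "FM F (Zero C A B) = Zero D (FO F A) (FO F B)"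
proof -
  interpret C: additive_category C by fact
  interpret D: additive_category D by fact
  interpret is_functor C D F
    using assms(3) by (simp add: additive_functor_def)
  have z: "Zero C A B \<in> Hom C A B"
    by (rule C.Zero_hom[OF assms(4,5)])
  show ?thesis
  proof (rule D.Add_idem_zero[OF hom[OF z]])
    show "Add D (FM F (Zero C A B)) (FM F (Zero C A B)) = FM F (Zero C A B)"
      using z assms(3) C.Add_Zero[OF z] unfolding additive_functor_def by metis
  qed
qed

section \<open>Lifting along the first map of a distinguished triangle\<close>

context triangulated_category
begin

lemma shift_Zero: "\<lbrakk>A \<in> Obj C; B \<in> Obj C\<rbrakk> \<Longrightarrow> ShM C n (Zero C A B) = Zero C (ShO C n A) (ShO C n B)"
  using additive_functor_Zero[OF additive_category_axioms additive_category_axioms shift_additive[of n]]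
  by simp

text \<open>Compare the rotated identity triangle \<open>W -> 0 -> W[1]\<close> with the rotation
  \<open>(v, w, - u[1])\<close>: the assumption on \<open>f\<close> is the commuting square, and the
  completing arrow \<open>W[1] -> A[1]\<close> is the translate of the lift.\<close>

lemma triangle_lift:
  assumes tri: "(u, v, w) \<in> Tri C" and f: "f \<in> Hom C W (Cod C u)" and zero: "v \<cdot> f = Zero C W (Cod C v)"
  obtains g where "g \<in> Hom C W (Dom C u)" "u \<cdot> g = f"
proof -
  obtain A B D where uvw: "u \<in> Hom C A B" "v \<in> Hom C B D" "w \<in> Hom C D (ShO C 1 A)"
    using tri_hom[OF tri] by blast
  note obj = homD(4,5)[OF uvw(1)] homD(5)[OF uvw(2)] homD(4)[OF f]
  obtain O' where O': "zero_object C O'"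
    using ex_zero_object by blast
  then have O'_obj: "O' \<in> Obj C"
    by (simp add: zero_object_def)
  have "(Zero C W O', Zero C O' (ShO C 1 W), neg C (ShM C 1 (Id C W))) \<in> Tri C"
    using tri_rotate[of "Id C W" "Zero C W O'" "Zero C O' (ShO C 1 W)"]
      tri_identity[OF obj(4) O'] obj O'_obj by (simp add: Hom_def)
  moreover have "(v, w, neg C (ShM C 1 u)) \<in> Tri C"
    using tri_rotate[of u v w] tri uvw by (simp add: Hom_def)
  moreover have "Zero C O' D \<cdot> Zero C W O' = v \<cdot> f"
    using comp_Zero_left[OF Zero_hom[OF obj(4) O'_obj] obj(3)] zero uvw by (simp add: Hom_def)
  ultimately obtain h where h: "h \<in> Hom C (ShO C 1 W) (ShO C 1 A)"
    and eq: "ShM C 1 f \<cdot> neg C (ShM C 1 (Id C W)) = neg C (ShM C 1 u) \<cdot> h"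
    using tri_morphism[of "Zero C W O'" "Zero C O' (ShO C 1 W)" "neg C (ShM C 1 (Id C W))" v w
        "neg C (ShM C 1 u)" f "Zero C O' D"] f uvw obj O'_obj by (auto simp: Hom_def)
  have f1: "ShM C 1 f \<in> Hom C (ShO C 1 W) (ShO C 1 B)" and u1: "ShM C 1 u \<in> Hom C (ShO C 1 A) (ShO C 1 B)"
    using f uvw shift_hom by (auto simp: Hom_def)
  \<comment> \<open>Rotation puts the same sign on the last map of both triangles, so the signs
    cancel.\<close>
  have "neg C (ShM C 1 f) = neg C (ShM C 1 u \<cdot> h)"
    using eq comp_neg_right[OF f1 id_hom[OF shift_obj[OF obj(4)]]] comp_neg_left[OF u1 h] comp_id_right[OF f1]
      obj by simp
  then have "ShM C 1 f = ShM C 1 u \<cdot> h"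
    using neg_hom(3)[OF f1] neg_hom(3)[OF comp_hom[OF u1 h]] by metis
  also have "\<dots> = ShM C 1 (u \<cdot> ShM C (- 1) h)"
    using h uvw obj by (simp add: Hom_def shift_shift_obj shift_shift_arr)
  finally have "f = u \<cdot> ShM C (- 1) h"
    by (rule shift_inject[rotated 2]) (use h f uvw obj in \<open>auto simp: Hom_def shift_shift_obj\<close>)
  moreover have "ShM C (- 1) h \<in> Hom C W (Dom C u)"
    using shift_hom[OF h, of "- 1"] uvw obj by (simp add: Hom_def shift_shift_obj)
  ultimately show thesis
    using that by metis
qed

text \<open>The source of \<open>f\<close> is shifted by \<open>- n\<close> instead of the triangle
  by \<open>n\<close>, which would bring in the sign of a shifted triangle.\<close>

lemma triangle_lift_shift:
  assumes tri: "(u, v, w) \<in> Tri C" and f: "f \<in> Hom C W (ShO C n (Cod C u))"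
    and zero: "ShM C n v \<cdot> f = Zero C W (ShO C n (Cod C v))"
  obtains g where "g \<in> Hom C W (ShO C n (Dom C u))" "ShM C n u \<cdot> g = f"
proof -
  obtain A B D where uvw: "u \<in> Hom C A B" "v \<in> Hom C B D"
    using tri_hom[OF tri] by blast
  note obj = homD(4,5)[OF uvw(1)] homD(5)[OF uvw(2)] homD(4)[OF f]
  have f': "ShM C (- n) f \<in> Hom C (ShO C (- n) W) (Cod C u)"
    using shift_hom[OF f, of "- n"] uvw obj by (simp add: Hom_def)
  have "v \<cdot> ShM C (- n) f = ShM C (- n) (ShM C n v \<cdot> f)"
    using f uvw by (simp add: Hom_def)
  also have "\<dots> = Zero C (ShO C (- n) W) (Cod C v)"
    using zero shift_Zero[of W "ShO C n D" "- n"] uvw obj by (simp add: Hom_def)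
  finally obtain g where g: "g \<in> Hom C (ShO C (- n) W) (Dom C u)" "u \<cdot> g = ShM C (- n) f"
    using triangle_lift[OF tri f'] by blast
  have "ShM C n u \<cdot> ShM C n g = f"
    using arg_cong[OF g(2), of "ShM C n"] g(1) uvw f by (simp add: Hom_def)
  moreover have "ShM C n g \<in> Hom C W (ShO C n (Dom C u))"
    using shift_hom[OF g(1), of n] obj by simp
  ultimately show thesis
    using that by blast
qed

end

text \<open>\<open>K\<close> acts by translation, and cancellation in \<open>G\<close> makes the
  stabilizers trivial. The restriction to \<open>T\<close> in the action is there because
  \<open>BijGroup\<close> consists of extensional bijections.\<close>

lemma subgroup_torsor:
  assumes G: "group G" and K: "subgroup K G" and T: "T \<subseteq> carrier G" "T \<noteq> {}"
    and act: "\<And>k x. \<lbrakk>k \<in> K; x \<in> T\<rbrakk> \<Longrightarrow> k \<otimes>\<^bsub>G\<^esub> x \<in> T"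
    and trans: "\<And>x y. \<lbrakk>x \<in> T; y \<in> T\<rbrakk> \<Longrightarrow> \<exists>k\<in>K. k \<otimes>\<^bsub>G\<^esub> x = y"
  shows "torsor (G\<lparr>carrier := K\<rparr>) T (\<lambda>g. \<lambda>l\<in>T. g \<otimes>\<^bsub>G\<^esub> l)"
proof -
  interpret G: group G by fact
  interpret K: subgroup K G by fact
  have inK [simp]: "k \<in> carrier G" if "k \<in> K" for k
    using that by (rule K.mem_carrier)
  have inT [simp]: "x \<in> carrier G" if "x \<in> T" for x
    using that T by blast
  let ?\<phi> = "\<lambda>g. \<lambda>l\<in>T. g \<otimes>\<^bsub>G\<^esub> l"
  have bij: "?\<phi> k \<in> Bij T" if k: "k \<in> K" for k
  proof -
    have "bij_betw (?\<phi> k) T T"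
      by (rule bij_betw_byWitness[where f' = "\<lambda>x. inv\<^bsub>G\<^esub> k \<otimes>\<^bsub>G\<^esub> x"])
        (use k act in \<open>auto simp: G.m_assoc[symmetric]\<close>)
    then show ?thesis
      by (simp add: Bij_def)
  qed
  have "group_hom (G\<lparr>carrier := K\<rparr>) (BijGroup T) ?\<phi>"
  proof (rule group_hom.intro[OF K.subgroup_is_group[OF G] group_BijGroup], unfold_locales)
    show "?\<phi> \<in> hom (G\<lparr>carrier := K\<rparr>) (BijGroup T)"
    proof (rule homI)
      show "?\<phi> x \<in> carrier (BijGroup T)" if "x \<in> carrier (G\<lparr>carrier := K\<rparr>)" for x
        using that bij by (simp add: BijGroup_def)
      show "?\<phi> (x \<otimes>\<^bsub>G\<lparr>carrier := K\<rparr>\<^esub> y) = ?\<phi> x \<otimes>\<^bsub>BijGroup T\<^esub> ?\<phi> y"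
        if "x \<in> carrier (G\<lparr>carrier := K\<rparr>)" "y \<in> carrier (G\<lparr>carrier := K\<rparr>)" for x y
        using that bij act by (auto simp: BijGroup_def compose_def G.m_assoc fun_eq_iff restrict_def)
    qed
  qed
  then have "transitive_action (G\<lparr>carrier := K\<rparr>) T ?\<phi>"
    using trans by (auto simp: transitive_action_def transitive_action_axioms_def group_action_def)
  moreover have "stabilizer (G\<lparr>carrier := K\<rparr>) ?\<phi> x = {\<one>\<^bsub>G\<^esub>}" if "x \<in> T" for x
    using that by (auto simp: stabilizer_def G.r_cancel_one' K.one_closed)
  ultimately show ?thesis
    using T(2) by (simp add: torsor_def)
qed

text \<open>The counit is a family from the composite of \<open>R\<close> and \<open>L\<close> to
  the identity functor, whose comparisons are identities; \<open>counit_shift\<close> is its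
  compatibility with one translation.\<close>

lemma exact_adjunction_counit_shift_cmp:
  assumes "triangulated_category C" "triangulated_category D"
    and adj: "exact_adjunction C D L R unit counit" and B: "B \<in> Obj D"
  shows "ShM D n (counit B) \<cdot>\<^bsub>D\<^esub> shift_cmp C D L n (FO R B) \<cdot>\<^bsub>D\<^esub> FM L (shift_cmp D C R n B)
    = counit (ShO D n B)"
proof -
  interpret adj: exact_adjunction C D L R unit counit by fact
  interpret L: shift_functor C D L
    by (rule exact_functor_shift_functor[OF assms(1,2) adj.left_exact_functor])
  interpret R: shift_functor D C R
    by (rule exact_functor_shift_functor[OF assms(2,1) adj.right_exact_functor])
  have counit [simp]: "counit A \<in> Arr D" "Dom D (counit A) = FO L (FO R A)" "Cod D (counit A) = A"
    if "A \<in> Obj D" for A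
    using natural_trans.hom[OF adj.counit_natural that] by (simp_all add: Hom_def comp_fun_def)
  have "ShM D n (counit B) \<cdot>\<^bsub>D\<^esub> shift_cmp D D (comp_exfun D L R) n B
      = shift_cmp D D (id_exfun D) n B \<cdot>\<^bsub>D\<^esub> counit (ShO D n B)"
    by (rule shift_cmp_natural_trans[OF shift_functor_comp(1)[OF R.shift_functor_axioms L.shift_functor_axioms]
          shift_functor_id(1)[OF assms(2)] _ _ B])
      (use adj.counit_shift in \<open>auto simp: Hom_def\<close>)
  then show ?thesis
    using shift_functor_comp(2)[OF R.shift_functor_axioms L.shift_functor_axioms B, of n]
      shift_functor_id(2)[OF assms(2) B, of n] B by simp
qed

lemma exact_adjunction_unit_shift_cmp:
  assumes "triangulated_category C" "triangulated_category D"
    and adj: "exact_adjunction C D L R unit counit" and A: "A \<in> Obj C"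
  shows "shift_cmp D C R n (FO L A) \<cdot>\<^bsub>C\<^esub> FM R (shift_cmp C D L n A) \<cdot>\<^bsub>C\<^esub> unit (ShO C n A)
    = ShM C n (unit A)"
proof -
  interpret adj: exact_adjunction C D L R unit counit by fact
  interpret L: shift_functor C D L
    by (rule exact_functor_shift_functor[OF assms(1,2) adj.left_exact_functor])
  interpret R: shift_functor D C R
    by (rule exact_functor_shift_functor[OF assms(2,1) adj.right_exact_functor])
  have unit [simp]: "unit A \<in> Arr C" "Dom C (unit A) = A" "Cod C (unit A) = FO R (FO L A)"
    if "A \<in> Obj C" for A
    using natural_trans.hom[OF adj.unit_natural that] by (simp_all add: Hom_def comp_fun_def)
  have "ShM C n (unit A) \<cdot>\<^bsub>C\<^esub> shift_cmp C C (id_exfun C) n A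
      = shift_cmp C C (comp_exfun C R L) n A \<cdot>\<^bsub>C\<^esub> unit (ShO C n A)"
    by (rule shift_cmp_natural_trans[OF shift_functor_id(1)[OF assms(1)]
          shift_functor_comp(1)[OF L.shift_functor_axioms R.shift_functor_axioms] _ _ A])
      (use adj.unit_shift in \<open>auto simp: Hom_def\<close>)
  then show ?thesis
    using shift_functor_comp(2)[OF L.shift_functor_axioms R.shift_functor_axioms A, of n]
      shift_functor_id(2)[OF assms(1) A, of n] A by simp
qed

section \<open>Pullbacks and external products of cohomology classes\<close>

context category_with_products
begin

lemma prod_map_hom:
  assumes f: "f \<in> Hom P X X'" and g: "g \<in> Hom P Y Y'"
  shows "prod_map P f g \<in> Hom P (Prod P X Y) (Prod P X' Y')"
proof -
  note X = homD[OF f] and Y = homD[OF g]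
  have "\<exists>!h. h \<in> Hom P (Prod P X Y) (Prod P X' Y') \<and> Pr1 P X' Y' \<cdot> h = f \<cdot> Pr1 P X Y \<and>
      Pr2 P X' Y' \<cdot> h = g \<cdot> Pr2 P X Y"
    by (rule prod_universal[OF comp_hom[OF f pr1_hom] comp_hom[OF g pr2_hom]]) (fact X Y)+
  from theI'[OF this] show ?thesis
    unfolding prod_map_def X(2,3) Y(2,3) by blast
qed

end

context coefficient_system
begin

sublocale Sp: category_with_products "Sp S"
  by (rule spaces)

lemma pull_shift_functor:
  assumes "f \<in> Hom (Sp S) X Y"
  shows "shift_functor (Coef S Y) (Coef S X) (Pull S f)"
  by (rule exact_functor_shift_functor[OF coef_triangulated coef_triangulated
        exact_adjunction.left_exact_functor[OF pull_push[OF assms]]]) (fact Sp.homD[OF assms])+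

lemma push_shift_functor:
  assumes "f \<in> Hom (Sp S) X Y"
  shows "shift_functor (Coef S X) (Coef S Y) (Push S f)"
  by (rule exact_functor_shift_functor[OF coef_triangulated coef_triangulated
        exact_adjunction.right_exact_functor[OF pull_push[OF assms]]]) (fact Sp.homD[OF assms])+

lemma ext_bifunctor:
  assumes "X \<in> Obj (Sp S)" "Y \<in> Obj (Sp S)"
  shows "triangulated_bifunctor (Coef S X) (Coef S Y) (Coef S (Prod (Sp S) X Y)) (Ext S X Y)"
  unfolding triangulated_bifunctor_def
  using assms coef_triangulated ext_biexact Sp.prod_obj by simp

lemma one_obj [simp]: "X \<in> Obj (Sp S) \<Longrightarrow> One (Coef S X) \<in> Obj (Coef S X)"
  by (rule symmetric_monoidal.one_obj[OF coef_monoidal])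

lemma FOne_iso:
  "f \<in> Hom (Sp S) X Y \<Longrightarrow>
    FOne (Pull S f) \<in> Isos (Coef S X) (One (Coef S X)) (FO (Pull S f) (One (Coef S Y)))"
  by (rule symmetric_monoidal_functor.one_iso[OF pull_monoidal])

lemma pull_class_eq:
  assumes "f \<in> Hom (Sp S) X Y"
  shows "pull_class S f d A c = shift_cmp (Coef S Y) (Coef S X) (Pull S f) d A
    \<cdot>\<^bsub>Coef S X\<^esub> FM (Pull S f) c \<cdot>\<^bsub>Coef S X\<^esub> FOne (Pull S f)"
  using Sp.homD[OF assms] by (simp add: pull_class_def Let_def)

lemma pull_class_Coh:
  assumes f: "f \<in> Hom (Sp S) X Y" and c: "c \<in> Coh S Y d A" and A: "A \<in> Obj (Coef S Y)"
  shows "pull_class S f d A c \<in> Coh S X d (FO (Pull S f) A)"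
proof -
  interpret F: shift_functor "Coef S Y" "Coef S X" "Pull S f"
    by (rule pull_shift_functor[OF f])
  show ?thesis
    using c A Isos_Hom[OF FOne_iso[OF f]] by (simp add: pull_class_eq[OF f] Coh_def Hom_def)
qed

lemma pull_class_natural:
  assumes f: "f \<in> Hom (Sp S) X Y" and c: "c \<in> Coh S Y d A" and u: "u \<in> Hom (Coef S Y) A A'"
  shows "pull_class S f d A' (ShM (Coef S Y) d u \<cdot>\<^bsub>Coef S Y\<^esub> c)
    = ShM (Coef S X) d (FM (Pull S f) u) \<cdot>\<^bsub>Coef S X\<^esub> pull_class S f d A c"
proof -
  interpret F: shift_functor "Coef S Y" "Coef S X" "Pull S f"
    by (rule pull_shift_functor[OF f])
  show ?thesis
    using F.D.comp_eq_reassoc[OF F.shift_cmp_natural[of u d], of "FM (Pull S f) c \<cdot>\<^bsub>Coef S X\<^esub> FOne (Pull S f)"]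
      c F.C.homD[OF u] Isos_Hom[OF FOne_iso[OF f]]
    by (simp add: pull_class_eq[OF f] Coh_def Hom_def)
qed

lemma pull_class_Add:
  assumes f: "f \<in> Hom (Sp S) X Y" and A: "A \<in> Obj (Coef S Y)"
    and c: "c \<in> Coh S Y d A" and c': "c' \<in> Coh S Y d A"
  shows "pull_class S f d A (Add (Coef S Y) c c')
    = Add (Coef S X) (pull_class S f d A c) (pull_class S f d A c')"
proof -
  interpret F: shift_functor "Coef S Y" "Coef S X" "Pull S f"
    by (rule pull_shift_functor[OF f])
  let ?c = "FM (Pull S f) c" and ?c' = "FM (Pull S f) c'"
  have sc: "F.sc d A \<in> Hom (Coef S X) (FO (Pull S f) (ShO (Coef S Y) d A)) (ShO (Coef S X) d (FO (Pull S f) A))"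
    using A by (simp add: Hom_def)
  note one = Isos_Hom[OF FOne_iso[OF f]] and hom = F.hom[OF c[unfolded Coh_def]] F.hom[OF c'[unfolded Coh_def]]
  have "FM (Pull S f) (Add (Coef S Y) c c') = Add (Coef S X) ?c ?c'"
    using exact_functor.additive[OF exact_adjunction.left_exact_functor[OF pull_push[OF f]]] c c'
    by (simp add: additive_functor_def Coh_def)
  then show ?thesis
    using F.D.comp_add_left[OF hom one] F.D.comp_add_right[OF sc F.D.comp_hom[OF hom(1) one] F.D.comp_hom[OF hom(2) one]]
    by (simp add: pull_class_eq[OF f])
qed

text \<open>The bridge from vanishing after pullback to the vanishing that a triangle can use,
  namely of the composite of \<open>c\<close> with the shifted unit. By naturality of the unit, that
  composite factors through the pushforward of \<open>FM (Pull S f) c\<close>.\<close>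

lemma pull_class_Zero:
  assumes f: "f \<in> Hom (Sp S) X Y" and A: "A \<in> Obj (Coef S Y)" and c: "c \<in> Coh S Y d A"
    and zero: "pull_class S f d A c = Zero (Coef S X) (One (Coef S X)) (ShO (Coef S X) d (FO (Pull S f) A))"
  shows "ShM (Coef S Y) d (PPUnit S f A) \<cdot>\<^bsub>Coef S Y\<^esub> c
    = Zero (Coef S Y) (One (Coef S Y)) (ShO (Coef S Y) d (FO (Push S f) (FO (Pull S f) A)))"
proof -
  interpret F: shift_functor "Coef S Y" "Coef S X" "Pull S f"
    by (rule pull_shift_functor[OF f])
  interpret G: shift_functor "Coef S X" "Coef S Y" "Push S f"
    by (rule push_shift_functor[OF f])
  interpret adj: exact_adjunction "Coef S Y" "Coef S X" "Pull S f" "Push S f" "PPUnit S f" "PPCounit S f"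
    by (rule pull_push[OF f])
  let ?oneX = "One (Coef S X)" and ?oneY = "One (Coef S Y)" and ?Ad = "ShO (Coef S Y) d A"
  have one: "?oneX \<in> Obj (Coef S X)" "?oneY \<in> Obj (Coef S Y)"
    using Sp.homD[OF f] by simp_all
  have unit: "PPUnit S f B \<in> Hom (Coef S Y) B (FO (Push S f) (FO (Pull S f) B))" if "B \<in> Obj (Coef S Y)" for B
    using natural_trans.hom[OF adj.unit_natural that] by (simp add: comp_fun_def)
  have c': "c \<in> Hom (Coef S Y) ?oneY ?Ad"
    using c by (simp add: Coh_def)
  note Fc = F.hom[OF c'] and FOne = Isos_Hom[OF FOne_iso[OF f]]
  have sc: "F.sc d A \<in> Hom (Coef S X) (FO (Pull S f) ?Ad) (ShO (Coef S X) d (FO (Pull S f) A))"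
    using A by (simp add: Hom_def)
  have z: "Zero (Coef S X) B D \<in> Hom (Coef S X) B D" if "B \<in> Obj (Coef S X)" "D \<in> Obj (Coef S X)" for B D
    by (rule F.D.Zero_hom[OF that])
  \<comment> \<open>The pullback class is \<open>FM (Pull S f) c\<close> between two isomorphisms,
    \<open>F.sc d A\<close> and \<open>FOne\<close>. Cancelling both shows that the arrow itself
    vanishes.\<close>
  have "F.sc d A \<cdot>\<^bsub>Coef S X\<^esub> (FM (Pull S f) c \<cdot>\<^bsub>Coef S X\<^esub> FOne (Pull S f))
      = F.sc d A \<cdot>\<^bsub>Coef S X\<^esub> Zero (Coef S X) ?oneX (FO (Pull S f) ?Ad)"
    using zero F.D.comp_Zero_right[OF sc one(1)] by (simp add: pull_class_eq[OF f])
  then have "FM (Pull S f) c \<cdot>\<^bsub>Coef S X\<^esub> FOne (Pull S f) = Zero (Coef S X) ?oneX (FO (Pull S f) ?Ad)"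
    by (rule F.D.iso_cancel_left[OF F.shift_cmp_iso[OF A] F.D.comp_hom[OF Fc FOne] z, rotated 2])
      (use A one in auto)
  also have "\<dots> = Zero (Coef S X) (FO (Pull S f) ?oneY) (FO (Pull S f) ?Ad) \<cdot>\<^bsub>Coef S X\<^esub> FOne (Pull S f)"
    by (rule F.D.comp_Zero_left[OF FOne, symmetric]) (use A in simp)
  finally have Fc0: "FM (Pull S f) c = Zero (Coef S X) (FO (Pull S f) ?oneY) (FO (Pull S f) ?Ad)"
    by (rule F.D.iso_cancel_right[OF FOne_iso[OF f] Fc z, rotated 2]) (use A one in auto)
  have "ShM (Coef S Y) d (PPUnit S f A) \<cdot>\<^bsub>Coef S Y\<^esub> c
      = (G.sc d (FO (Pull S f) A) \<cdot>\<^bsub>Coef S Y\<^esub> FM (Push S f) (F.sc d A) \<cdot>\<^bsub>Coef S Y\<^esub> PPUnit S f ?Ad) \<cdot>\<^bsub>Coef S Y\<^esub> c"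
    using exact_adjunction_unit_shift_cmp[OF F.C.triangulated_category_axioms F.D.triangulated_category_axioms
        adj.exact_adjunction_axioms A, of d] by simp
  also have "\<dots> = (G.sc d (FO (Pull S f) A) \<cdot>\<^bsub>Coef S Y\<^esub> FM (Push S f) (F.sc d A)) \<cdot>\<^bsub>Coef S Y\<^esub> (PPUnit S f ?Ad \<cdot>\<^bsub>Coef S Y\<^esub> c)"
    using A c' unit[of ?Ad] by (simp add: Hom_def)
  also have "PPUnit S f ?Ad \<cdot>\<^bsub>Coef S Y\<^esub> c = FM (Push S f) (FM (Pull S f) c) \<cdot>\<^bsub>Coef S Y\<^esub> PPUnit S f ?oneY"
    using natural_trans.natural[OF adj.unit_natural c'] by (simp add: comp_fun_def)
  also have "FM (Push S f) (FM (Pull S f) c)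
      = Zero (Coef S Y) (FO (Push S f) (FO (Pull S f) ?oneY)) (FO (Push S f) (FO (Pull S f) ?Ad))"
    unfolding Fc0
    by (rule additive_functor_Zero[OF F.D.additive_category_axioms F.C.additive_category_axioms])
      (use exact_functor.additive[OF adj.right_exact_functor] A one in auto)
  also have "\<dots> \<cdot>\<^bsub>Coef S Y\<^esub> PPUnit S f ?oneY = Zero (Coef S Y) ?oneY (FO (Push S f) (FO (Pull S f) ?Ad))"
    by (rule F.C.comp_Zero_left[OF unit[OF one(2)]]) (use A in simp)
  also have "(G.sc d (FO (Pull S f) A) \<cdot>\<^bsub>Coef S Y\<^esub> FM (Push S f) (F.sc d A)) \<cdot>\<^bsub>Coef S Y\<^esub> \<dots>
      = Zero (Coef S Y) ?oneY (ShO (Coef S Y) d (FO (Push S f) (FO (Pull S f) A)))"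
    by (rule F.C.comp_Zero_right) (use A one in \<open>simp_all add: Hom_def\<close>)
  finally show ?thesis .
qed

text \<open>Pullback along an identity is only isomorphic to the identity functor, and pulling back
  along a product with the identity of \<open>Y\<close> alters \<open>\<beta>\<close> in this way.
  \<open>PullId\<close> undoes the change, being compatible with translation and with the unit
  object.\<close>

lemma pull_class_id:
  assumes Y: "Y \<in> Obj (Sp S)" and N: "N \<in> Obj (Coef S Y)" and b: "b \<in> Coh S Y e N"
  shows "ShM (Coef S Y) e (PullId S Y N) \<cdot>\<^bsub>Coef S Y\<^esub> pull_class S (Id (Sp S) Y) e N b = b"
proof -
  let ?F = "Pull S (Id (Sp S) Y)" and ?C = "Coef S Y"
  have id: "Id (Sp S) Y \<in> Hom (Sp S) Y Y"
    by (rule Sp.id_hom[OF Y])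
  interpret F: shift_functor ?C ?C ?F
    by (rule pull_shift_functor[OF id])
  interpret t: natural_iso ?C ?C ?F id_fun "PullId S Y"
    by (rule pull_id[OF Y])
  have t_arr [simp]: "PullId S Y B \<in> Arr ?C" "Dom ?C (PullId S Y B) = FO ?F B" "Cod ?C (PullId S Y B) = B"
    if "B \<in> Obj ?C" for B
    using t.hom[OF that] by (simp_all add: Hom_def)
  have "ShM ?C e (PullId S Y N) \<cdot>\<^bsub>?C\<^esub> F.sc e N = shift_cmp ?C ?C (id_exfun ?C) e N \<cdot>\<^bsub>?C\<^esub> PullId S Y (ShO ?C e N)"
    by (rule shift_cmp_natural_trans[OF F.shift_functor_axioms shift_functor_id(1)[OF F.C.triangulated_category_axioms] _ _ N])
      (use pull_id_shift[OF Y] in \<open>auto simp: Hom_def\<close>)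
  then have 1: "ShM ?C e (PullId S Y N) \<cdot>\<^bsub>?C\<^esub> F.sc e N = PullId S Y (ShO ?C e N)"
    using shift_functor_id(2)[OF F.C.triangulated_category_axioms N] N by simp
  have b': "b \<in> Arr ?C" "Dom ?C b = One ?C" "Cod ?C b = ShO ?C e N"
    using b by (simp_all add: Coh_def Hom_def)
  note one = Isos_Hom[OF FOne_iso[OF id]]
  have "ShM ?C e (PullId S Y N) \<cdot>\<^bsub>?C\<^esub> pull_class S (Id (Sp S) Y) e N b
      = (ShM ?C e (PullId S Y N) \<cdot>\<^bsub>?C\<^esub> F.sc e N) \<cdot>\<^bsub>?C\<^esub> (FM ?F b \<cdot>\<^bsub>?C\<^esub> FOne ?F)"
    using N b' one by (simp add: pull_class_eq[OF id] Hom_def)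
  also have "\<dots> = (PullId S Y (ShO ?C e N) \<cdot>\<^bsub>?C\<^esub> FM ?F b) \<cdot>\<^bsub>?C\<^esub> FOne ?F"
    unfolding 1 using N b' one by (simp add: Hom_def)
  also have "PullId S Y (ShO ?C e N) \<cdot>\<^bsub>?C\<^esub> FM ?F b = b \<cdot>\<^bsub>?C\<^esub> PullId S Y (One ?C)"
    using t.natural[of b "One ?C" "ShO ?C e N"] b' by (simp add: Hom_def)
  also have "(b \<cdot>\<^bsub>?C\<^esub> PullId S Y (One ?C)) \<cdot>\<^bsub>?C\<^esub> FOne ?F = b"
    using b' one Y pull_id_one[OF Y] by (simp add: Hom_def)
  finally show ?thesis .
qed

section \<open>External products of classes: naturality, additivity, pullback\<close>

lemma ext_class_Coh:
  assumes X: "X \<in> Obj (Sp S)" and Y: "Y \<in> Obj (Sp S)" and A: "A \<in> Obj (Coef S X)" and B: "B \<in> Obj (Coef S Y)"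
    and a: "a \<in> Coh S X p A" and b: "b \<in> Coh S Y q B"
  shows "ext_class S X Y p q A B a b \<in> Coh S (Prod (Sp S) X Y) (p + q) (BO (Ext S X Y) A B)"
proof -
  interpret T: triangulated_bifunctor "Coef S X" "Coef S Y" "Coef S (Prod (Sp S) X Y)" "Ext S X Y"
    by (rule ext_bifunctor[OF X Y])
  show ?thesis
    using assms Isos_Hom[OF ext_one[OF X Y]] by (simp add: ext_class_def Let_def Coh_def Hom_def)
qed

lemma ext_class_natural:
  assumes X: "X \<in> Obj (Sp S)" and Y: "Y \<in> Obj (Sp S)"
    and u: "u \<in> Hom (Coef S X) A A'" and v: "v \<in> Hom (Coef S Y) B B'"
    and a: "a \<in> Coh S X p A" and b: "b \<in> Coh S Y q B"
  shows "ext_class S X Y p q A' B' (ShM (Coef S X) p u \<cdot>\<^bsub>Coef S X\<^esub> a) (ShM (Coef S Y) q v \<cdot>\<^bsub>Coef S Y\<^esub> b)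
    = ShM (Coef S (Prod (Sp S) X Y)) (p + q) (BM (Ext S X Y) u v)
      \<cdot>\<^bsub>Coef S (Prod (Sp S) X Y)\<^esub> ext_class S X Y p q A B a b"
proof -
  let ?D = "Coef S (Prod (Sp S) X Y)" and ?T = "Ext S X Y"
  interpret T: triangulated_bifunctor "Coef S X" "Coef S Y" ?D ?T
    by (rule ext_bifunctor[OF X Y])
  note u' = T.C1.homD[OF u] and v' = T.C2.homD[OF v]
  have ab: "a \<in> Arr (Coef S X)" "Dom (Coef S X) a = One (Coef S X)" "Cod (Coef S X) a = ShO (Coef S X) p A"
      "b \<in> Arr (Coef S Y)" "Dom (Coef S Y) b = One (Coef S Y)" "Cod (Coef S Y) b = ShO (Coef S Y) q B"
    using a b by (auto simp: Coh_def Hom_def)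
  note one = T.D.homD[OF Isos_Hom[OF ext_one[OF X Y]]]
  let ?u = "ShM (Coef S X) p u" and ?v = "ShM (Coef S Y) q v"
  have "T.bsc p q A' B' \<cdot>\<^bsub>?D\<^esub> (BM ?T ?u ?v \<cdot>\<^bsub>?D\<^esub> (BM ?T a b \<cdot>\<^bsub>?D\<^esub> ExtOne S X Y))
      = ShM ?D (p + q) (BM ?T u v) \<cdot>\<^bsub>?D\<^esub> (T.bsc p q A B \<cdot>\<^bsub>?D\<^esub> (BM ?T a b \<cdot>\<^bsub>?D\<^esub> ExtOne S X Y))"
    by (rule T.D.comp_eq_reassoc)
      (use T.bishift_cmp_natural[of u v p q] u' v' ab one in \<open>simp_all\<close>)
  moreover have "BM ?T ?u ?v \<cdot>\<^bsub>?D\<^esub> (BM ?T a b \<cdot>\<^bsub>?D\<^esub> ExtOne S X Y)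
      = BM ?T (?u \<cdot>\<^bsub>Coef S X\<^esub> a) (?v \<cdot>\<^bsub>Coef S Y\<^esub> b) \<cdot>\<^bsub>?D\<^esub> ExtOne S X Y"
    using u' v' ab one by simp
  ultimately show ?thesis
    by (simp add: ext_class_def Let_def)
qed

lemma ext_class_Add_left:
  assumes X: "X \<in> Obj (Sp S)" and Y: "Y \<in> Obj (Sp S)" and A: "A \<in> Obj (Coef S X)" and B: "B \<in> Obj (Coef S Y)"
    and a: "a \<in> Coh S X p A" and a': "a' \<in> Coh S X p A" and b: "b \<in> Coh S Y q B"
  shows "ext_class S X Y p q A B (Add (Coef S X) a a') b
    = Add (Coef S (Prod (Sp S) X Y)) (ext_class S X Y p q A B a b) (ext_class S X Y p q A B a' b)"
proof -
  let ?D = "Coef S (Prod (Sp S) X Y)" and ?T = "Ext S X Y"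
  interpret T: triangulated_bifunctor "Coef S X" "Coef S Y" ?D ?T
    by (rule ext_bifunctor[OF X Y])
  note h = a[unfolded Coh_def] a'[unfolded Coh_def] b[unfolded Coh_def]
  note one = Isos_Hom[OF ext_one[OF X Y]]
  note ab = T.hom[OF h(1,3)] T.hom[OF h(2,3)]
  have bsc: "T.bsc p q A B \<in> Hom ?D (BO ?T (ShO (Coef S X) p A) (ShO (Coef S Y) q B))
      (ShO ?D (p + q) (BO ?T A B))"
    using A B by (simp add: Hom_def)
  show ?thesis
    using T.D.comp_add_left[OF ab one]
      T.D.comp_add_right[OF bsc T.D.comp_hom[OF ab(1) one] T.D.comp_hom[OF ab(2) one]] T.BM_Add_left[OF h]
    by (simp add: ext_class_def Let_def)
qed

text \<open>Three squares are pasted: the exchange of shifts (\<open>ex\<close>), naturality of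
  \<open>ExtPull\<close> at the pair \<open>a\<close>, \<open>b\<close> (\<open>tnat\<close>), and
  its compatibility with unit objects (\<open>tone\<close>). They correspond to the three factors of
  \<open>ext_class\<close>.\<close>

lemma pull_ext_class:
  assumes f: "f \<in> Hom (Sp S) X X'" and g: "g \<in> Hom (Sp S) Y Y'"
    and M: "M \<in> Obj (Coef S X')" and N: "N \<in> Obj (Coef S Y')"
    and a: "a \<in> Coh S X' p M" and b: "b \<in> Coh S Y' q N"
  shows "ShM (Coef S (Prod (Sp S) X Y)) (p + q) (ExtPull S f g M N) \<cdot>\<^bsub>Coef S (Prod (Sp S) X Y)\<^esub>
      pull_class S (prod_map (Sp S) f g) (p + q) (BO (Ext S X' Y') M N) (ext_class S X' Y' p q M N a b)
    = ext_class S X Y p q (FO (Pull S f) M) (FO (Pull S g) N) (pull_class S f p M a) (pull_class S g q N b)"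
proof -
  note X = Sp.homD(4,5)[OF f] and Y = Sp.homD(4,5)[OF g]
  note fg = Sp.prod_map_hom[OF f g]
  let ?D = "Coef S (Prod (Sp S) X Y)" and ?D' = "Coef S (Prod (Sp S) X' Y')" and ?F = "Pull S (prod_map (Sp S) f g)"
  let ?T = "Ext S X Y" and ?T' = "Ext S X' Y'" and ?t = "ExtPull S f g"
  interpret T: triangulated_bifunctor "Coef S X" "Coef S Y" ?D ?T
    by (rule ext_bifunctor[OF X(1) Y(1)])
  interpret T': triangulated_bifunctor "Coef S X'" "Coef S Y'" ?D' ?T'
    by (rule ext_bifunctor[OF X(2) Y(2)])
  interpret F: shift_functor ?D' ?D ?F
    by (rule pull_shift_functor[OF fg])
  interpret f: shift_functor "Coef S X'" "Coef S X" "Pull S f"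
    by (rule pull_shift_functor[OF f])
  interpret g: shift_functor "Coef S Y'" "Coef S Y" "Pull S g"
    by (rule pull_shift_functor[OF g])
  interpret t: bi_natural_iso "Coef S X'" "Coef S Y'" ?D "postcomp2 ?F ?T'" "precomp2 ?T (Pull S f) (Pull S g)" ?t
    by (rule ext_pull[OF f g])
  have t_arr [simp]: "?t A B \<in> Arr ?D" "Dom ?D (?t A B) = FO ?F (BO ?T' A B)"
      "Cod ?D (?t A B) = BO ?T (FO (Pull S f) A) (FO (Pull S g) B)"
    if "A \<in> Obj (Coef S X')" "B \<in> Obj (Coef S Y')" for A B
    using t.component_arr[OF that] by simp_all
  have ab: "a \<in> Arr (Coef S X')" "Dom (Coef S X') a = One (Coef S X')" "Cod (Coef S X') a = ShO (Coef S X') p M"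
      "b \<in> Arr (Coef S Y')" "Dom (Coef S Y') b = One (Coef S Y')" "Cod (Coef S Y') b = ShO (Coef S Y') q N"
    using a b by (auto simp: Coh_def Hom_def)
  note E = T.D.homD[OF Isos_Hom[OF ext_one[OF X(1) Y(1)]]] T'.D.homD[OF Isos_Hom[OF ext_one[OF X(2) Y(2)]]]
  note U = T.D.homD[OF Isos_Hom[OF FOne_iso[OF fg]]] T.C1.homD[OF Isos_Hom[OF FOne_iso[OF f]]]
    T.C2.homD[OF Isos_Hom[OF FOne_iso[OF g]]]
  let ?W = "BO ?T' M N"
  have ex: "ShM ?D (p + q) (?t M N) \<cdot>\<^bsub>?D\<^esub> (F.sc (p + q) ?W \<cdot>\<^bsub>?D\<^esub> FM ?F (T'.bsc p q M N))
      = (T.bsc p q (FO (Pull S f) M) (FO (Pull S g) N) \<cdot>\<^bsub>?D\<^esub> BM ?T (f.sc p M) (g.sc q N))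
        \<cdot>\<^bsub>?D\<^esub> ?t (ShO (Coef S X') p M) (ShO (Coef S Y') q N)"
    using bishift_cmp_exchange[OF T'.triangulated_bifunctor_axioms T.triangulated_bifunctor_axioms
      F.shift_functor_axioms f.shift_functor_axioms g.shift_functor_axioms t.bi_natural_iso_axioms
      ext_pull_shift_left[OF f g, unfolded Let_def] ext_pull_shift_right[OF f g, unfolded Let_def] M N, of p q]
      M N by simp
  have tnat: "?t (ShO (Coef S X') p M) (ShO (Coef S Y') q N) \<cdot>\<^bsub>?D\<^esub> FM ?F (BM ?T' a b)
      = BM ?T (FM (Pull S f) a) (FM (Pull S g) b) \<cdot>\<^bsub>?D\<^esub> ?t (One (Coef S X')) (One (Coef S Y'))"
    using t.natural_arr[of a b] ab by simp
  have tone: "?t (One (Coef S X')) (One (Coef S Y')) \<cdot>\<^bsub>?D\<^esub> (FM ?F (ExtOne S X' Y') \<cdot>\<^bsub>?D\<^esub> FOne ?F)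
      = BM ?T (FOne (Pull S f)) (FOne (Pull S g)) \<cdot>\<^bsub>?D\<^esub> ExtOne S X Y"
    using ext_pull_one[OF f g] by (simp add: Let_def)
  have "ShM ?D (p + q) (?t M N) \<cdot>\<^bsub>?D\<^esub> pull_class S (prod_map (Sp S) f g) (p + q) ?W (ext_class S X' Y' p q M N a b)
      = (ShM ?D (p + q) (?t M N) \<cdot>\<^bsub>?D\<^esub> (F.sc (p + q) ?W \<cdot>\<^bsub>?D\<^esub> FM ?F (T'.bsc p q M N)))
        \<cdot>\<^bsub>?D\<^esub> (FM ?F (BM ?T' a b) \<cdot>\<^bsub>?D\<^esub> (FM ?F (ExtOne S X' Y') \<cdot>\<^bsub>?D\<^esub> FOne ?F))"
    using M N ab E U X Y by (simp add: pull_class_eq[OF fg] ext_class_def Let_def)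
  also have "\<dots> = (T.bsc p q (FO (Pull S f) M) (FO (Pull S g) N) \<cdot>\<^bsub>?D\<^esub> BM ?T (f.sc p M) (g.sc q N))
      \<cdot>\<^bsub>?D\<^esub> ((?t (ShO (Coef S X') p M) (ShO (Coef S Y') q N) \<cdot>\<^bsub>?D\<^esub> FM ?F (BM ?T' a b))
      \<cdot>\<^bsub>?D\<^esub> (FM ?F (ExtOne S X' Y') \<cdot>\<^bsub>?D\<^esub> FOne ?F))"
    unfolding ex using M N ab E U X Y by simp
  also have "\<dots> = (T.bsc p q (FO (Pull S f) M) (FO (Pull S g) N) \<cdot>\<^bsub>?D\<^esub> BM ?T (f.sc p M) (g.sc q N))
      \<cdot>\<^bsub>?D\<^esub> (BM ?T (FM (Pull S f) a) (FM (Pull S g) b)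
      \<cdot>\<^bsub>?D\<^esub> (?t (One (Coef S X')) (One (Coef S Y')) \<cdot>\<^bsub>?D\<^esub> (FM ?F (ExtOne S X' Y') \<cdot>\<^bsub>?D\<^esub> FOne ?F)))"
    unfolding tnat using M N ab E U X Y by simp
  also have "\<dots> = ext_class S X Y p q (FO (Pull S f) M) (FO (Pull S g) N) (pull_class S f p M a) (pull_class S g q N b)"
    unfolding tone using M N ab E U X Y
    by (simp add: pull_class_eq[OF f] pull_class_eq[OF g] ext_class_def Let_def)
  finally show ?thesis .
qed

text \<open>\<open>ext_pull_id\<close> is \<open>ExtPull\<close> followed by \<open>PullId\<close>
  in the second factor; that extra map restores \<open>b\<close> from its pullback along the
  identity.\<close>

lemma pull_ext_class_id:
  assumes f: "f \<in> Hom (Sp S) X X'" and Y: "Y \<in> Obj (Sp S)"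
    and M: "M \<in> Obj (Coef S X')" and N: "N \<in> Obj (Coef S Y)"
    and a: "a \<in> Coh S X' p M" and b: "b \<in> Coh S Y q N"
  shows "ShM (Coef S (Prod (Sp S) X Y)) (p + q) (ext_pull_id S f Y M N) \<cdot>\<^bsub>Coef S (Prod (Sp S) X Y)\<^esub>
      pull_class S (times_id S f Y) (p + q) (BO (Ext S X' Y) M N) (ext_class S X' Y p q M N a b)
    = ext_class S X Y p q (FO (Pull S f) M) N (pull_class S f p M a) b"
proof -
  let ?D = "Coef S (Prod (Sp S) X Y)" and ?D' = "Coef S (Prod (Sp S) X' Y)" and ?id = "Id (Sp S) Y"
  have X: "X \<in> Obj (Sp S)" "X' \<in> Obj (Sp S)" and dom: "Dom (Sp S) f = X"
    using Sp.homD[OF f] by auto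
  have id: "?id \<in> Hom (Sp S) Y Y"
    by (rule Sp.id_hom[OF Y])
  interpret T: triangulated_bifunctor "Coef S X" "Coef S Y" ?D "Ext S X Y"
    by (rule ext_bifunctor[OF X(1) Y])
  interpret T': triangulated_bifunctor "Coef S X'" "Coef S Y" ?D' "Ext S X' Y"
    by (rule ext_bifunctor[OF X(2) Y])
  interpret f: shift_functor "Coef S X'" "Coef S X" "Pull S f"
    by (rule pull_shift_functor[OF f])
  interpret t: bi_natural_iso "Coef S X'" "Coef S Y" ?D "postcomp2 (Pull S (times_id S f Y)) (Ext S X' Y)"
      "precomp2 (Ext S X Y) (Pull S f) (Pull S ?id)" "ExtPull S f ?id"
    by (rule ext_pull[OF f id])
  have N': "PullId S Y N \<in> Hom (Coef S Y) (FO (Pull S ?id) N) N"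
    using natural_trans.hom[OF natural_iso.axioms(1)[OF pull_id[OF Y]] N] by simp
  have 1: "Id (Coef S X) (FO (Pull S f) M) \<in> Hom (Coef S X) (FO (Pull S f) M) (FO (Pull S f) M)"
    using M by (simp add: Hom_def)
  note pa = pull_class_Coh[OF f a M] and pb = pull_class_Coh[OF id b N]
  note E = pull_class_Coh[OF Sp.prod_map_hom[OF f id] ext_class_Coh[OF X(2) Y M N a b] T'.obj[OF M N]]
  let ?pc = "pull_class S (times_id S f Y) (p + q) (BO (Ext S X' Y) M N) (ext_class S X' Y p q M N a b)"
  have "ShM ?D (p + q) (ext_pull_id S f Y M N) \<cdot>\<^bsub>?D\<^esub> ?pc
      = ShM ?D (p + q) (BM (Ext S X Y) (Id (Coef S X) (FO (Pull S f) M)) (PullId S Y N)) \<cdot>\<^bsub>?D\<^esub>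
        (ShM ?D (p + q) (ExtPull S f ?id M N) \<cdot>\<^bsub>?D\<^esub> ?pc)"
    using t.component_arr[OF M N] T.C2.homD[OF N'] M N E
    by (simp add: ext_pull_id_def Let_def dom Coh_def Hom_def)
  also have "\<dots> = ext_class S X Y p q (FO (Pull S f) M) N
      (ShM (Coef S X) p (Id (Coef S X) (FO (Pull S f) M)) \<cdot>\<^bsub>Coef S X\<^esub> pull_class S f p M a)
      (ShM (Coef S Y) q (PullId S Y N) \<cdot>\<^bsub>Coef S Y\<^esub> pull_class S ?id q N b)"
    unfolding pull_ext_class[OF f id M N a b]
    by (rule ext_class_natural[OF X(1) Y 1 N' pa pb, symmetric])
  also have "\<dots> = ext_class S X Y p q (FO (Pull S f) M) N (pull_class S f p M a) b"
    using pull_class_id[OF Y N b] pa M by (simp add: Coh_def Hom_def)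
  finally show ?thesis .
qed

end

section \<open>Localizations\<close>

lemma (in triangulated_category) shift_comp_eq_reassoc:
  assumes "a \<cdot> b = c \<cdot> d"
    and "a \<in> Arr C" "b \<in> Arr C" "Dom C a = Cod C b"
    and "c \<in> Arr C" "d \<in> Arr C" "Dom C c = Cod C d"
    and "x \<in> Arr C" "Cod C x = ShO C n (Dom C b)"
  shows "ShM C n a \<cdot> (ShM C n b \<cdot> x) = ShM C n c \<cdot> (ShM C n d \<cdot> x)"
proof (rule comp_eq_reassoc)
  show "ShM C n a \<cdot> ShM C n b = ShM C n c \<cdot> ShM C n d"
    using arg_cong[OF assms(1), of "ShM C n"] assms(2-7) by simp
qed (use assms(2-) in auto)

locale recollement_system = coefficient_system S + recollement S Z U X i j R
  for S :: "('s, 'f, 'o, 'm) coeff_system"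
    and Z U X :: "'s"
    and i j :: "'f"
    and R :: "('o, 'm) recol"
begin

lemma space_obj [simp]: "Z \<in> Obj (Sp S)" "U \<in> Obj (Sp S)" "X \<in> Obj (Sp S)"
  using Sp.homD[OF i_hom] Sp.homD[OF j_hom] by simp_all

lemma i_space [simp]: "Dom (Sp S) i = Z" "Cod (Sp S) i = X"
  using Sp.homD[OF i_hom] by simp_all

sublocale CX: triangulated_category "Coef S X"
  by (simp add: coef_triangulated)

sublocale CZ: triangulated_category "Coef S Z"
  by (simp add: coef_triangulated)

sublocale Pull: shift_functor "Coef S X" "Coef S Z" "Pull S i"
  by (rule pull_shift_functor[OF i_hom])

sublocale Push: shift_functor "Coef S Z" "Coef S X" "Push S i"
  by (rule push_shift_functor[OF i_hom])

sublocale UpSh: is_functor "Coef S X" "Coef S Z" "UpSh R"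
  by (rule adjunction.right_functor[OF upper_shriek])

abbreviation "up A \<equiv> FO (UpSh R) A"
abbreviation "pu A \<equiv> FO (Push S i) (FO (UpSh R) A)"

lemma UpCounit_hom: "A \<in> Obj (Coef S X) \<Longrightarrow> UpCounit R A \<in> Hom (Coef S X) (pu A) A"
  using natural_trans.hom[OF adjunction.counit_natural[OF upper_shriek], of A] by (simp add: comp_fun_def)

lemma UpCounit_natural:
  "u \<in> Hom (Coef S X) A A' \<Longrightarrow>
    UpCounit R A' \<cdot>\<^bsub>Coef S X\<^esub> FM (Push S i) (FM (UpSh R) u) = u \<cdot>\<^bsub>Coef S X\<^esub> UpCounit R A"
  using natural_trans.natural[OF adjunction.counit_natural[OF upper_shriek], of u A A']
  by (simp add: comp_fun_def)

lemma PPCounit_hom: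
  "M \<in> Obj (Coef S Z) \<Longrightarrow> PPCounit S i M \<in> Hom (Coef S Z) (FO (Pull S i) (FO (Push S i) M)) M"
  using natural_trans.hom[OF adjunction.counit_natural[OF exact_adjunction.axioms(1)[OF pull_push[OF i_hom]]], of M]
  by (simp add: comp_fun_def)

lemma PPCounit_natural:
  "u \<in> Hom (Coef S Z) M M' \<Longrightarrow>
    PPCounit S i M' \<cdot>\<^bsub>Coef S Z\<^esub> FM (Pull S i) (FM (Push S i) u) = u \<cdot>\<^bsub>Coef S Z\<^esub> PPCounit S i M"
  using natural_trans.natural[OF adjunction.counit_natural[OF exact_adjunction.axioms(1)[OF pull_push[OF i_hom]]], of u M M']
  by (simp add: comp_fun_def)

section \<open>Classes with support and their adjoints\<close>

lemma supp_group_eq: "supp_group S i R d A = coh_group S X d (pu A)"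
  by (simp add: supp_group_def coh_group_def Let_def)

lemma coh_group_sel [simp]:
  "carrier (coh_group S W d A) = Coh S W d A" "mult (coh_group S W d A) = Add (Coef S W)"
  "one (coh_group S W d A) = Zero (Coef S W) (One (Coef S W)) (ShO (Coef S W) d A)"
  by (simp_all add: coh_group_def hom_group_def Coh_def)

lemma coh_group_group: "\<lbrakk>W \<in> Obj (Sp S); A \<in> Obj (Coef S W)\<rbrakk> \<Longrightarrow> group (coh_group S W d A)"
  unfolding coh_group_def
  by (intro additive_category.hom_group[OF triangulated_category.axioms(1)[OF coef_triangulated]]
      triangulated_category.shift_obj[OF coef_triangulated] one_obj)

lemma forg_eq: "forg S i R d A c = ShM (Coef S X) d (UpCounit R A) \<cdot>\<^bsub>Coef S X\<^esub> c"
  by (simp add: forg_def Let_def)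

lemma forg_hom:
  assumes A: "A \<in> Obj (Coef S X)"
  shows "group_hom (supp_group S i R d A) (coh_group S X d A) (forg S i R d A)"
  unfolding supp_group_eq
proof (rule group_hom.intro[OF coh_group_group coh_group_group], unfold_locales)
  note h = CX.shift_hom[OF UpCounit_hom[OF A], of d]
  show "forg S i R d A \<in> hom (coh_group S X d (pu A)) (coh_group S X d A)"
    using CX.comp_add_right[OF h] CX.comp_hom[OF h] by (auto simp: hom_def forg_eq Coh_def)
qed (use A in auto)

lemma Lift_iff: "c' \<in> Lift S i R d A c \<longleftrightarrow> c' \<in> Coh S X d (pu A) \<and> forg S i R d A c' = c"
  by (simp add: Lift_def supp_group_eq)

text \<open>The shift-compatible counit absorbs the comparison isomorphism of \<open>i\<^sub>*\<close>, so that passing to the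
  adjoint becomes pulling back a class.\<close>

lemma supp_adj_eq:
  assumes A: "A \<in> Obj (Coef S X)" and c: "c \<in> Coh S X d (pu A)"
  shows "supp_adj S i R d A c
    = ShM (Coef S Z) d (PPCounit S i (up A)) \<cdot>\<^bsub>Coef S Z\<^esub> pull_class S i d (pu A) c"
proof -
  let ?E = "up A" and ?s = "Push.sc d (up A)"
  have E: "?E \<in> Obj (Coef S Z)"
    using A by simp
  have c': "c \<in> Arr (Coef S X)" "Dom (Coef S X) c = One (Coef S X)" "Cod (Coef S X) c = ShO (Coef S X) d (pu A)"
    using c by (auto simp: Coh_def Hom_def)
  note one = CZ.homD[OF Isos_Hom[OF FOne_iso[OF i_hom]]]
  note inv = CX.homD[OF Isos_Hom[OF CX.iso_inv(1)[OF Push.shift_cmp_iso[OF E, of d]]]]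
  have "?s \<cdot>\<^bsub>Coef S X\<^esub> (inv_arr (Coef S X) ?s \<cdot>\<^bsub>Coef S X\<^esub> c) = (?s \<cdot>\<^bsub>Coef S X\<^esub> inv_arr (Coef S X) ?s) \<cdot>\<^bsub>Coef S X\<^esub> c"
    by (rule CX.comp_assoc_arr[symmetric]) (use E inv c' in auto)
  then have sc: "?s \<cdot>\<^bsub>Coef S X\<^esub> (inv_arr (Coef S X) ?s \<cdot>\<^bsub>Coef S X\<^esub> c) = c"
    using CX.iso_inv(3)[OF Push.shift_cmp_iso[OF E, of d]] c' by simp
  have Fsc: "FM (Pull S i) ?s \<cdot>\<^bsub>Coef S Z\<^esub> FM (Pull S i) (inv_arr (Coef S X) ?s \<cdot>\<^bsub>Coef S X\<^esub> c) = FM (Pull S i) c"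
    using arg_cong[OF sc, of "FM (Pull S i)"] E inv c' by (subst Pull.comp_arr[symmetric]) auto
  have "supp_adj S i R d A c = (ShM (Coef S Z) d (PPCounit S i ?E) \<cdot>\<^bsub>Coef S Z\<^esub> Pull.sc d (pu A)
      \<cdot>\<^bsub>Coef S Z\<^esub> FM (Pull S i) ?s) \<cdot>\<^bsub>Coef S Z\<^esub>
      (FM (Pull S i) (inv_arr (Coef S X) ?s \<cdot>\<^bsub>Coef S X\<^esub> c) \<cdot>\<^bsub>Coef S Z\<^esub> FOne (Pull S i))"
    unfolding exact_adjunction_counit_shift_cmp[OF CX.triangulated_category_axioms CZ.triangulated_category_axioms
        pull_push[OF i_hom] E]
    by (simp add: supp_adj_def Let_def)
  also have "\<dots> = ShM (Coef S Z) d (PPCounit S i ?E) \<cdot>\<^bsub>Coef S Z\<^esub> Pull.sc d (pu A)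
      \<cdot>\<^bsub>Coef S Z\<^esub> ((FM (Pull S i) ?s \<cdot>\<^bsub>Coef S Z\<^esub> FM (Pull S i) (inv_arr (Coef S X) ?s \<cdot>\<^bsub>Coef S X\<^esub> c))
      \<cdot>\<^bsub>Coef S Z\<^esub> FOne (Pull S i))"
    using E inv c' one CZ.homD[OF PPCounit_hom[OF E]] by simp
  finally show ?thesis
    unfolding Fsc by (simp add: pull_class_eq[OF i_hom])
qed

lemma supp_adj_Coh:
  assumes A: "A \<in> Obj (Coef S X)" and c: "c \<in> Coh S X d (pu A)"
  shows "supp_adj S i R d A c \<in> Coh S Z d (up A)"
  using CZ.comp_hom[OF CZ.shift_hom[OF PPCounit_hom[of "up A"], of d] pull_class_Coh[OF i_hom c, unfolded Coh_def]] A
  by (simp add: supp_adj_eq[OF assms] Coh_def)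

text \<open>Clear from the form in \<open>supp_adj_eq\<close>, where the adjoint is a pullback class
  followed by a fixed arrow; both operations are additive.\<close>

lemma supp_adj_hom:
  assumes A: "A \<in> Obj (Coef S X)"
  shows "group_hom (supp_group S i R d A) (coh_group S Z d (up A)) (supp_adj S i R d A)"
  unfolding supp_group_eq
proof (rule group_hom.intro[OF coh_group_group coh_group_group], unfold_locales)
  have E: "pu A \<in> Obj (Coef S X)"
    using A by simp
  have h: "ShM (Coef S Z) d (PPCounit S i (up A))
      \<in> Hom (Coef S Z) (ShO (Coef S Z) d (FO (Pull S i) (pu A))) (ShO (Coef S Z) d (up A))"
    using CZ.shift_hom[OF PPCounit_hom] A by simp
  show "supp_adj S i R d A \<in> hom (coh_group S X d (pu A)) (coh_group S Z d (up A))"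
  proof (rule homI; simp only: coh_group_sel)
    fix x y assume xy: "x \<in> Coh S X d (pu A)" "y \<in> Coh S X d (pu A)"
    have "Add (Coef S X) x y \<in> Coh S X d (pu A)"
      using xy CX.Add_hom by (simp add: Coh_def)
    then show "supp_adj S i R d A (Add (Coef S X) x y)
        = Add (Coef S Z) (supp_adj S i R d A x) (supp_adj S i R d A y)"
      using xy A pull_class_Add[OF i_hom E xy]
        CZ.comp_add_right[OF h pull_class_Coh[OF i_hom xy(1) E, unfolded Coh_def]
          pull_class_Coh[OF i_hom xy(2) E, unfolded Coh_def]]
      by (simp add: supp_adj_eq)
  qed (rule supp_adj_Coh[OF A])
qed (use A in auto)

lemma supp_adj_natural:
  assumes c: "c \<in> Coh S X d (pu A)" and u: "u \<in> Hom (Coef S X) A A'"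
  shows "supp_adj S i R d A' (ShM (Coef S X) d (FM (Push S i) (FM (UpSh R) u)) \<cdot>\<^bsub>Coef S X\<^esub> c)
    = ShM (Coef S Z) d (FM (UpSh R) u) \<cdot>\<^bsub>Coef S Z\<^esub> supp_adj S i R d A c"
proof -
  note A = CX.homD(4,5)[OF u]
  let ?v = "FM (UpSh R) u"
  have v: "?v \<in> Hom (Coef S Z) (up A) (up A')"
    by (rule UpSh.hom[OF u])
  note w = Push.hom[OF v]
  have c': "ShM (Coef S X) d (FM (Push S i) ?v) \<cdot>\<^bsub>Coef S X\<^esub> c \<in> Coh S X d (pu A')"
    using CX.comp_hom[OF CX.shift_hom[OF w] c[unfolded Coh_def]] by (simp add: Coh_def)
  have p: "pull_class S i d (pu A) c \<in> Coh S Z d (FO (Pull S i) (pu A))"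
    by (rule pull_class_Coh[OF i_hom c]) (use A in simp)
  note e = CZ.homD[OF PPCounit_hom[OF UpSh.obj[OF A(1)]]] CZ.homD[OF PPCounit_hom[OF UpSh.obj[OF A(2)]]]
  show ?thesis
    unfolding supp_adj_eq[OF A(1) c] supp_adj_eq[OF A(2) c'] pull_class_natural[OF i_hom c w]
    by (rule CZ.shift_comp_eq_reassoc[OF PPCounit_natural[OF v]])
      (use e p CZ.homD[OF v] in \<open>auto simp: Coh_def Hom_def\<close>)
qed

text \<open>Exactness at \<open>A\<close> of the triangle
  \<open>i_* i^! A -> A -> j_* j^* A\<close>: the pullback condition says that \<open>c\<close> dies
  in the third term, so it comes from the first.\<close>

lemma Lift_nonempty:
  assumes A: "A \<in> Obj (Coef S X)" and c: "c \<in> Coh S X d A"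
    and zero: "pull_class S j d A c = Zero (Coef S U) (One (Coef S U)) (ShO (Coef S U) d (FO (Pull S j) A))"
  shows "Lift S i R d A c \<noteq> {}"
proof -
  obtain w where tri: "(UpCounit R A, PPUnit S j A, w) \<in> Tri (Coef S X)"
    using triangle_closed_open A by blast
  interpret adj: exact_adjunction "Coef S X" "Coef S U" "Pull S j" "Push S j" "PPUnit S j" "PPCounit S j"
    by (rule pull_push[OF j_hom])
  have unit: "PPUnit S j A \<in> Hom (Coef S X) A (FO (Push S j) (FO (Pull S j) A))"
    using natural_trans.hom[OF adj.unit_natural A] by (simp add: comp_fun_def)
  note h = CX.homD[OF UpCounit_hom[OF A]] CX.homD[OF unit]
  obtain c' where "c' \<in> Hom (Coef S X) (One (Coef S X)) (ShO (Coef S X) d (pu A))"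
      "ShM (Coef S X) d (UpCounit R A) \<cdot>\<^bsub>Coef S X\<^esub> c' = c"
    using CX.triangle_lift_shift[OF tri, of c "One (Coef S X)" d] c pull_class_Zero[OF j_hom A c zero] h
    by (auto simp: Coh_def)
  then have "c' \<in> Lift S i R d A c"
    by (simp add: Lift_iff forg_eq Coh_def)
  then show ?thesis by blast
qed

section \<open>Localizations as torsors and their functoriality\<close>

lemma LocTor_subset: "A \<in> Obj (Coef S X) \<Longrightarrow> LocTor S i R d A c \<subseteq> Coh S Z d (up A)"
  using supp_adj_Coh by (auto simp: LocTor_def Lift_iff)

text \<open>The kernel of \<open>forg\<close> is the set of lifts of the zero class. Facts about
  localization sets therefore apply to the acting groups as well.\<close>

lemma LocGroup_sel:
  "carrier (LocGroup S i R d A) = LocTor S i R d A (Zero (Coef S X) (One (Coef S X)) (ShO (Coef S X) d A))"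
  "mult (LocGroup S i R d A) = Add (Coef S Z)"
  by (simp_all add: LocGroup_def LocTor_def Lift_def kernel_def)

text \<open>The lifts of \<open>c\<close> form a nonempty coset of the kernel of
  \<open>forg\<close>, and an additive map sends a coset to a coset of the image.\<close>

lemma LocTor_torsor:
  assumes A: "A \<in> Obj (Coef S X)" and c: "c \<in> Coh S X d A"
    and zero: "pull_class S j d A c = Zero (Coef S U) (One (Coef S U)) (ShO (Coef S U) d (FO (Pull S j) A))"
  shows "torsor (LocGroup S i R d A) (LocTor S i R d A c) (LocAct S i R d A c)"
proof -
  interpret sa: group_hom "supp_group S i R d A" "coh_group S Z d (up A)" "supp_adj S i R d A"
    by (rule supp_adj_hom[OF A])
  interpret fg: group_hom "supp_group S i R d A" "coh_group S X d A" "forg S i R d A"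
    by (rule forg_hom[OF A])
  let ?K = "kernel (supp_group S i R d A) (coh_group S X d A) (forg S i R d A)"
  let ?G = "supp_group S i R d A"
  have "torsor ((coh_group S Z d (up A))\<lparr>carrier := supp_adj S i R d A ` ?K\<rparr>) (LocTor S i R d A c)
      (\<lambda>g. \<lambda>l\<in>LocTor S i R d A c. g \<otimes>\<^bsub>coh_group S Z d (up A)\<^esub> l)"
  proof (rule subgroup_torsor)
    show "subgroup (supp_adj S i R d A ` ?K) (coh_group S Z d (up A))"
      by (rule sa.subgroup_img_is_subgroup[OF fg.subgroup_kernel])
    show "LocTor S i R d A c \<subseteq> carrier (coh_group S Z d (up A))"
      using LocTor_subset[OF A] by simp
    show "LocTor S i R d A c \<noteq> {}"
      using Lift_nonempty[OF assms] by (simp add: LocTor_def)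
  next
    fix k x
    assume "k \<in> supp_adj S i R d A ` ?K" "x \<in> LocTor S i R d A c"
    then obtain k' x' where k': "k' \<in> ?K" "k = supp_adj S i R d A k'"
      and x': "x' \<in> carrier ?G" "forg S i R d A x' = c" "x = supp_adj S i R d A x'"
      by (auto simp: LocTor_def Lift_def)
    have "k' \<otimes>\<^bsub>?G\<^esub> x' \<in> Lift S i R d A c"
      using k' x' c fg.hom_mult[of k' x'] fg.H.l_one[of c] by (simp add: Lift_def kernel_def)
    then have "supp_adj S i R d A (k' \<otimes>\<^bsub>?G\<^esub> x') \<in> LocTor S i R d A c"
      by (simp add: LocTor_def)
    then show "k \<otimes>\<^bsub>coh_group S Z d (up A)\<^esub> x \<in> LocTor S i R d A c"
      using k' x' sa.hom_mult[of k' x'] by (simp add: kernel_def)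
  next
    fix x y
    assume "x \<in> LocTor S i R d A c" "y \<in> LocTor S i R d A c"
    then obtain x' y' where x': "x' \<in> carrier ?G" "forg S i R d A x' = c" "x = supp_adj S i R d A x'"
      and y': "y' \<in> carrier ?G" "forg S i R d A y' = c" "y = supp_adj S i R d A y'"
      by (auto simp: LocTor_def Lift_def)
    \<comment> \<open>The difference of two lifts of \<open>c\<close>; \<open>forg\<close> sends it
      to \<open>c - c = 0\<close>.\<close>
    let ?k = "y' \<otimes>\<^bsub>?G\<^esub> inv\<^bsub>?G\<^esub> x'"
    have "?k \<in> ?K"
      using x' y' c fg.hom_mult[of y' "inv\<^bsub>?G\<^esub> x'"] fg.hom_inv[of x'] fg.H.r_inv[of c] by (simp add: kernel_def)
    moreover have "?k \<otimes>\<^bsub>?G\<^esub> x' = y'"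
      using x' y' by (simp add: sa.G.m_assoc)
    then have "supp_adj S i R d A ?k \<otimes>\<^bsub>coh_group S Z d (up A)\<^esub> x = y"
      using x' y' sa.hom_mult[of ?k x'] by simp
    ultimately show "\<exists>k\<in>supp_adj S i R d A ` ?K. k \<otimes>\<^bsub>coh_group S Z d (up A)\<^esub> x = y"
      by blast
  qed (rule coh_group_group, use A in auto)
  then show ?thesis
    by (simp add: LocAct_def LocGroup_def cong: restrict_cong)
qed

text \<open>Composing a lift with \<open>i_* i^! u\<close> gives a lift of the transported class by
  naturality of the counit of \<open>i_*\<close> and \<open>i^!\<close>; the adjoint changes by
  \<open>i^! u\<close>.\<close>

lemma LocTor_natural:
  assumes l: "l \<in> LocTor S i R d A c" and u: "u \<in> Hom (Coef S X) A A'"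
  shows "ShM (Coef S Z) d (FM (UpSh R) u) \<cdot>\<^bsub>Coef S Z\<^esub> l
    \<in> LocTor S i R d A' (ShM (Coef S X) d u \<cdot>\<^bsub>Coef S X\<^esub> c)"
proof -
  note A = CX.homD(4,5)[OF u]
  obtain c' where c': "c' \<in> Coh S X d (pu A)" "forg S i R d A c' = c" "l = supp_adj S i R d A c'"
    using l by (auto simp: LocTor_def Lift_iff)
  note w = Push.hom[OF UpSh.hom[OF u]]
  let ?c = "ShM (Coef S X) d (FM (Push S i) (FM (UpSh R) u)) \<cdot>\<^bsub>Coef S X\<^esub> c'"
  have "?c \<in> Coh S X d (pu A')"
    using CX.comp_hom[OF CX.shift_hom[OF w] c'(1)[unfolded Coh_def]] by (simp add: Coh_def)
  moreover have "forg S i R d A' ?c = ShM (Coef S X) d u \<cdot>\<^bsub>Coef S X\<^esub> c"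
    unfolding c'(2)[symmetric] forg_eq
    by (rule CX.shift_comp_eq_reassoc[OF UpCounit_natural[OF u]])
      (use CX.homD[OF UpCounit_hom[OF A(1)]] CX.homD[OF UpCounit_hom[OF A(2)]] CX.homD[OF u] CX.homD[OF w] c'
        in \<open>auto simp: Coh_def Hom_def\<close>)
  ultimately have "supp_adj S i R d A' ?c \<in> LocTor S i R d A' (ShM (Coef S X) d u \<cdot>\<^bsub>Coef S X\<^esub> c)"
    by (auto simp: LocTor_def Lift_iff)
  then show ?thesis
    using supp_adj_natural[OF c'(1) u] c'(3) by simp
qed

end

section \<open>External product with a class\<close>

text \<open>Both recollements are instances of one locale, so each result on localizations is
  available twice: as \<open>L.\<close> for \<open>i\<close>, and as \<open>L'.\<close> for the
  product of \<open>i\<close> with the identity of \<open>Y\<close>.\<close>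

locale closed_ext_recollement =
  L: recollement_system S Z U X i j R +
  L': recollement_system S "Prod (Sp S) Z Y" "Prod (Sp S) U Y" "Prod (Sp S) X Y"
    "times_id S i Y" "times_id S j Y" R' +
  closed_ext_compatible S i Y R R' \<phi> \<psi>
  for S :: "('s, 'f, 'o, 'm) coeff_system"
    and Z U X Y :: "'s"
    and i j :: "'f"
    and R R' :: "('o, 'm) recol"
    and \<phi> \<psi> :: "'o \<Rightarrow> 'o \<Rightarrow> 'm" +
  assumes Y_obj [simp]: "Y \<in> Obj (Sp S)"
begin

abbreviation "CX \<equiv> Coef S X"
abbreviation "CY \<equiv> Coef S Y"
abbreviation "CZ \<equiv> Coef S Z"
abbreviation "CU \<equiv> Coef S U"
abbreviation "CXY \<equiv> Coef S (Prod (Sp S) X Y)"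
abbreviation "CZY \<equiv> Coef S (Prod (Sp S) Z Y)"
abbreviation "CUY \<equiv> Coef S (Prod (Sp S) U Y)"
abbreviation "I \<equiv> times_id S i Y"
abbreviation "J \<equiv> times_id S j Y"
abbreviation "ext A B \<equiv> BO (Ext S X Y) A B"

sublocale TX: triangulated_bifunctor CX CY CXY "Ext S X Y"
  by (simp add: L.ext_bifunctor)

sublocale TZ: triangulated_bifunctor CZ CY CZY "Ext S Z Y"
  by (simp add: L.ext_bifunctor)

sublocale \<phi>: bi_natural_iso CZ CY CXY "precomp2 (Ext S X Y) (Push S i) id_fun"
    "postcomp2 (Push S I) (Ext S Z Y)" \<phi>
  using push_iso by simp

sublocale \<psi>: bi_natural_iso CX CY CZY "precomp2 (Ext S Z Y) (UpSh R) id_fun"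
    "postcomp2 (UpSh R') (Ext S X Y)" \<psi>
  using shriek_iso by simp

lemma \<phi>_hom:
  "\<lbrakk>M \<in> Obj CZ; N \<in> Obj CY\<rbrakk> \<Longrightarrow>
    \<phi> M N \<in> Hom CXY (BO (Ext S X Y) (FO (Push S i) M) N) (FO (Push S I) (BO (Ext S Z Y) M N))"
  using \<phi>.iso[of M N] by (simp add: Isos_def)

lemma \<psi>_hom:
  "\<lbrakk>M \<in> Obj CX; N \<in> Obj CY\<rbrakk> \<Longrightarrow> \<psi> M N \<in> Hom CZY (BO (Ext S Z Y) (L.up M) N) (L'.up (ext M N))"
  using \<psi>.iso[of M N] by (simp add: Isos_def)

lemma ext_loc_eq:
  "ext_loc S i Y R \<psi> d e A B l \<beta>
    = ShM CZY (d + e) (\<psi> A B) \<cdot>\<^bsub>CZY\<^esub> ext_class S Z Y d e (L.up A) B l \<beta>"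
  by (simp add: ext_loc_def Let_def)

section \<open>Product with \<open>\<beta>\<close> on the closed subspace\<close>

lemma ext_loc_Add:
  assumes A: "A \<in> Obj CX" and B: "B \<in> Obj CY"
    and l: "l \<in> Coh S Z d (L.up A)" and l': "l' \<in> Coh S Z d (L.up A)" and \<beta>: "\<beta> \<in> Coh S Y e B"
  shows "ext_loc S i Y R \<psi> d e A B (Add CZ l l') \<beta>
    = Add CZY (ext_loc S i Y R \<psi> d e A B l \<beta>) (ext_loc S i Y R \<psi> d e A B l' \<beta>)"
proof -
  have E: "L.up A \<in> Obj CZ"
    using A by simp
  note ec = L.ext_class_Coh[OF L.space_obj(1) Y_obj E B _ \<beta>, unfolded Coh_def, folded Coh_def[of S Z]]
  show ?thesis
    using L'.CZ.comp_add_right[OF L'.CZ.shift_hom[OF \<psi>_hom[OF A B]] ec[OF l] ec[OF l']]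
      L.ext_class_Add_left[OF L.space_obj(1) Y_obj E B l l' \<beta>]
    by (simp add: ext_loc_eq)
qed

text \<open>Naturality of the product of classes at \<open>i^! u\<close> and \<open>v\<close>,
  followed by the naturality square of \<open>\<psi>\<close>. Together with
  \<open>LocTor_natural\<close> it makes precise that the morphism of torsors is natural in both
  coefficients.\<close>

lemma ext_loc_natural:
  assumes u: "u \<in> Hom CX A A'" and v: "v \<in> Hom CY B B'"
    and l: "l \<in> Coh S Z d (L.up A)" and \<beta>: "\<beta> \<in> Coh S Y e B"
  shows "ext_loc S i Y R \<psi> d e A' B' (ShM CZ d (FM (UpSh R) u) \<cdot>\<^bsub>CZ\<^esub> l) (ShM CY e v \<cdot>\<^bsub>CY\<^esub> \<beta>)
    = ShM CZY (d + e) (FM (UpSh R') (BM (Ext S X Y) u v)) \<cdot>\<^bsub>CZY\<^esub> ext_loc S i Y R \<psi> d e A B l \<beta>"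
proof -
  note A = L.CX.homD[OF u] and B = TX.C2.homD[OF v]
  have E: "L.up A \<in> Obj CZ"
    using A by simp
  note ec = L.ext_class_Coh[OF L.space_obj(1) Y_obj E B(4) l \<beta>]
  show ?thesis
    unfolding ext_loc_eq L.ext_class_natural[OF L.space_obj(1) Y_obj L.UpSh.hom[OF u] v l \<beta>]
    by (rule L'.CZ.shift_comp_eq_reassoc)
      (use \<psi>.natural[OF u v] L'.CZ.homD[OF \<psi>_hom[OF A(4) B(4)]] L'.CZ.homD[OF \<psi>_hom[OF A(5) B(5)]] A B ec
        in \<open>auto simp: Coh_def Hom_def\<close>)
qed

text \<open>The product formed before passing to adjoints. On the ambient product space both tools
  are at hand: the forgetful map, which identifies it as a lift, and pullback along
  \<open>I\<close>, which computes its adjoint.\<close>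

definition supp_ext :: "int \<Rightarrow> int \<Rightarrow> 'o \<Rightarrow> 'o \<Rightarrow> 'm \<Rightarrow> 'm \<Rightarrow> 'm" where
  "supp_ext d e A B c \<beta> =
     ShM CXY (d + e) (FM (Push S I) (\<psi> A B) \<cdot>\<^bsub>CXY\<^esub> \<phi> (L.up A) B)
       \<cdot>\<^bsub>CXY\<^esub> ext_class S X Y d e (L.pu A) B c \<beta>"

context
  fixes A B :: 'o and d e :: int and c \<beta> :: 'm
  assumes A: "A \<in> Obj CX" and B: "B \<in> Obj CY"
    and c: "c \<in> Coh S X d (L.pu A)" and \<beta>: "\<beta> \<in> Coh S Y e B"
begin

lemma exchange_hom:
  "FM (Push S I) (\<psi> A B) \<cdot>\<^bsub>CXY\<^esub> \<phi> (L.up A) B \<in> Hom CXY (ext (L.pu A) B) (L'.pu (ext A B))"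
  by (rule L'.CX.comp_hom[OF L'.Push.hom[OF \<psi>_hom[OF A B]] \<phi>_hom]) (use A B in auto)

lemma ext_class_pu_Coh: "ext_class S X Y d e (L.pu A) B c \<beta> \<in> Coh S (Prod (Sp S) X Y) (d + e) (ext (L.pu A) B)"
  by (rule L.ext_class_Coh[OF L.space_obj(3) Y_obj _ B c \<beta>]) (use A in simp)

lemma supp_ext_Coh: "supp_ext d e A B c \<beta> \<in> Coh S (Prod (Sp S) X Y) (d + e) (L'.pu (ext A B))"
  using L'.CX.comp_hom[OF L'.CX.shift_hom[OF exchange_hom] ext_class_pu_Coh[unfolded Coh_def]]
  by (simp add: supp_ext_def Coh_def)

text \<open>\<open>shriek_counit\<close> collapses the counit after both exchange maps to the counit
  of \<open>i\<close> times the identity of \<open>B\<close>; naturality of external products then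
  moves it onto \<open>c\<close>.\<close>

lemma forg_supp_ext:
  "forg S I R' (d + e) (ext A B) (supp_ext d e A B c \<beta>) = ext_class S X Y d e A B (forg S i R d A c) \<beta>"
proof -
  note w = L'.CX.homD[OF exchange_hom] and x = L'.CX.homD[OF ext_class_pu_Coh[unfolded Coh_def]]
  note k = L'.CX.homD[OF L'.UpCounit_hom[OF TX.obj[OF A B]]]
  have b: "\<beta> \<in> Arr CY" "Cod CY \<beta> = ShO CY e B"
    using \<beta> by (auto simp: Coh_def Hom_def)
  have "forg S I R' (d + e) (ext A B) (supp_ext d e A B c \<beta>)
      = ShM CXY (d + e) (UpCounit R' (ext A B) \<cdot>\<^bsub>CXY\<^esub> FM (Push S I) (\<psi> A B) \<cdot>\<^bsub>CXY\<^esub> \<phi> (L.up A) B)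
        \<cdot>\<^bsub>CXY\<^esub> ext_class S X Y d e (L.pu A) B c \<beta>"
    unfolding L'.forg_eq supp_ext_def using w x k by (simp del: L'.CX.comp_assoc_arr add: L'.CX.comp_assoc_arr[symmetric])
  also have "UpCounit R' (ext A B) \<cdot>\<^bsub>CXY\<^esub> FM (Push S I) (\<psi> A B) \<cdot>\<^bsub>CXY\<^esub> \<phi> (L.up A) B
      = BM (Ext S X Y) (UpCounit R A) (Id CY B)"
    using shriek_counit[of A B] A B by simp
  also have "ShM CXY (d + e) \<dots> \<cdot>\<^bsub>CXY\<^esub> ext_class S X Y d e (L.pu A) B c \<beta>
      = ext_class S X Y d e A B (forg S i R d A c) (ShM CY e (Id CY B) \<cdot>\<^bsub>CY\<^esub> \<beta>)"
    unfolding L.forg_eq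
    by (rule L.ext_class_natural[OF L.space_obj(3) Y_obj L.UpCounit_hom[OF A] TX.C2.id_hom[OF B] c \<beta>, symmetric])
  finally show ?thesis
    using B b by simp
qed

text \<open>Both adjoints are written as a pullback class followed by a counit. It then remains to
  compare the counit of \<open>I\<close> with that of \<open>i\<close>, and to pull back the
  external product.\<close>

lemma supp_adj_supp_ext:
  "supp_adj S I R' (d + e) (ext A B) (supp_ext d e A B c \<beta>)
    = ext_loc S i Y R \<psi> d e A B (supp_adj S i R d A c) \<beta>"
proof -
  let ?n = "d + e" and ?w = "FM (Push S I) (\<psi> A B) \<cdot>\<^bsub>CXY\<^esub> \<phi> (L.up A) B"
  let ?x = "ext_class S X Y d e (L.pu A) B c \<beta>" and ?E = "L.up A" and ?E' = "L'.up (ext A B)"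
  let ?I = "Pull S I" and ?\<epsilon> = "PPCounit S i (L.up A)" and ?\<epsilon>' = "PPCounit S I"
  let ?P = "ext_pull_id S i Y (L.pu A) B" and ?px = "pull_class S I (d + e) (ext (L.pu A) B) ?x"
  have E: "?E \<in> Obj CZ" "L.pu A \<in> Obj CX"
    using A by simp_all
  note AB = TX.obj[OF A B] and EB = TZ.obj[OF E(1) B] and PB = TX.obj[OF E(2) B]
  note w = L'.CX.homD[OF exchange_hom] and x = ext_class_pu_Coh
  note ps = L'.CZ.homD[OF \<psi>_hom[OF A B]] and ph = L'.CX.homD[OF \<phi>_hom[OF E(1) B]]
  note k = L'.CZ.homD[OF L'.PPCounit_hom[OF L'.UpSh.obj[OF AB]]] L'.CZ.homD[OF L'.PPCounit_hom[OF EB]]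
  note e = L.CZ.homD[OF L.PPCounit_hom[OF E(1)]]
  have b: "\<beta> \<in> Arr CY" "Cod CY \<beta> = ShO CY e B"
    using \<beta> by (auto simp: Coh_def Hom_def)
  have px: "?px \<in> Arr CZY" "Cod CZY ?px = ShO CZY ?n (FO ?I (ext (L.pu A) B))"
    using L.pull_class_Coh[OF L'.i_hom x PB] by (auto simp: Coh_def Hom_def)
  have pc: "pull_class S i d (L.pu A) c \<in> Coh S Z d (FO (Pull S i) (L.pu A))"
    by (rule L.pull_class_Coh[OF L.i_hom c E(2)])
  have ec: "ext_class S Z Y d e ?E B (supp_adj S i R d A c) \<beta> \<in> Coh S (Prod (Sp S) Z Y) ?n (BO (Ext S Z Y) ?E B)"
    by (rule L.ext_class_Coh[OF L.space_obj(1) Y_obj E(1) B L.supp_adj_Coh[OF A c] \<beta>])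
  interpret t: bi_natural_iso CX CY CZY "postcomp2 ?I (Ext S X Y)"
      "precomp2 (Ext S Z Y) (Pull S i) (Pull S (Id (Sp S) Y))" "ExtPull S i (Id (Sp S) Y)"
    by (rule L.ext_pull[OF L.i_hom L.Sp.id_hom[OF Y_obj]])
  have pid: "PullId S Y B \<in> Hom CY (FO (Pull S (Id (Sp S) Y)) B) B"
    using natural_trans.hom[OF natural_iso.axioms(1)[OF L.pull_id[OF Y_obj]] B] by simp
  have P: "?P \<in> Arr CZY" "Dom CZY ?P = FO ?I (ext (L.pu A) B)" "Cod CZY ?P = BO (Ext S Z Y) (FO (Pull S i) (L.pu A)) B"
    using t.component_arr[OF E(2) B] TX.C2.homD[OF pid] E B by (simp_all add: ext_pull_id_def Let_def)
  \<comment> \<open>Naturality of the counit of \<open>I\<close> moves \<open>\<psi>\<close> out to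
    the left; \<open>pull_counit\<close> turns what remains into the counit of \<open>i\<close>
    after \<open>ext_pull_id\<close>, exactly the map that \<open>pull_ext_class_id\<close>
    expects.\<close>
  have "?\<epsilon>' ?E' \<cdot>\<^bsub>CZY\<^esub> FM ?I ?w = (?\<epsilon>' ?E' \<cdot>\<^bsub>CZY\<^esub> FM ?I (FM (Push S I) (\<psi> A B))) \<cdot>\<^bsub>CZY\<^esub> FM ?I (\<phi> ?E B)"
    using ps ph k by simp
  also have "\<dots> = \<psi> A B \<cdot>\<^bsub>CZY\<^esub> (?\<epsilon>' (BO (Ext S Z Y) ?E B) \<cdot>\<^bsub>CZY\<^esub> FM ?I (\<phi> ?E B))"
    unfolding L'.PPCounit_natural[OF \<psi>_hom[OF A B]] using ps ph k by simp
  also have "?\<epsilon>' (BO (Ext S Z Y) ?E B) \<cdot>\<^bsub>CZY\<^esub> FM ?I (\<phi> ?E B) = BM (Ext S Z Y) ?\<epsilon> (Id CY B) \<cdot>\<^bsub>CZY\<^esub> ?P"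
    using pull_counit[of ?E B] E B by simp
  finally have eq: "?\<epsilon>' ?E' \<cdot>\<^bsub>CZY\<^esub> FM ?I ?w = \<psi> A B \<cdot>\<^bsub>CZY\<^esub> (BM (Ext S Z Y) ?\<epsilon> (Id CY B) \<cdot>\<^bsub>CZY\<^esub> ?P)" .
  have "supp_adj S I R' ?n (ext A B) (supp_ext d e A B c \<beta>)
      = ShM CZY ?n (?\<epsilon>' ?E') \<cdot>\<^bsub>CZY\<^esub> (ShM CZY ?n (FM ?I ?w) \<cdot>\<^bsub>CZY\<^esub> ?px)"
    using L'.supp_adj_eq[OF AB supp_ext_Coh] L.pull_class_natural[OF L'.i_hom x exchange_hom]
    by (simp add: supp_ext_def)
  also have "\<dots> = ShM CZY ?n (\<psi> A B) \<cdot>\<^bsub>CZY\<^esub> (ShM CZY ?n (BM (Ext S Z Y) ?\<epsilon> (Id CY B) \<cdot>\<^bsub>CZY\<^esub> ?P) \<cdot>\<^bsub>CZY\<^esub> ?px)"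
    by (rule L'.CZ.shift_comp_eq_reassoc[OF eq]) (use w ps k e P px B E in simp_all)
  also have "\<dots> = ShM CZY ?n (\<psi> A B) \<cdot>\<^bsub>CZY\<^esub> (ShM CZY ?n (BM (Ext S Z Y) ?\<epsilon> (Id CY B)) \<cdot>\<^bsub>CZY\<^esub> (ShM CZY ?n ?P \<cdot>\<^bsub>CZY\<^esub> ?px))"
    using ps e P px B E by simp
  also have "ShM CZY ?n ?P \<cdot>\<^bsub>CZY\<^esub> ?px = ext_class S Z Y d e (FO (Pull S i) (L.pu A)) B (pull_class S i d (L.pu A) c) \<beta>"
    by (rule L.pull_ext_class_id[OF L.i_hom Y_obj E(2) B c \<beta>])
  also have "ShM CZY ?n (BM (Ext S Z Y) ?\<epsilon> (Id CY B)) \<cdot>\<^bsub>CZY\<^esub> \<dots>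
      = ext_class S Z Y d e ?E B (ShM CZ d ?\<epsilon> \<cdot>\<^bsub>CZ\<^esub> pull_class S i d (L.pu A) c) (ShM CY e (Id CY B) \<cdot>\<^bsub>CY\<^esub> \<beta>)"
    by (rule L.ext_class_natural[OF L.space_obj(1) Y_obj L.PPCounit_hom[OF E(1)] TX.C2.id_hom[OF B] pc \<beta>, symmetric])
  finally show ?thesis
    using L.supp_adj_eq[OF A c] B b by (simp add: ext_loc_eq)
qed

end

section \<open>Passage to the localization torsors\<close>

lemma ext_loc_LocTor:
  assumes A: "A \<in> Obj CX" and B: "B \<in> Obj CY" and \<beta>: "\<beta> \<in> Coh S Y e B" and l: "l \<in> LocTor S i R d A c"
  shows "ext_loc S i Y R \<psi> d e A B l \<beta> \<in> LocTor S I R' (d + e) (ext A B) (ext_class S X Y d e A B c \<beta>)"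
proof -
  obtain c' where c': "c' \<in> Coh S X d (L.pu A)" "forg S i R d A c' = c" "l = supp_adj S i R d A c'"
    using l by (auto simp: LocTor_def L.Lift_iff)
  then have "supp_ext d e A B c' \<beta> \<in> Lift S I R' (d + e) (ext A B) (ext_class S X Y d e A B c \<beta>)"
    using supp_ext_Coh[OF A B c'(1) \<beta>] forg_supp_ext[OF A B c'(1) \<beta>] by (simp add: L'.Lift_iff)
  then show ?thesis
    using supp_adj_supp_ext[OF A B c'(1) \<beta>] c'(3) by (force simp: LocTor_def)
qed

text \<open>Additivity in the first class makes the product idempotent. The space \<open>W\<close>
  is left open because the result is used over \<open>X\<close> for the acting groups and over
  \<open>U\<close> for vanishing on the open complement.\<close>

lemma ext_class_Zero_left:
  assumes W: "W \<in> Obj (Sp S)" and A: "A \<in> Obj (Coef S W)" and B: "B \<in> Obj CY" and \<beta>: "\<beta> \<in> Coh S Y e B"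
  shows "ext_class S W Y d e A B (Zero (Coef S W) (One (Coef S W)) (ShO (Coef S W) d A)) \<beta>
    = Zero (Coef S (Prod (Sp S) W Y)) (One (Coef S (Prod (Sp S) W Y)))
        (ShO (Coef S (Prod (Sp S) W Y)) (d + e) (BO (Ext S W Y) A B))"
proof -
  interpret T: triangulated_bifunctor "Coef S W" CY "Coef S (Prod (Sp S) W Y)" "Ext S W Y"
    by (rule L.ext_bifunctor[OF W Y_obj])
  let ?z = "Zero (Coef S W) (One (Coef S W)) (ShO (Coef S W) d A)"
  have z: "?z \<in> Hom (Coef S W) (One (Coef S W)) (ShO (Coef S W) d A)"
    by (rule T.C1.Zero_hom) (use W A L.one_obj in simp_all)
  then have zC: "?z \<in> Coh S W d A"
    by (simp add: Coh_def)
  show ?thesis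
    by (rule T.D.Add_idem_zero[OF L.ext_class_Coh[OF W Y_obj A B zC \<beta>, unfolded Coh_def]])
      (use L.ext_class_Add_left[OF W Y_obj A B zC zC \<beta>] T.C1.Add_Zero(1)[OF z] in simp)
qed

lemma pull_ext_class_Zero:
  assumes A: "A \<in> Obj CX" and B: "B \<in> Obj CY" and c: "c \<in> Coh S X d A" and \<beta>: "\<beta> \<in> Coh S Y e B"
    and zero: "pull_class S j d A c = Zero CU (One CU) (ShO CU d (FO (Pull S j) A))"
  shows "pull_class S J (d + e) (ext A B) (ext_class S X Y d e A B c \<beta>)
    = Zero CUY (One CUY) (ShO CUY (d + e) (FO (Pull S J) (ext A B)))"
proof -
  let ?id = "Id (Sp S) Y" and ?n = "d + e" and ?x = "ext_class S X Y d e A B c \<beta>"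
  let ?t = "ExtPull S j ?id A B" and ?W = "BO (Ext S U Y) (FO (Pull S j) A) (FO (Pull S ?id) B)"
  have id: "?id \<in> Hom (Sp S) Y Y"
    by (rule L.Sp.id_hom[OF Y_obj])
  interpret UY: triangulated_category CUY
    by (simp add: L.coef_triangulated)
  interpret PJ: shift_functor CXY CUY "Pull S J"
    by (rule L.pull_shift_functor[OF L'.j_hom])
  interpret j: shift_functor CX CU "Pull S j"
    by (rule L.pull_shift_functor[OF L.j_hom])
  interpret Pid: shift_functor CY CY "Pull S ?id"
    by (rule L.pull_shift_functor[OF id])
  interpret t: bi_natural_iso CX CY CUY "postcomp2 (Pull S J) (Ext S X Y)"
      "precomp2 (Ext S U Y) (Pull S j) (Pull S ?id)" "ExtPull S j ?id"
    by (rule L.ext_pull[OF L.j_hom id])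
  note AB = TX.obj[OF A B]
  have one: "One CUY \<in> Obj CUY"
    by (rule L.one_obj) simp
  have t: "ShM CUY ?n ?t \<in> Isos CUY (ShO CUY ?n (FO (Pull S J) (ext A B))) (ShO CUY ?n ?W)"
    using UY.shift_iso(1)[OF t.iso[OF A B]] by simp
  have px: "pull_class S J ?n (ext A B) ?x \<in> Hom CUY (One CUY) (ShO CUY ?n (FO (Pull S J) (ext A B)))"
    using L.pull_class_Coh[OF L'.j_hom L.ext_class_Coh[OF L.space_obj(3) Y_obj A B c \<beta>] AB]
    by (simp add: Coh_def)
  have "ShM CUY ?n ?t \<cdot>\<^bsub>CUY\<^esub> pull_class S J ?n (ext A B) ?x
      = ext_class S U Y d e (FO (Pull S j) A) (FO (Pull S ?id) B) (pull_class S j d A c) (pull_class S ?id e B \<beta>)"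
    by (rule L.pull_ext_class[OF L.j_hom id A B c \<beta>])
  also have "\<dots> = Zero CUY (One CUY) (ShO CUY ?n ?W)"
    unfolding zero by (rule ext_class_Zero_left) (use A B L.pull_class_Coh[OF id \<beta> B] in auto)
  also have "\<dots> = ShM CUY ?n ?t \<cdot>\<^bsub>CUY\<^esub> Zero CUY (One CUY) (ShO CUY ?n (FO (Pull S J) (ext A B)))"
    by (rule UY.comp_Zero_right[OF Isos_Hom[OF t] one, symmetric])
  \<comment> \<open>\<open>ExtPull\<close> is an isomorphism, hence so is its shift, and it cancels
    from both sides.\<close>
  finally show ?thesis
    by (rule UY.iso_cancel_left[OF t px UY.Zero_hom, rotated 2]) (use one AB in auto)
qed

text \<open>Equivariance is additivity of \<open>f\<close>: both actions are addition in the ambient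
  group of classes, and the homomorphism of acting groups is \<open>f\<close> itself.\<close>

lemma ext_loc_torsor_morphism:
  assumes A: "A \<in> Obj CX" and B: "B \<in> Obj CY" and c: "c \<in> Coh S X d A" and \<beta>: "\<beta> \<in> Coh S Y e B"
    and zero: "pull_class S j d A c = Zero CU (One CU) (ShO CU d (FO (Pull S j) A))"
  defines "x \<equiv> ext_class S X Y d e A B c \<beta>" and "f \<equiv> \<lambda>l. ext_loc S i Y R \<psi> d e A B l \<beta>"
  shows "torsor_morphism
    (LocGroup S i R d A) (LocTor S i R d A c) (LocAct S i R d A c)
    (LocGroup S I R' (d + e) (ext A B)) (LocTor S I R' (d + e) (ext A B) x) (LocAct S I R' (d + e) (ext A B) x) f f"
  unfolding torsor_morphism_def
proof (intro conjI ballI)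
  note sub = L.LocTor_subset[OF A, THEN subsetD]
  have Add: "f (Add CZ g l) = Add CZY (f g) (f l)"
    if "g \<in> Coh S Z d (L.up A)" "l \<in> Coh S Z d (L.up A)" for g l
    unfolding f_def using that by (intro ext_loc_Add[OF A B _ _ \<beta>])
  \<comment> \<open>The acting groups are the localization sets of zero classes, and the product of
    0 with \<open>\<beta>\<close> is 0; hence the general statement on localization sets
    applies.\<close>
  have grp: "f g \<in> carrier (LocGroup S I R' (d + e) (ext A B))" if "g \<in> carrier (LocGroup S i R d A)" for g
    using ext_loc_LocTor[OF A B \<beta>, of g d "Zero CX (One CX) (ShO CX d A)"] that
      ext_class_Zero_left[OF L.space_obj(3) A B \<beta>, of d]
    by (simp add: L.LocGroup_sel L'.LocGroup_sel f_def)
  show "torsor (LocGroup S i R d A) (LocTor S i R d A c) (LocAct S i R d A c)"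
    by (rule L.LocTor_torsor[OF A c zero])
  show "torsor (LocGroup S I R' (d + e) (ext A B)) (LocTor S I R' (d + e) (ext A B) x) (LocAct S I R' (d + e) (ext A B) x)"
    unfolding x_def
    by (rule L'.LocTor_torsor[OF TX.obj[OF A B] L.ext_class_Coh[OF L.space_obj(3) Y_obj A B c \<beta>]
          pull_ext_class_Zero[OF A B c \<beta> zero]])
  show "f \<in> hom (LocGroup S i R d A) (LocGroup S I R' (d + e) (ext A B))"
    by (rule homI) (use grp Add sub in \<open>simp_all add: L.LocGroup_sel L'.LocGroup_sel\<close>)
  show T: "f \<in> LocTor S i R d A c \<rightarrow> LocTor S I R' (d + e) (ext A B) x"
    using ext_loc_LocTor[OF A B \<beta>] by (simp add: f_def x_def)
  fix g l
  assume "g \<in> carrier (LocGroup S i R d A)" and l: "l \<in> LocTor S i R d A c"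
  then have "f (g \<otimes>\<^bsub>LocGroup S i R d A\<^esub> l) = f g \<otimes>\<^bsub>LocGroup S I R' (d + e) (ext A B)\<^esub> f l"
    using Add[of g l] sub by (simp add: L.LocGroup_sel L'.LocGroup_sel)
  then show "f (LocAct S i R d A c g l) = LocAct S I R' (d + e) (ext A B) x (f g) (f l)"
    using l T by (simp add: LocAct_def Pi_iff)
qed

end

theorem proposition4p18:
  fixes S :: "('s, 'f, 'o, 'm) coeff_system"
    and Z U X Y :: "'s"
    and i j I J :: "'f"
    and R R' :: "('o, 'm) recol"
    and \<phi> \<psi> :: "'o \<Rightarrow> 'o \<Rightarrow> 'm"
    and A B AB :: "'o"
    and d e :: int
    and c \<beta> c\<beta> :: "'m"
  assumes "coefficient_system S"
    and "Y \<in> Obj (Sp S)"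
    and "recollement S Z U X i j R"
    and I_def: "I = prod_map (Sp S) i (Id (Sp S) Y)"
    and J_def: "J = prod_map (Sp S) j (Id (Sp S) Y)"
    and "recollement S (Prod (Sp S) Z Y) (Prod (Sp S) U Y) (Prod (Sp S) X Y) I J R'"
    and "A \<in> Obj (Coef S X)"
    and "B \<in> Obj (Coef S Y)"
    and "c \<in> Coh S X d A"
    and "pull_class S j d A c = Zero (Coef S U) (One (Coef S U)) (ShO (Coef S U) d (FO (Pull S j) A))"
    and "\<beta> \<in> Coh S Y e B"
    and "closed_ext_compatible S i Y R R' \<phi> \<psi>"
    and AB_def: "AB = BO (Ext S X Y) A B"
    and c\<beta>_def: "c\<beta> = ext_class S X Y d e A B c \<beta>"
  shows "pull_class S J (d + e) AB c\<beta> =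
      Zero (Coef S (Prod (Sp S) U Y)) (One (Coef S (Prod (Sp S) U Y)))
        (ShO (Coef S (Prod (Sp S) U Y)) (d + e) (FO (Pull S J) AB)) \<and>
    torsor_morphism
      (LocGroup S i R d A) (LocTor S i R d A c) (LocAct S i R d A c)
      (LocGroup S I R' (d + e) AB) (LocTor S I R' (d + e) AB c\<beta>) (LocAct S I R' (d + e) AB c\<beta>)
      (\<lambda>g. ext_loc S i Y R \<psi> d e A B g \<beta>) (\<lambda>l. ext_loc S i Y R \<psi> d e A B l \<beta>) \<and>
    (\<forall>A' B'. \<forall>u \<in> Hom (Coef S X) A A'. \<forall>v \<in> Hom (Coef S Y) B B'. \<forall>l \<in> LocTor S i R d A c.
      ShM (Coef S Z) d (FM (UpSh R) u) \<cdot>\<^bsub>Coef S Z\<^esub> l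
        \<in> LocTor S i R d A' (ShM (Coef S X) d u \<cdot>\<^bsub>Coef S X\<^esub> c) \<and>
      ext_loc S i Y R \<psi> d e A' B' (ShM (Coef S Z) d (FM (UpSh R) u) \<cdot>\<^bsub>Coef S Z\<^esub> l)
          (ShM (Coef S Y) e v \<cdot>\<^bsub>Coef S Y\<^esub> \<beta>) =
        ShM (Coef S (Prod (Sp S) Z Y)) (d + e) (FM (UpSh R') (BM (Ext S X Y) u v))
          \<cdot>\<^bsub>Coef S (Prod (Sp S) Z Y)\<^esub> ext_loc S i Y R \<psi> d e A B l \<beta>) \<and>
    (is_singleton (LocTor S i R d A c) \<and> is_singleton (LocTor S I R' (d + e) AB c\<beta>) \<longrightarrow>
      Loc S I R' (d + e) AB c\<beta> = ext_loc S i Y R \<psi> d e A B (Loc S i R d A c) \<beta>)"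
proof -
  interpret closed_ext_recollement S Z U X Y i j R R' \<phi> \<psi>
    using assms(1-3,6,12) by (simp add: closed_ext_recollement_def closed_ext_recollement_axioms_def
        recollement_system_def I_def J_def)
  note A = assms(7) and B = assms(8) and c = assms(9) and zero = assms(10) and \<beta> = assms(11)
  let ?T = "LocTor S i R d A c" and ?T' = "LocTor S I R' (d + e) AB c\<beta>"
  let ?f = "\<lambda>l. ext_loc S i Y R \<psi> d e A B l \<beta>"
  have maps: "?f l \<in> ?T'" if "l \<in> ?T" for l
    unfolding I_def AB_def c\<beta>_def by (rule ext_loc_LocTor[OF A B \<beta> that])
  \<comment> \<open>The image of the single element of \<open>?T\<close> lies in \<open>?T'\<close>,
    so it must be the single element there.\<close>
  have "Loc S I R' (d + e) AB c\<beta> = ?f (Loc S i R d A c)" if "is_singleton ?T" "is_singleton ?T'"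
    using that maps by (auto simp: is_singleton_def Loc_def)
  then show ?thesis
    using pull_ext_class_Zero[OF A B c \<beta> zero] ext_loc_torsor_morphism[OF A B c \<beta> zero]
      L.LocTor_natural ext_loc_natural[OF _ _ L.LocTor_subset[OF A, THEN subsetD] \<beta>]
    unfolding I_def J_def AB_def c\<beta>_def by blast
qed

end
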